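(* Let $\Gamma$ be a finite simple undirected graph with vertex set $X$, let $G=G(\Gamma)$ be the partially commutative group with commutation graph $\Gamma$, and let $L=L(\Gamma)$ be the lattice of closed subsets of $X$. The map $\pi:\operatorname{St}(L)\to\operatorname{GL}(|X|,\mathbb{Z})$ given by $\phi\mapsto[\phi]$ is an injective homomorphism with image $S_X$. In particular $S_X$ is a group. Moreover the group $\operatorname{St}(L)$ is generated by the elements of $J$, $V_\perp$ and $\operatorname{Tr}_\perp$, and is an arithmetic group.
   Context: Graphs and closed sets. For $Y\subseteq X$ the orthogonal complement is $Y^\perp=\{u\in X : d(u,y)\le 1 \text{ for all } y\in Y\}$, where $d$ is the graph distance in $\Gamma$ (infinite if there is no path); $\emptyset^\perp=X$, and $x^\perp=\{x\}^\perp$ for $x\in X$. The closure is $\operatorname{cl}(Y)=Y^{\perp\perp}$, and $\operatorname{cl}(x)=\operatorname{cl}(\{x\})$. $Y$ is closed if $Y=\operatorname{cl}(Y)$. $L$ is the set of all closed subsets of $X$, ordered by inclusion. For $x,y\in X$ write $x<_L y$ if $\operatorname{cl}(x)\subsetneq\operatorname{cl}(y)$. Write $x\sim y$ if $x^\perp=y^\perp$ (equivalently $\operatorname{cl}(x)=\operatorname{cl}(y)$); $[x]$ is the equivalence class of $x$. Groups. $G=G(\Gamma)$ is the group with generating set $X$ and defining relations $xy=yx$ for all pairs of adjacent vertices $x,y$ of $\Gamma$. For $Y\subseteq X$, $G(Y)$ is the subgroup of $G$ generated by $Y$. Automorphisms act on the right ($g\mapsto g^\phi$, $g^{\phi\psi}=(g^\phi)^\psi$).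 The stabiliser of $L$ is $\operatorname{St}(L)=\{\phi\in\operatorname{Aut}(G): G(Y)^\phi=G(Y)\text{ for all }Y\in L\}$. The sets $J$, $V_\perp$, $\operatorname{Tr}_\perp$. Each class $[x]$ is a set of pairwise adjacent vertices, and every $\phi\in\operatorname{Aut}(G([x]))$ extends to an automorphism $\phi^{\varepsilon_x}$ of $G$ which equals $\phi$ on $G([x])$ and fixes every element of $X\setminus[x]$. (i) $J$ is the group of automorphisms of $G$ which send each $x\in X$ to $x$ or $x^{-1}$ (independently for each $x$). (ii) $V_\perp$ is the subgroup $\prod_{[x]:\,|[x]|\ge 2}\operatorname{Aut}(G([x]))^{\varepsilon_x}$ of $\operatorname{Aut}(G)$ (an internal direct product over the equivalence classes with at least two elements). (iii) For distinct $x,y\in X$ with $x^\perp\setminus\{x\}\subseteq y^\perp$, $\operatorname{tr}_{x,y}$ is the automorphism of $G$ with $x\mapsto xy$ and $z\mapsto z$ for $z\in X\setminus\{x\}$. $\operatorname{Tr}_\perp$ is the set of those $\operatorname{tr}_{x,y}$ for which $\operatorname{cl}(y)\subsetneq\operatorname{cl}(x)$. The total order $\prec$ on $X$. The height $h(x)$ of $x\in X$ is $0$ if no $y$ satisfies $y<_L x$, and otherwise $h(x)=1+\max\{h(y): y<_L x\}$; it depends only on $[x]$. For each $i$, fix a total order on the (finite) set $B_i=\{\operatorname{cl}(x): h(x)=i\}$, and fix a total order on each class $[x]$. Then $u\prec v$ if and only if: $h(u)>h(v)$; or $h(u)=h(v)$ and $\operatorname{cl}(v)$ precedes $\operatorname{cl}(u)$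 in the order on $B_{h(u)}$; or $[u]=[v]$ and $u$ precedes $v$ in the order on $[u]$. (Thus $x<_L y$ implies $y\prec x$, and each class $[x]$ is an interval for $\prec$.) This order is fixed. The matrix $[\phi]$. Write $X=\{x_1,\dots,x_k\}$ with $x_1\prec\cdots\prec x_k$. For $\phi\in\operatorname{St}(L)$ we have $x_i^\phi\in G(\operatorname{cl}(x_i))$, which is free abelian with basis $\operatorname{cl}(x_i)$; write uniquely $x_i^\phi=x_1^{a_{i,1}}\cdots x_k^{a_{i,k}}$ with $a_{i,j}\in\mathbb{Z}$ and $a_{i,j}=0$ if $x_j\notin\operatorname{cl}(x_i)$. Then $[\phi]=(a_{i,j})_{1\le i,j\le k}$. The set $S_X$. $S_X$ is the set of $k\times k$ integer matrices $A=(a_{i,j})$ such that: (1) for each equivalence class $[v]$, the diagonal block of $A$ consisting of the entries $a_{i,j}$ with $x_i,x_j\in[v]$ belongs to $\operatorname{GL}(|[v]|,\mathbb{Z})$; (2) if $i>j$ and $a_{i,j}$ is not in one of these diagonal blocks then $a_{i,j}=0$; (3) if $i<j$ and $a_{i,j}$ is not in a diagonal block then $a_{i,j}=0$ unless $x_j<_L x_i$, in which case $a_{i,j}$ may be any integer. Arithmetic groups. Two subgroups $A,B$ of a group are commensurable if $A\cap B$ has finite index in both. A linear algebraic group is $\mathbb{Q}$-defined if it is a subgroup of $\operatorname{GL}(n,\mathbb{C})$ defined by polynomials over $\mathbb{Q}$ whose group operations are morphisms defined over $\mathbb{Q}$. If $H$ is a $\mathbb{Q}$-defined linear algebraic group,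 a subgroup $A\subseteq H\cap\operatorname{GL}(n,\mathbb{Q})$ is an arithmetic subgroup of $H$ if it is commensurable with $H\cap\operatorname{GL}(n,\mathbb{Z})$. A group is arithmetic if it is isomorphic to an arithmetic subgroup of a $\mathbb{Q}$-defined linear algebraic group. *)

theory Defs
  imports
    Complex_Main
    "HOL-Algebra.Bij"
    "HOL-Algebra.Generated_Groups"
    "HOL-Library.Poly_Mapping"
    "Graph_Theory.Pair_Digraph"
    "Graph_Theory.Shortest_Path"
    "Jordan_Normal_Form.Determinant"
    "Jordan_Normal_Form.DL_Submatrix"
begin

section \<open>Closed sets of a graph\<close>

text \<open>A finite simple undirected graph is a \<open>pair_graph\<close>: a finite vertex set \<open>pverts \<Gamma>\<close> and a
  symmetric, loop-free set \<open>parcs \<Gamma>\<close> of ordered pairs of vertices.\<close>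

definition graph_dist :: "'a pair_pre_digraph \<Rightarrow> 'a \<Rightarrow> 'a \<Rightarrow> ereal" where
  "graph_dist \<Gamma> u v = wf_digraph.\<mu> (with_proj \<Gamma>) (\<lambda>_. 1) u v"

definition orth :: "'a pair_pre_digraph \<Rightarrow> 'a set \<Rightarrow> 'a set" where
  "orth \<Gamma> Y = {u \<in> pverts \<Gamma>. \<forall>y\<in>Y. graph_dist \<Gamma> u y \<le> 1}"

definition cl :: "'a pair_pre_digraph \<Rightarrow> 'a set \<Rightarrow> 'a set" where
  "cl \<Gamma> Y = orth \<Gamma> (orth \<Gamma> Y)"

definition closed_sets :: "'a pair_pre_digraph \<Rightarrow> 'a set set" where
  "closed_sets \<Gamma> = {Y. Y \<subseteq> pverts \<Gamma> \<and> Y = cl \<Gamma> Y}"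

definition less_L :: "'a pair_pre_digraph \<Rightarrow> 'a \<Rightarrow> 'a \<Rightarrow> bool" where
  "less_L \<Gamma> x y \<longleftrightarrow> cl \<Gamma> {x} \<subset> cl \<Gamma> {y}"

definition eq_class :: "'a pair_pre_digraph \<Rightarrow> 'a \<Rightarrow> 'a set" where
  "eq_class \<Gamma> x = {y \<in> pverts \<Gamma>. orth \<Gamma> {x} = orth \<Gamma> {y}}"


section \<open>The total order on the vertices\<close>

text \<open>The finiteness guard only makes the recursion terminate for every argument.\<close>

function height :: "'a pair_pre_digraph \<Rightarrow> 'a \<Rightarrow> nat" where
  "height \<Gamma> x =
    (if finite (pverts \<Gamma>) \<and> (\<exists>y\<in>pverts \<Gamma>. less_L \<Gamma> y x)
     then 1 + Max (height \<Gamma> ` {y \<in> pverts \<Gamma>. less_L \<Gamma> y x})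
     else 0)"
  by pat_completeness auto
termination
proof (relation "measure (\<lambda>(\<Gamma>, x). card (cl \<Gamma> {x}))", goal_cases)
  case 1
  show ?case by simp
next
  case (2 \<Gamma> x y)
  have "finite (cl \<Gamma> {x})"
    using 2(1) by (auto simp: cl_def orth_def)
  then show ?case
    using 2(2) by (auto simp: less_L_def intro: psubset_card_mono)
qed

declare height.simps [simp del]

definition height_level :: "'a pair_pre_digraph \<Rightarrow> nat \<Rightarrow> 'a set set" where
  "height_level \<Gamma> i = {cl \<Gamma> {x} | x. x \<in> pverts \<Gamma> \<and> height \<Gamma> x = i}"

text \<open>The chosen (reflexive) total orders are \<open>rB i\<close> on \<open>height_level \<Gamma> i\<close> and \<open>rC C\<close> on each
  class \<open>C\<close>; the resulting order on vertices is the strict one. Note the reversal in the second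
  clause.\<close>

definition vertex_less ::
  "'a pair_pre_digraph \<Rightarrow> (nat \<Rightarrow> 'a set rel) \<Rightarrow> ('a set \<Rightarrow> 'a rel) \<Rightarrow> 'a \<Rightarrow> 'a \<Rightarrow> bool" where
  "vertex_less \<Gamma> rB rC u v \<longleftrightarrow>
     height \<Gamma> u > height \<Gamma> v \<or>
     (height \<Gamma> u = height \<Gamma> v \<and> cl \<Gamma> {v} \<noteq> cl \<Gamma> {u} \<and>
        (cl \<Gamma> {v}, cl \<Gamma> {u}) \<in> rB (height \<Gamma> u)) \<or>
     (eq_class \<Gamma> u = eq_class \<Gamma> v \<and> u \<noteq> v \<and> (u, v) \<in> rC (eq_class \<Gamma> u))"


section \<open>Partially commutative groups\<close>

text \<open>Words over the alphabet of generators and formal inverses: \<open>(x, True)\<close> stands for the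
  generator \<open>x\<close> and \<open>(x, False)\<close> for its inverse.\<close>

type_synonym 'a word = "('a \<times> bool) list"

text \<open>The congruence on words generated by free cancellation and by the relations in \<open>R\<close>,
  a pair \<open>(u, v)\<close> standing for the relation \<open>u = v\<close>.\<close>

inductive_set pres_rel :: "'a set \<Rightarrow> ('a word \<times> 'a word) set \<Rightarrow> ('a word \<times> 'a word) set"
  for X :: "'a set" and R :: "('a word \<times> 'a word) set" where
  refl: "w \<in> lists (X \<times> UNIV) \<Longrightarrow> (w, w) \<in> pres_rel X R"
| sym: "(u, v) \<in> pres_rel X R \<Longrightarrow> (v, u) \<in> pres_rel X R"
| trans: "(u, v) \<in> pres_rel X R \<Longrightarrow> (v, w) \<in> pres_rel X R \<Longrightarrow> (u, w) \<in> pres_rel X R"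
| cancel: "a \<in> lists (X \<times> UNIV) \<Longrightarrow> b \<in> lists (X \<times> UNIV) \<Longrightarrow> x \<in> X \<Longrightarrow>
     (a @ [(x, e), (x, \<not> e)] @ b, a @ b) \<in> pres_rel X R"
| relator: "a \<in> lists (X \<times> UNIV) \<Longrightarrow> b \<in> lists (X \<times> UNIV) \<Longrightarrow> (u, v) \<in> R \<Longrightarrow>
     (a @ u @ b, a @ v @ b) \<in> pres_rel X R"

definition presented_group :: "'a set \<Rightarrow> ('a word \<times> 'a word) set \<Rightarrow> 'a word set monoid" where
  "presented_group X R =
    \<lparr>carrier = lists (X \<times> UNIV) // pres_rel X R,
     monoid.mult = (\<lambda>A B. \<Union>a\<in>A. \<Union>b\<in>B. pres_rel X R `` {a @ b}),
     one = pres_rel X R `` {[]}\<rparr>"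

definition comm_relations :: "'a pair_pre_digraph \<Rightarrow> ('a word \<times> 'a word) set" where
  "comm_relations \<Gamma> =
    {([(x, True), (y, True)], [(y, True), (x, True)]) | x y. (x, y) \<in> parcs \<Gamma>}"

definition pc_group :: "'a pair_pre_digraph \<Rightarrow> 'a word set monoid" where
  "pc_group \<Gamma> = presented_group (pverts \<Gamma>) (comm_relations \<Gamma>)"

definition pc_gen :: "'a pair_pre_digraph \<Rightarrow> 'a \<Rightarrow> 'a word set" where
  "pc_gen \<Gamma> x = pres_rel (pverts \<Gamma>) (comm_relations \<Gamma>) `` {[(x, True)]}"

definition pc_sub :: "'a pair_pre_digraph \<Rightarrow> 'a set \<Rightarrow> 'a word set set" where
  "pc_sub \<Gamma> Y = generate (pc_group \<Gamma>) (pc_gen \<Gamma> ` Y)"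


section \<open>Automorphisms\<close>

text \<open>Automorphisms act on the right, so the product \<open>\<phi>\<psi>\<close> means first \<open>\<phi>\<close>, then \<open>\<psi>\<close>; this is
  the opposite of the multiplication of \<open>AutoGroup\<close>.\<close>

definition right_Aut :: "('g, 'm) monoid_scheme \<Rightarrow> ('g \<Rightarrow> 'g) monoid" where
  "right_Aut G = (AutoGroup G)\<lparr>monoid.mult := \<lambda>\<phi> \<psi>. \<psi> \<otimes>\<^bsub>AutoGroup G\<^esub> \<phi>\<rparr>"

definition St_L :: "'a pair_pre_digraph \<Rightarrow> ('a word set \<Rightarrow> 'a word set) set" where
  "St_L \<Gamma> = {\<phi> \<in> auto (pc_group \<Gamma>). \<forall>Y\<in>closed_sets \<Gamma>. \<phi> ` pc_sub \<Gamma> Y = pc_sub \<Gamma> Y}"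

definition J_set :: "'a pair_pre_digraph \<Rightarrow> ('a word set \<Rightarrow> 'a word set) set" where
  "J_set \<Gamma> = {\<phi> \<in> auto (pc_group \<Gamma>). \<forall>x\<in>pverts \<Gamma>.
     \<phi> (pc_gen \<Gamma> x) = pc_gen \<Gamma> x \<or> \<phi> (pc_gen \<Gamma> x) = inv\<^bsub>pc_group \<Gamma>\<^esub> pc_gen \<Gamma> x}"

definition ext_aut ::
  "'a pair_pre_digraph \<Rightarrow> 'a \<Rightarrow> ('a word set \<Rightarrow> 'a word set) \<Rightarrow> ('a word set \<Rightarrow> 'a word set)" where
  "ext_aut \<Gamma> x \<phi> = (THE \<psi>. \<psi> \<in> auto (pc_group \<Gamma>) \<and>
     (\<forall>g\<in>pc_sub \<Gamma> (eq_class \<Gamma> x). \<psi> g = \<phi> g) \<and>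
     (\<forall>z\<in>pverts \<Gamma> - eq_class \<Gamma> x. \<psi> (pc_gen \<Gamma> z) = pc_gen \<Gamma> z))"

text \<open>The internal direct product is, as a subset of the automorphism group, the subgroup generated
  by its factors.\<close>

definition V_perp :: "'a pair_pre_digraph \<Rightarrow> ('a word set \<Rightarrow> 'a word set) set" where
  "V_perp \<Gamma> = generate (right_Aut (pc_group \<Gamma>))
     (\<Union>x\<in>{x \<in> pverts \<Gamma>. card (eq_class \<Gamma> x) \<ge> 2}.
        ext_aut \<Gamma> x ` auto ((pc_group \<Gamma>)\<lparr>carrier := pc_sub \<Gamma> (eq_class \<Gamma> x)\<rparr>))"

definition tr :: "'a pair_pre_digraph \<Rightarrow> 'a \<Rightarrow> 'a \<Rightarrow> ('a word set \<Rightarrow> 'a word set)" where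
  "tr \<Gamma> x y = (THE \<phi>. \<phi> \<in> auto (pc_group \<Gamma>) \<and>
     \<phi> (pc_gen \<Gamma> x) = pc_gen \<Gamma> x \<otimes>\<^bsub>pc_group \<Gamma>\<^esub> pc_gen \<Gamma> y \<and>
     (\<forall>z\<in>pverts \<Gamma> - {x}. \<phi> (pc_gen \<Gamma> z) = pc_gen \<Gamma> z))"

definition Tr_perp :: "'a pair_pre_digraph \<Rightarrow> ('a word set \<Rightarrow> 'a word set) set" where
  "Tr_perp \<Gamma> = {tr \<Gamma> x y | x y. x \<in> pverts \<Gamma> \<and> y \<in> pverts \<Gamma> \<and> x \<noteq> y \<and>
     orth \<Gamma> {x} - {x} \<subseteq> orth \<Gamma> {y} \<and> cl \<Gamma> {y} \<subset> cl \<Gamma> {x}}"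


section \<open>The matrix of an automorphism\<close>

definition GL :: "nat \<Rightarrow> ('r :: comm_ring_1) mat monoid" where
  "GL n = units_of (ring_mat TYPE('r) n ())"

text \<open>In this section \<open>xs\<close> lists the vertices in increasing order; indices start at \<open>0\<close>.\<close>

definition gen_power_prod :: "'a pair_pre_digraph \<Rightarrow> 'a list \<Rightarrow> (nat \<Rightarrow> int) \<Rightarrow> 'a word set" where
  "gen_power_prod \<Gamma> xs a =
    foldr (\<lambda>j g. (pc_gen \<Gamma> (xs ! j) [^]\<^bsub>pc_group \<Gamma>\<^esub> a j) \<otimes>\<^bsub>pc_group \<Gamma>\<^esub> g)
      [0..<length xs] \<one>\<^bsub>pc_group \<Gamma>\<^esub>"

definition aut_matrix ::
  "'a pair_pre_digraph \<Rightarrow> 'a list \<Rightarrow> ('a word set \<Rightarrow> 'a word set) \<Rightarrow> int mat" where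
  "aut_matrix \<Gamma> xs \<phi> = (THE A. A \<in> carrier_mat (length xs) (length xs) \<and>
     (\<forall>i<length xs. \<phi> (pc_gen \<Gamma> (xs ! i)) = gen_power_prod \<Gamma> xs (\<lambda>j. A $$ (i, j))) \<and>
     (\<forall>i<length xs. \<forall>j<length xs. xs ! j \<notin> cl \<Gamma> {xs ! i} \<longrightarrow> A $$ (i, j) = 0))"

definition S_X :: "'a pair_pre_digraph \<Rightarrow> 'a list \<Rightarrow> int mat set" where
  "S_X \<Gamma> xs = {A \<in> carrier_mat (length xs) (length xs).
     (\<forall>v\<in>pverts \<Gamma>. let I = {i. i < length xs \<and> xs ! i \<in> eq_class \<Gamma> v} in
        submatrix A I I \<in> carrier (GL (card (eq_class \<Gamma> v)))) \<and>
     (\<forall>i<length xs. \<forall>j<length xs. i > j \<and> eq_class \<Gamma> (xs ! i) \<noteq> eq_class \<Gamma> (xs ! j) \<longrightarrow>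
        A $$ (i, j) = 0) \<and>
     (\<forall>i<length xs. \<forall>j<length xs. i < j \<and> eq_class \<Gamma> (xs ! i) \<noteq> eq_class \<Gamma> (xs ! j) \<and>
        \<not> less_L \<Gamma> (xs ! j) (xs ! i) \<longrightarrow> A $$ (i, j) = 0)}"


section \<open>Arithmetic groups\<close>

definition finite_index_in :: "('g, 'm) monoid_scheme \<Rightarrow> 'g set \<Rightarrow> 'g set \<Rightarrow> bool" where
  "finite_index_in G A B \<longleftrightarrow> finite (rcosets\<^bsub>G\<lparr>carrier := B\<rparr>\<^esub> A)"

definition commensurable :: "('g, 'm) monoid_scheme \<Rightarrow> 'g set \<Rightarrow> 'g set \<Rightarrow> bool" where
  "commensurable G A B \<longleftrightarrow> subgroup A G \<and> subgroup B G \<and>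
     finite_index_in G (A \<inter> B) A \<and> finite_index_in G (A \<inter> B) B"

text \<open>Multivariate polynomials over the rationals: finitely supported maps from monomials, which are
  finitely supported maps from variables to exponents.\<close>

type_synonym 'v rat_mpoly = "('v \<Rightarrow>\<^sub>0 nat) \<Rightarrow>\<^sub>0 rat"

definition mpolys_in :: "'v set \<Rightarrow> 'v rat_mpoly set" where
  "mpolys_in V = {p. \<forall>m\<in>Poly_Mapping.keys p. Poly_Mapping.keys m \<subseteq> V}"

definition mpoly_eval :: "('v \<Rightarrow> complex) \<Rightarrow> 'v rat_mpoly \<Rightarrow> complex" where
  "mpoly_eval f p = (\<Sum>m\<in>Poly_Mapping.keys p. of_rat (Poly_Mapping.lookup p m) *
     (\<Prod>v\<in>Poly_Mapping.keys m. f v ^ Poly_Mapping.lookup m v))"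

text \<open>The coordinates of the affine variety \<open>GL n\<close> are the matrix entries (\<open>Some (i, j)\<close>) and the
  inverse of the determinant (\<open>None\<close>).\<close>

definition GL_vars :: "nat \<Rightarrow> (nat \<times> nat) option set" where
  "GL_vars n = insert None (Some ` ({..<n} \<times> {..<n}))"

fun GL_coord :: "complex mat \<Rightarrow> (nat \<times> nat) option \<Rightarrow> complex" where
  "GL_coord A None = 1 / det A"
| "GL_coord A (Some ij) = A $$ ij"

text \<open>The last two conditions say that multiplication and inversion on \<open>H\<close> are morphisms defined
  over the rationals.\<close>

definition Q_defined_algebraic_group :: "nat \<Rightarrow> complex mat set \<Rightarrow> bool" where
  "Q_defined_algebraic_group n H \<longleftrightarrow>
     subgroup H (GL n) \<and>
     (\<exists>P \<subseteq> mpolys_in ({..<n} \<times> {..<n}).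
        H = {A \<in> carrier (GL n). \<forall>p\<in>P. mpoly_eval (\<lambda>ij. A $$ ij) p = 0}) \<and>
     (\<forall>i<n. \<forall>j<n. \<exists>q\<in>mpolys_in (GL_vars n <+> GL_vars n). \<forall>A\<in>H. \<forall>B\<in>H.
        (A \<otimes>\<^bsub>GL n\<^esub> B) $$ (i, j) = mpoly_eval (case_sum (GL_coord A) (GL_coord B)) q) \<and>
     (\<forall>i<n. \<forall>j<n. \<exists>q\<in>mpolys_in (GL_vars n). \<forall>A\<in>H.
        (inv\<^bsub>GL n\<^esub> A) $$ (i, j) = mpoly_eval (GL_coord A) q)"

text \<open>The images of the integral and of the rational general linear group in the complex one.\<close>

definition GL_int :: "nat \<Rightarrow> complex mat set" where
  "GL_int n = map_mat of_int ` carrier (GL n)"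

definition GL_rat :: "nat \<Rightarrow> complex mat set" where
  "GL_rat n = map_mat of_rat ` carrier (GL n)"

definition arithmetic_subgroup :: "nat \<Rightarrow> complex mat set \<Rightarrow> complex mat set \<Rightarrow> bool" where
  "arithmetic_subgroup n H A \<longleftrightarrow>
     subgroup A (GL n) \<and> A \<subseteq> H \<inter> GL_rat n \<and> commensurable (GL n) A (H \<inter> GL_int n)"

definition arithmetic_group :: "('g, 'm) monoid_scheme \<Rightarrow> bool" where
  "arithmetic_group K \<longleftrightarrow> group K \<and>
     (\<exists>n H A. Q_defined_algebraic_group n H \<and> arithmetic_subgroup n H A \<and>
        K \<cong> (GL n)\<lparr>carrier := A\<rparr>)"

end

theory Submission
  imports Defs "HOL-Algebra.Elementary_Groups"
begin

text \<open>For \<open>\<phi>\<close> in \<open>St_L\<close> the image of a vertex \<open>x\<close> lies in the subgroup generated by the clique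
  \<open>cl {x}\<close>, so it is determined by its exponents, and taking exponents is a homomorphism; hence the
  matrix map is an injective homomorphism. Since \<open>y \<in> cl {x}\<close> is a preorder on vertices, the matrices
  with \<open>A $$ (i, j) = 0\<close> unless \<open>xs ! j \<in> cl {xs ! i}\<close> form an incidence algebra, and \<open>S_X\<close> is its
  intersection with the integral general linear group. Conversely a matrix in \<open>S_X\<close> is reduced to the
  identity by splitting off its invertible diagonal blocks (which come from \<open>V_perp\<close>, or from \<open>J\<close>
  for classes with one element) and then by elementary row operations (which come from
  \<open>Tr_perp\<close>). The invertible complex matrices of the incidence algebra form an algebraic group
  whose integral points are \<open>S_X\<close>.\<close>

text \<open>Two facts carry the argument. First, if x and y are adjacent then every vertex of cl(x)
  commutes with every vertex of cl(y). Hence any choice of images f(x) in G(cl(x)) respects the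
  defining relations, so every integral matrix of the incidence algebra comes from an endomorphism,
  and bijectivity reduces to inverting the matrix. Second, exponents are homomorphisms to the
  integers supplied by the universal property of G, so they are defined on the whole group and no
  normal form of words is involved. The delicate point is that the inverse of an invertible member
  of the incidence algebra has to lie there too. For a matrix coming from St(L) the inverse
  automorphism provides this. For an arbitrary invertible integral matrix it is linear algebra over
  a field, and this is what identifies S_X with the integral points of an algebraic group.
  Surjectivity onto S_X and generation are obtained together: the factorisation into elementary
  matrices shows that S_X is covered by automorphisms in the generated subgroup, and injectivity
  carries generation back to St(L).\<close>

declare in_lists_conv_set [simp del]

section \<open>Presented groups\<close>

locale presentation =
  fixes X :: "'a set" and R :: "('a word \<times> 'a word) set"
  assumes relators: "R \<subseteq> lists (X \<times> UNIV) \<times> lists (X \<times> UNIV)"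
begin

abbreviation W :: "'a word set" where "W \<equiv> lists (X \<times> UNIV)"
abbreviation cls :: "'a word \<Rightarrow> 'a word set" where "cls w \<equiv> pres_rel X R `` {w}"
abbreviation G :: "'a word set monoid" where "G \<equiv> presented_group X R"

lemma pres_rel_words:
  assumes "(u, v) \<in> pres_rel X R"
  shows "u \<in> W \<and> v \<in> W"
  using assms relators by (induction rule: pres_rel.induct) (auto simp: append_in_lists_conv)

lemma equiv_pres_rel: "equiv W (pres_rel X R)"
proof (rule equivI)
  show "pres_rel X R \<subseteq> W \<times> W"
    using pres_rel_words by (intro subrelI SigmaI) simp_all
  show "refl_on W (pres_rel X R)"
    by (auto intro: refl_onI pres_rel.refl)
  show "sym (pres_rel X R)"
    by (auto intro: symI pres_rel.sym)
  show "trans (pres_rel X R)"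
    by (auto intro: transI pres_rel.trans)
qed

text \<open>The generating steps \<open>cancel\<close> and \<open>relator\<close> already carry a
  context on both sides, so an outer context is absorbed into the inner one.\<close>

lemma pres_rel_context:
  assumes "(u, v) \<in> pres_rel X R" "a \<in> W" "b \<in> W"
  shows "(a @ u @ b, a @ v @ b) \<in> pres_rel X R"
  using assms
proof (induction rule: pres_rel.induct)
  case (refl w)
  then show ?case by (intro pres_rel.refl) auto
next
  case (sym u v)
  then show ?case by (blast intro: pres_rel.sym)
next
  case (trans u v w)
  then show ?case by (blast intro: pres_rel.trans)
next
  case (cancel a' b' x e)
  then show ?case
    using pres_rel.cancel[of "a @ a'" X "b' @ b" x e R] by (auto simp: append_in_lists_conv)
next
  case (relator a' b' u v)
  then show ?case
    using pres_rel.relator[of "a @ a'" X "b' @ b" u v R] by (auto simp: append_in_lists_conv)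
qed

lemma pres_rel_append:
  assumes "(u, u') \<in> pres_rel X R" "(v, v') \<in> pres_rel X R"
  shows "(u @ v, u' @ v') \<in> pres_rel X R"
proof -
  have "(u @ v, u' @ v) \<in> pres_rel X R"
    using pres_rel_context[OF assms(1), of "[]" v] pres_rel_words[OF assms(2)] by auto
  moreover have "(u' @ v, u' @ v') \<in> pres_rel X R"
    using pres_rel_context[OF assms(2), of u' "[]"] pres_rel_words[OF assms(1)] by auto
  ultimately show ?thesis by (rule pres_rel.trans)
qed

lemma cls_eq_iff:
  assumes "u \<in> W" "v \<in> W"
  shows "cls u = cls v \<longleftrightarrow> (u, v) \<in> pres_rel X R"
  using eq_equiv_class_iff[OF equiv_pres_rel assms] .

lemma carrier_G: "carrier G = cls ` W"
  by (auto simp: presented_group_def quotient_def)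

lemma cls_closed: "w \<in> W \<Longrightarrow> cls w \<in> carrier G"
  unfolding carrier_G by (rule imageI)

lemma carrier_GE:
  assumes "A \<in> carrier G"
  obtains w where "w \<in> W" "A = cls w"
proof -
  from assms have "A \<in> cls ` W" by (simp only: carrier_G)
  then show thesis by (rule imageE) (rule that)
qed

lemma one_G: "\<one>\<^bsub>G\<^esub> = cls []"
  by (simp add: presented_group_def)

lemma mult_G:
  assumes "u \<in> W" "v \<in> W"
  shows "cls u \<otimes>\<^bsub>G\<^esub> cls v = cls (u @ v)"
proof -
  have "cls (a @ b) = cls (u @ v)" if "a \<in> cls u" "b \<in> cls v" for a b
  proof -
    have "(u @ v, a @ b) \<in> pres_rel X R"
      using that by (auto intro: pres_rel_append)
    then show ?thesis
      by (simp add: equiv_class_eq[OF equiv_pres_rel])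
  qed
  moreover have "u \<in> cls u" "v \<in> cls v"
    using assms by (auto intro: pres_rel.refl)
  ultimately have "(\<Union>a\<in>cls u. \<Union>b\<in>cls v. cls (a @ b)) = cls (u @ v)"
    by blast
  then show ?thesis by (simp add: presented_group_def)
qed

lemma inverse_word_in_W: "w \<in> W \<Longrightarrow> rev (map (apsnd Not) w) \<in> W"
  by (induction w rule: list.induct) auto

lemma inverse_word:
  assumes "w \<in> W"
  shows "(rev (map (apsnd Not) w) @ w, []) \<in> pres_rel X R"
  using assms
proof (induction w rule: list.induct)
  case Nil
  then show ?case by (auto intro: pres_rel.refl)
next
  case (Cons p w)
  obtain x e where p: "p = (x, e)" by force
  have inv_W: "rev (map (apsnd Not) w) \<in> W"
    using Cons.prems inverse_word_in_W[of w] by simp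
  \<comment> \<open>The double negation is kept so that the innermost pair literally matches
    \<open>pres_rel.cancel\<close> for the exponent \<open>\<not> e\<close>.\<close>
  have "(rev (map (apsnd Not) w) @ [(x, \<not> e), (x, \<not> \<not> e)] @ w, rev (map (apsnd Not) w) @ w)
      \<in> pres_rel X R"
    using Cons.prems p inv_W by (intro pres_rel.cancel) auto
  moreover have "(rev (map (apsnd Not) w) @ w, []) \<in> pres_rel X R"
    using Cons by simp
  ultimately have "(rev (map (apsnd Not) w) @ [(x, \<not> e), (x, \<not> \<not> e)] @ w, []) \<in> pres_rel X R"
    by (rule pres_rel.trans)
  then show ?case using p by simp
qed

lemma group_G: "group G"
proof (rule groupI)
  show "x \<otimes>\<^bsub>G\<^esub> y \<in> carrier G" if "x \<in> carrier G" "y \<in> carrier G" for x y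
  proof -
    from that(1) obtain u where u: "u \<in> W" "x = cls u" by (rule carrier_GE)
    from that(2) obtain v where v: "v \<in> W" "y = cls v" by (rule carrier_GE)
    have "u @ v \<in> W" using u v by simp
    then show ?thesis using u v cls_closed[of "u @ v"] by (simp add: mult_G)
  qed
  show "\<one>\<^bsub>G\<^esub> \<in> carrier G"
    unfolding one_G by (rule cls_closed) simp
  show "x \<otimes>\<^bsub>G\<^esub> y \<otimes>\<^bsub>G\<^esub> z = x \<otimes>\<^bsub>G\<^esub> (y \<otimes>\<^bsub>G\<^esub> z)"
    if "x \<in> carrier G" "y \<in> carrier G" "z \<in> carrier G" for x y z
  proof -
    from that(1) obtain u where u: "u \<in> W" "x = cls u" by (rule carrier_GE)
    from that(2) obtain v where v: "v \<in> W" "y = cls v" by (rule carrier_GE)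
    from that(3) obtain w where w: "w \<in> W" "z = cls w" by (rule carrier_GE)
    from u v w show ?thesis by (simp add: mult_G)
  qed
  show "\<one>\<^bsub>G\<^esub> \<otimes>\<^bsub>G\<^esub> x = x" if "x \<in> carrier G" for x
    using that by (elim carrier_GE) (simp add: one_G mult_G)
  show "\<exists>y\<in>carrier G. y \<otimes>\<^bsub>G\<^esub> x = \<one>\<^bsub>G\<^esub>" if x: "x \<in> carrier G" for x
  proof -
    obtain w where w: "w \<in> W" "x = cls w" using x by (rule carrier_GE)
    have inv_W: "rev (map (apsnd Not) w) \<in> W"
      using w(1) by (rule inverse_word_in_W)
    have "cls (rev (map (apsnd Not) w)) \<otimes>\<^bsub>G\<^esub> x = \<one>\<^bsub>G\<^esub>"
      using w inv_W inverse_word[OF w(1)] by (simp add: mult_G one_G cls_eq_iff)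
    then show ?thesis
      using cls_closed[OF inv_W] by blast
  qed
qed

sublocale G: group G by (rule group_G)

definition gen :: "'a \<Rightarrow> 'a word set" where "gen x = cls [(x, True)]"

lemma gen_closed [simp]: "x \<in> X \<Longrightarrow> gen x \<in> carrier G"
  by (simp add: gen_def cls_closed)

lemma inv_gen: "x \<in> X \<Longrightarrow> inv\<^bsub>G\<^esub> gen x = cls [(x, False)]"
proof (rule G.inv_equality)
  assume x: "x \<in> X"
  show "cls [(x, False)] \<otimes>\<^bsub>G\<^esub> gen x = \<one>\<^bsub>G\<^esub>"
    using x pres_rel.cancel[of "[]" X "[]" x False R] by (simp add: gen_def mult_G one_G cls_eq_iff)
  show "cls [(x, False)] \<in> carrier G"
    using x by (simp add: cls_closed)
qed simp

lemma carrier_generate: "carrier G = generate G (gen ` X)"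
proof
  show "generate G (gen ` X) \<subseteq> carrier G"
    by (rule G.generate_incl) auto
  have "cls w \<in> generate G (gen ` X)" if "w \<in> W" for w
    using that
  proof (induction w rule: list.induct)
    case Nil
    then show ?case using generate.one[of G] by (simp add: one_G)
  next
    case (Cons p w)
    obtain x e where p: "p = (x, e)" by force
    have x: "x \<in> X" using Cons.prems p by simp
    have "cls [p] \<in> generate G (gen ` X)"
    proof (cases e)
      case True
      then show ?thesis using x p by (auto simp: gen_def intro: generate.incl)
    next
      case False
      then show ?thesis using x p generate.inv[of "gen x" "gen ` X" G] by (simp add: inv_gen)
    qed
    moreover have "cls (p # w) = cls [p] \<otimes>\<^bsub>G\<^esub> cls w"
      using Cons.prems by (subst mult_G) auto
    ultimately show ?case
      using Cons by (auto intro: generate.eng)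
  qed
  then show "carrier G \<subseteq> generate G (gen ` X)"
    unfolding carrier_G by (rule image_subsetI)
qed

section \<open>Universal property of a presented group\<close>

definition word_eval :: "('b, 'm) monoid_scheme \<Rightarrow> ('a \<Rightarrow> 'b) \<Rightarrow> 'a word \<Rightarrow> 'b" where
  "word_eval H f w =
    foldr (\<lambda>(x, e) h. (if e then f x else inv\<^bsub>H\<^esub> f x) \<otimes>\<^bsub>H\<^esub> h) w \<one>\<^bsub>H\<^esub>"

lemma word_eval_simps [simp]:
  "word_eval H f [] = \<one>\<^bsub>H\<^esub>"
  "word_eval H f ((x, e) # w) = (if e then f x else inv\<^bsub>H\<^esub> f x) \<otimes>\<^bsub>H\<^esub> word_eval H f w"
  by (simp_all add: word_eval_def)

lemma word_eval_closed:
  assumes "group H" "f \<in> X \<rightarrow> carrier H" "w \<in> W"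
  shows "word_eval H f w \<in> carrier H"
proof -
  interpret H: group H by fact
  show ?thesis
    using assms(3,2) by (induction w rule: list.induct) (auto simp: Pi_iff)
qed

lemma word_eval_append:
  assumes "group H" "f \<in> X \<rightarrow> carrier H" "u \<in> W" "v \<in> W"
  shows "word_eval H f (u @ v) = word_eval H f u \<otimes>\<^bsub>H\<^esub> word_eval H f v"
proof -
  interpret H: group H by fact
  show ?thesis
    using assms(3)
  proof (induction u rule: list.induct)
    case Nil
    then show ?case using word_eval_closed[OF assms(1,2,4)] by simp
  next
    case (Cons p u)
    obtain x e where p: "p = (x, e)" by force
    have "x \<in> X" using Cons.prems p by simp
    then have "f x \<in> carrier H" using assms(2) by auto
    then show ?case
      using Cons p word_eval_closed[OF assms(1,2,4)] word_eval_closed[OF assms(1,2), of u]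
      by (auto simp: H.m_assoc)
  qed
qed

text \<open>Free cancellation holds in every group, so the relators are the only condition under
  which the value of a word depends on its class alone.\<close>

lemma word_eval_pres_rel:
  assumes "group H" "f \<in> X \<rightarrow> carrier H"
    and rel: "\<forall>(u, v)\<in>R. word_eval H f u = word_eval H f v"
    and "(u, v) \<in> pres_rel X R"
  shows "word_eval H f u = word_eval H f v"
proof -
  interpret H: group H by fact
  note append = word_eval_append[OF assms(1,2)]
  show ?thesis
    using assms(4)
  proof (induction rule: pres_rel.induct)
    case (cancel a b x e)
    have "f x \<in> carrier H" using assms(2) cancel by auto
    then have "word_eval H f ([(x, e), (x, \<not> e)] @ b) = word_eval H f b"
      using word_eval_closed[OF assms(1,2), of b] cancel
      by (cases e) (auto simp: H.m_assoc[symmetric])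
    moreover have "[(x, e), (x, \<not> e)] @ b \<in> W" using cancel by simp
    ultimately show ?case
      using cancel by (simp only: append)
  next
    case (relator a b u v)
    have W: "u \<in> W" "v \<in> W" using relator relators by auto
    then have "word_eval H f (u @ b) = word_eval H f (v @ b)"
      using relator rel by (auto simp: append)
    moreover have "u @ b \<in> W" "v @ b \<in> W" using W relator by auto
    ultimately show ?case using relator by (simp only: append)
  qed auto
qed

text \<open>The homomorphism of von Dyck's theorem. Restricting it to the carrier makes it
  extensional, as members of \<open>auto\<close> have to be.\<close>

definition lift :: "('b, 'm) monoid_scheme \<Rightarrow> ('a \<Rightarrow> 'b) \<Rightarrow> 'a word set \<Rightarrow> 'b" where
  "lift H f = (\<lambda>A\<in>carrier G. word_eval H f (SOME w. w \<in> A))"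

lemma lift_cls:
  assumes "group H" "f \<in> X \<rightarrow> carrier H"
    and "\<forall>(u, v)\<in>R. word_eval H f u = word_eval H f v"
    and "w \<in> W"
  shows "lift H f (cls w) = word_eval H f w"
proof -
  have "w \<in> cls w"
    using pres_rel.refl[OF assms(4)] by (rule ImageI) simp
  then have "(SOME w'. w' \<in> cls w) \<in> cls w" by (rule someI)
  then have "(w, SOME w'. w' \<in> cls w) \<in> pres_rel X R"
    by (rule Image_singleton_iff[THEN iffD1])
  then have "word_eval H f w = word_eval H f (SOME w'. w' \<in> cls w)"
    by (rule word_eval_pres_rel[OF assms(1-3)])
  then show ?thesis
    using cls_closed[OF assms(4)] by (simp add: lift_def)
qed

lemma lift_hom:
  assumes "group H" "f \<in> X \<rightarrow> carrier H"
    and "\<forall>(u, v)\<in>R. word_eval H f u = word_eval H f v"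
  shows "lift H f \<in> hom G H"
proof (rule homI)
  fix A assume "A \<in> carrier G"
  then obtain u where u: "u \<in> W" "A = cls u" by (rule carrier_GE)
  then show "lift H f A \<in> carrier H"
    using word_eval_closed[OF assms(1,2)] by (simp add: lift_cls[OF assms])
  fix B assume "B \<in> carrier G"
  then obtain v where v: "v \<in> W" "B = cls v" by (rule carrier_GE)
  have "u @ v \<in> W" using u v by simp
  then show "lift H f (A \<otimes>\<^bsub>G\<^esub> B) = lift H f A \<otimes>\<^bsub>H\<^esub> lift H f B"
    using u v word_eval_append[OF assms(1,2)] by (simp add: mult_G lift_cls[OF assms])
qed

lemma lift_gen:
  assumes "group H" "f \<in> X \<rightarrow> carrier H"
    and "\<forall>(u, v)\<in>R. word_eval H f u = word_eval H f v"
    and "x \<in> X"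
  shows "lift H f (gen x) = f x"
proof -
  interpret H: group H by fact
  have "f x \<in> carrier H" using assms(2,4) by (rule funcset_mem)
  moreover have "lift H f (gen x) = word_eval H f [(x, True)]"
    unfolding gen_def using assms(4) by (intro lift_cls[OF assms(1-3)]) auto
  ultimately show ?thesis by simp
qed

end

lemma hom_eq_on_generate:
  assumes "group G" "group H" "f \<in> hom G H" "g \<in> hom G H" "S \<subseteq> carrier G"
    and "\<And>s. s \<in> S \<Longrightarrow> f s = g s"
    and "a \<in> generate G S"
  shows "f a = g a"
proof -
  interpret f: group_hom G H f
    using assms by (simp add: group_hom_def group_hom_axioms_def)
  interpret g: group_hom G H g
    using assms by (simp add: group_hom_def group_hom_axioms_def)
  show ?thesis
    using assms(7)
  proof (induction rule: generate.induct)
    case (inv h)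
    then show ?case using assms(5,6) f.hom_inv[of h] g.hom_inv[of h] by auto
  next
    case (eng h1 h2)
    then show ?case
      using f.G.generate_in_carrier[OF assms(5)] by simp
  qed (use assms(6) in auto)
qed

section \<open>Closed sets of vertices\<close>

lemma graph_dist_le_one:
  assumes "pair_graph \<Gamma>" "u \<in> pverts \<Gamma>"
  shows "graph_dist \<Gamma> u v \<le> 1 \<longleftrightarrow> u = v \<or> (u, v) \<in> parcs \<Gamma>"
proof -
  have "pair_wf_digraph \<Gamma>"
    using assms(1) by (simp add: pair_graph_def pair_digraph_def pair_fin_digraph_def)
  then interpret W: wf_digraph "with_proj \<Gamma>"
    by (simp add: wf_digraph_wp_iff)
  have cost: "W.awalk_cost (\<lambda>_. 1) p = real (length p)" for p :: "('a \<times> 'a) list"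
    by (induction p) (auto simp: W.awalk_cost_def)
  show ?thesis
  proof
    assume "graph_dist \<Gamma> u v \<le> 1"
    \<comment> \<open>The infimum is realised by an actual walk only below a strict bound. With unit
      costs a walk of cost less than 2 has at most one arc.\<close>
    also have "(1::ereal) < 2" by simp
    finally have "\<exists>p. W.awalk u p v \<and> ereal (W.awalk_cost (\<lambda>_. 1) p) < 2"
      unfolding graph_dist_def W.\<mu>_def INF_less_iff by blast
    then obtain p where p: "W.awalk u p v" "length p < 2"
      by (auto simp: cost)
    then consider "p = []" | e where "p = [e]"
      by (cases p) (auto simp: length_Suc_conv less_Suc_eq numeral_2_eq_2)
    then show "u = v \<or> (u, v) \<in> parcs \<Gamma>"
      using p(1) by cases (auto simp: W.awalk_def)
  next
    assume uv: "u = v \<or> (u, v) \<in> parcs \<Gamma>"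
    have "\<exists>p. W.awalk u p v \<and> length p \<le> 1"
    proof (cases "u = v")
      case True
      then have "W.awalk u [] v" using assms(2) by (simp add: W.awalk_Nil_iff)
      then show ?thesis by (metis list.size(3) zero_le)
    next
      case False
      then have "W.awalk u [(u, v)] v" using uv W.arc_implies_awalk[of "(u, v)"] by simp
      then show ?thesis by (intro exI[of _ "[(u, v)]"]) simp
    qed
    then obtain p where p: "W.awalk u p v" "length p \<le> 1" by blast
    have "W.\<mu> (\<lambda>_. 1) u v \<le> W.awalk_cost (\<lambda>_. 1) p"
      using p(1) by (rule W.min_cost_le_walk_cost)
    also have "\<dots> \<le> 1" using p(2) by (simp add: cost)
    finally show "graph_dist \<Gamma> u v \<le> 1" by (simp add: graph_dist_def)
  qed
qed

section \<open>Commuting subgroups and products of powers\<close>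

text \<open>The elements commuting with \<open>h\<close> are closed under products and
  inverses.\<close>

lemma (in group) commutes_with_generate:
  assumes "S \<subseteq> carrier G" "h \<in> carrier G"
    and "\<And>s. s \<in> S \<Longrightarrow> h \<otimes> s = s \<otimes> h"
    and "a \<in> generate G S"
  shows "h \<otimes> a = a \<otimes> h"
  using assms(4)
proof (induction rule: generate.induct)
  case one
  then show ?case using assms(2) by simp
next
  case (incl s)
  then show ?case by (rule assms(3))
next
  case (inv s)
  then have s: "s \<in> carrier G" using assms(1) by blast
  have "h = s \<otimes> h \<otimes> inv s"
    using s assms(2) by (simp add: assms(3)[OF inv, symmetric] m_assoc)
  then have "inv s \<otimes> h = inv s \<otimes> (s \<otimes> h \<otimes> inv s)" by simp
  also have "\<dots> = h \<otimes> inv s"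
    using s assms(2) by (simp add: m_assoc[symmetric])
  finally show ?case ..
next
  case (eng a b)
  have ab: "a \<in> carrier G" "b \<in> carrier G"
    using eng generate_in_carrier[OF assms(1)] by auto
  have "h \<otimes> (a \<otimes> b) = a \<otimes> h \<otimes> b"
    using ab assms(2) eng by (simp add: m_assoc[symmetric])
  also have "\<dots> = a \<otimes> b \<otimes> h"
    using ab assms(2) eng by (simp add: m_assoc)
  finally show ?case .
qed

lemma (in group) generate_commute:
  assumes "S \<subseteq> carrier G" "T \<subseteq> carrier G"
    and "\<And>s t. s \<in> S \<Longrightarrow> t \<in> T \<Longrightarrow> s \<otimes> t = t \<otimes> s"
    and "a \<in> generate G S" "b \<in> generate G T"
  shows "a \<otimes> b = b \<otimes> a"
proof -
  have a: "a \<in> carrier G" using generate_in_carrier[OF assms(1,4)] .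
  have "t \<otimes> a = a \<otimes> t" if t: "t \<in> T" for t
  proof (rule commutes_with_generate[OF assms(1) _ _ assms(4)])
    show "t \<in> carrier G" using t assms(2) by blast
    show "t \<otimes> s = s \<otimes> t" if "s \<in> S" for s using assms(3)[OF that t] by simp
  qed
  then have "a \<otimes> t = t \<otimes> a" if "t \<in> T" for t using that by simp
  then show ?thesis
    by (rule commutes_with_generate[OF assms(2) a _ assms(5)])
qed

context group
begin

text \<open>The product runs along a list because the factors need not commute;
  \<open>gen_power_prod\<close> is the instance where the factors are vertex generators.\<close>

definition pow_prod :: "('i \<Rightarrow> 'a) \<Rightarrow> 'i list \<Rightarrow> ('i \<Rightarrow> int) \<Rightarrow> 'a" where
  "pow_prod g L a = foldr (\<lambda>j h. (g j [^] a j) \<otimes> h) L \<one>"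

lemma pow_prod_simps [simp]:
  "pow_prod g [] a = \<one>"
  "pow_prod g (j # L) a = (g j [^] a j) \<otimes> pow_prod g L a"
  by (simp_all add: pow_prod_def)

lemma pow_prod_closed:
  assumes "\<And>j. j \<in> set L \<Longrightarrow> g j \<in> carrier G"
  shows "pow_prod g L a \<in> carrier G"
  using assms by (induction L) auto

lemma pow_prod_in_generate:
  assumes "\<And>j. j \<in> set L \<Longrightarrow> g j \<in> carrier G" "\<And>j. j \<in> set L \<Longrightarrow> j \<notin> J \<Longrightarrow> a j = 0"
    and "J \<subseteq> set L"
  shows "pow_prod g L a \<in> generate G (g ` J)"
proof -
  have sub: "subgroup (generate G (g ` J)) G"
    using assms by (intro generate_is_subgroup) auto
  have "pow_prod g L' a \<in> generate G (g ` J)" if "set L' \<subseteq> set L" for L'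
    using that
  proof (induction L')
    case Nil
    then show ?case by (auto intro: generate.one)
  next
    case (Cons j L')
    have "g j [^] a j \<in> generate G (g ` J)"
    proof (cases "j \<in> J")
      case True
      then show ?thesis by (intro subgroup_int_pow_closed[OF sub] generate.incl) auto
    next
      case False
      then have "a j = 0" using assms(2) Cons.prems by auto
      then show ?thesis by (simp add: generate.one)
    qed
    then show ?case using Cons by (auto intro: generate.eng)
  qed
  then show ?thesis by blast
qed

lemma pow_prod_zero:
  assumes "\<And>j. j \<in> set L \<Longrightarrow> a j = 0"
  shows "pow_prod g L a = \<one>"
  using assms by (induction L) auto

lemma pow_prod_single:
  assumes "distinct L" "i \<in> set L" "g i \<in> carrier G"
  shows "pow_prod g L (\<lambda>j. if j = i then 1 else 0) = g i"
  using assms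
proof (induction L)
  case (Cons j L)
  show ?case
  proof (cases "j = i")
    case True
    then have "pow_prod g L (\<lambda>j. if j = i then 1 else 0) = \<one>"
      using Cons.prems by (intro pow_prod_zero) auto
    then show ?thesis using True Cons.prems by simp
  next
    case False
    then show ?thesis using Cons by simp
  qed
qed simp

text \<open>Only factors indexed by \<open>J\<close> have nonzero exponents, and these commute, so
  the \<open>b\<close>-power of the head can be moved past the \<open>a\<close>-product of the
  tail.\<close>

lemma pow_prod_add:
  assumes "\<And>j. j \<in> set L \<Longrightarrow> g j \<in> carrier G"
    and "\<And>i j. i \<in> J \<Longrightarrow> j \<in> J \<Longrightarrow> g i \<otimes> g j = g j \<otimes> g i" "J \<subseteq> set L"
    and "\<And>j. j \<in> set L \<Longrightarrow> j \<notin> J \<Longrightarrow> a j = 0" "\<And>j. j \<in> set L \<Longrightarrow> j \<notin> J \<Longrightarrow> b j = 0"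
  shows "pow_prod g L (\<lambda>j. a j + b j) = pow_prod g L a \<otimes> pow_prod g L b"
proof -
  have gJ: "g ` J \<subseteq> carrier G" using assms(1,3) by auto
  have *: "pow_prod g L' (\<lambda>j. a j + b j) = pow_prod g L' a \<otimes> pow_prod g L' b"
    if "set L' \<subseteq> set L" for L'
    using that
  proof (induction L')
    case (Cons j L')
    have j: "g j \<in> carrier G" using Cons.prems assms(1) by auto
    have cl: "pow_prod g L' a \<in> carrier G" "pow_prod g L' b \<in> carrier G"
      using Cons.prems assms(1) by (auto intro!: pow_prod_closed)
    \<comment> \<open>\<open>pow_prod_in_generate\<close> wants the index set inside the list; the
      intersection is enlarged to \<open>J\<close> afterwards by monotonicity.\<close>
    have "pow_prod g L' a \<in> generate G (g ` (J \<inter> set L'))"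
      using Cons.prems assms(1,4) by (intro pow_prod_in_generate) auto
    then have A: "pow_prod g L' a \<in> generate G (g ` J)"
      using mono_generate[of "g ` (J \<inter> set L')" "g ` J"] by blast
    have B: "g j [^] b j \<in> generate G (g ` J)"
    proof (cases "j \<in> J")
      case True
      then show ?thesis
        using gJ by (intro subgroup_int_pow_closed[OF generate_is_subgroup] generate.incl) auto
    next
      case False
      then have "b j = 0" using assms(5) Cons.prems by auto
      then show ?thesis by (simp add: generate.one)
    qed
    have comm: "pow_prod g L' a \<otimes> g j [^] b j = g j [^] b j \<otimes> pow_prod g L' a"
      by (rule generate_commute[OF gJ gJ _ A B]) (use assms(2) in auto)
    have "pow_prod g (j # L') (\<lambda>j. a j + b j) =
        g j [^] a j \<otimes> (g j [^] b j \<otimes> pow_prod g L' a) \<otimes> pow_prod g L' b"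
      using Cons j cl by (simp add: int_pow_mult m_assoc)
    also have "\<dots> = pow_prod g (j # L') a \<otimes> pow_prod g (j # L') b"
      using j cl by (simp add: comm[symmetric] m_assoc)
    finally show ?case .
  qed simp
  then show ?thesis by blast
qed

end

lemma hom_pow_prod_int:
  assumes "group G" "h \<in> hom G integer_group" "\<And>j. j \<in> set L \<Longrightarrow> g j \<in> carrier G"
  shows "h (group.pow_prod G g L a) = (\<Sum>j\<leftarrow>L. a j * h (g j))"
proof -
  interpret group G by fact
  interpret h: group_hom G integer_group h
    using assms by (simp add: group_hom_def group_hom_axioms_def)
  have pow: "h (x [^]\<^bsub>G\<^esub> (n::int)) = n * h x" if "x \<in> carrier G" for x n
    using h.hom_int_pow[OF that] by simp
  show ?thesis
    using assms(3) by (induction L) (auto simp: pow pow_prod_closed)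
qed

section \<open>Closed sets\<close>

locale pc_graph =
  fixes \<Gamma> :: "'a pair_pre_digraph"
  assumes graph: "pair_graph \<Gamma>"
begin

definition comm :: "'a \<Rightarrow> 'a \<Rightarrow> bool" where
  "comm u v \<longleftrightarrow> u = v \<or> (u, v) \<in> parcs \<Gamma>"

lemma finite_verts: "finite (pverts \<Gamma>)"
  and arcs_verts: "(u, v) \<in> parcs \<Gamma> \<Longrightarrow> u \<in> pverts \<Gamma> \<and> v \<in> pverts \<Gamma>"
  and arcs_sym: "(u, v) \<in> parcs \<Gamma> \<Longrightarrow> (v, u) \<in> parcs \<Gamma>"
proof -
  interpret pair_graph \<Gamma> by (rule graph)
  show "finite (pverts \<Gamma>)" by (rule pair_finite_verts)
  show "(u, v) \<in> parcs \<Gamma> \<Longrightarrow> u \<in> pverts \<Gamma> \<and> v \<in> pverts \<Gamma>" using in_arcsD1 in_arcsD2 by simp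
  show "(u, v) \<in> parcs \<Gamma> \<Longrightarrow> (v, u) \<in> parcs \<Gamma>" by (rule arcs_symmetric)
qed

lemma comm_sym: "comm u v \<Longrightarrow> comm v u"
  using arcs_sym by (auto simp: comm_def)

lemma comm_refl [simp]: "comm u u"
  by (simp add: comm_def)

lemma in_orth_iff: "u \<in> orth \<Gamma> Y \<longleftrightarrow> u \<in> pverts \<Gamma> \<and> (\<forall>y\<in>Y. comm u y)"
  using graph_dist_le_one[OF graph] by (auto simp: orth_def comm_def)

lemma orth_subset: "orth \<Gamma> Y \<subseteq> pverts \<Gamma>"
  by (auto simp: orth_def)

lemma orth_antimono: "Y \<subseteq> Z \<Longrightarrow> orth \<Gamma> Z \<subseteq> orth \<Gamma> Y"
  by (auto simp: orth_def)

lemma subset_cl: "Y \<subseteq> pverts \<Gamma> \<Longrightarrow> Y \<subseteq> cl \<Gamma> Y"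
  using comm_sym unfolding cl_def subset_iff in_orth_iff Ball_def by blast

lemma cl_mono: "Y \<subseteq> Z \<Longrightarrow> cl \<Gamma> Y \<subseteq> cl \<Gamma> Z"
  by (simp add: cl_def orth_antimono)

lemma cl_subset: "cl \<Gamma> Y \<subseteq> pverts \<Gamma>"
  by (simp add: cl_def orth_subset)

text \<open>Complementation is a Galois connection, so three complements equal one: one inclusion is
  antitonicity applied to Y \<subseteq> cl(Y), the other is extensivity of the closure at the
  complement of Y.\<close>

lemma orth_cl: "Y \<subseteq> pverts \<Gamma> \<Longrightarrow> orth \<Gamma> (cl \<Gamma> Y) = orth \<Gamma> Y"
  using orth_antimono[OF subset_cl[of Y]] subset_cl[OF orth_subset, of Y] by (simp add: cl_def)

lemma cl_closed: "Y \<subseteq> pverts \<Gamma> \<Longrightarrow> cl \<Gamma> Y \<in> closed_sets \<Gamma>"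
  using cl_subset[of Y] orth_cl[of Y] by (simp add: closed_sets_def cl_def)

lemma closed_subset: "Y \<in> closed_sets \<Gamma> \<Longrightarrow> Y \<subseteq> pverts \<Gamma>"
  unfolding closed_sets_def by blast

lemma self_in_cl: "x \<in> pverts \<Gamma> \<Longrightarrow> x \<in> cl \<Gamma> {x}"
  using subset_cl[of "{x}"] by simp

lemma cl_subset_closed: "Y \<in> closed_sets \<Gamma> \<Longrightarrow> x \<in> Y \<Longrightarrow> cl \<Gamma> {x} \<subseteq> Y"
  using cl_mono[of "{x}" Y] by (simp add: closed_sets_def)

lemma in_cl_iff:
  assumes "x \<in> pverts \<Gamma>" "y \<in> pverts \<Gamma>"
  shows "y \<in> cl \<Gamma> {x} \<longleftrightarrow> cl \<Gamma> {y} \<subseteq> cl \<Gamma> {x}"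
  using cl_subset_closed[OF cl_closed, of "{x}" y] self_in_cl[of y] assms by auto

lemma in_cl_trans: "y \<in> cl \<Gamma> {x} \<Longrightarrow> z \<in> cl \<Gamma> {y} \<Longrightarrow> x \<in> pverts \<Gamma> \<Longrightarrow> z \<in> cl \<Gamma> {x}"
  using cl_subset_closed[OF cl_closed, of "{x}" y] by auto

text \<open>Since y lies in the complement of x, every u in the double complement of x commutes with
  y; the same argument then replaces y by v. This lets the relations of the group survive when each
  generator is sent into the subgroup of its closure.\<close>

lemma cl_comm:
  assumes "comm x y" "x \<in> pverts \<Gamma>" "y \<in> pverts \<Gamma>" "u \<in> cl \<Gamma> {x}" "v \<in> cl \<Gamma> {y}"
  shows "comm u v"
proof -
  have "y \<in> orth \<Gamma> {x}" using assms by (simp add: in_orth_iff comm_sym)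
  then have "comm u y" using assms(4) by (simp add: cl_def in_orth_iff[of u])
  moreover have "u \<in> pverts \<Gamma>" using assms(4) cl_subset by blast
  ultimately have "u \<in> orth \<Gamma> {y}" by (simp add: in_orth_iff)
  then have "comm v u" using assms(5) by (simp add: cl_def in_orth_iff[of v])
  then show ?thesis by (rule comm_sym)
qed

lemma cl_clique: "x \<in> pverts \<Gamma> \<Longrightarrow> u \<in> cl \<Gamma> {x} \<Longrightarrow> v \<in> cl \<Gamma> {x} \<Longrightarrow> comm u v"
  by (rule cl_comm[of x x]) auto

lemma in_eq_class_iff:
  assumes "x \<in> pverts \<Gamma>"
  shows "y \<in> eq_class \<Gamma> x \<longleftrightarrow> y \<in> pverts \<Gamma> \<and> cl \<Gamma> {y} = cl \<Gamma> {x}"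
proof
  assume "y \<in> eq_class \<Gamma> x"
  then show "y \<in> pverts \<Gamma> \<and> cl \<Gamma> {y} = cl \<Gamma> {x}" by (auto simp: eq_class_def cl_def)
next
  assume y: "y \<in> pverts \<Gamma> \<and> cl \<Gamma> {y} = cl \<Gamma> {x}"
  then have "orth \<Gamma> {x} = orth \<Gamma> {y}"
    using orth_cl[of "{x}"] orth_cl[of "{y}"] assms by simp
  then show "y \<in> eq_class \<Gamma> x" using y by (auto simp: eq_class_def)
qed

lemma eq_class_subset_cl: "x \<in> pverts \<Gamma> \<Longrightarrow> eq_class \<Gamma> x \<subseteq> cl \<Gamma> {x}"
  using in_eq_class_iff self_in_cl by auto

lemma self_in_eq_class: "x \<in> pverts \<Gamma> \<Longrightarrow> x \<in> eq_class \<Gamma> x"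
  by (auto simp: eq_class_def)

lemma eq_class_subset: "eq_class \<Gamma> x \<subseteq> pverts \<Gamma>"
  by (auto simp: eq_class_def)

lemma eq_class_cong: "y \<in> eq_class \<Gamma> x \<Longrightarrow> eq_class \<Gamma> y = eq_class \<Gamma> x"
  by (auto simp: eq_class_def)

lemma eq_class_eq_iff:
  assumes "x \<in> pverts \<Gamma>" "y \<in> pverts \<Gamma>"
  shows "eq_class \<Gamma> x = eq_class \<Gamma> y \<longleftrightarrow> cl \<Gamma> {x} = cl \<Gamma> {y}"
proof
  assume "eq_class \<Gamma> x = eq_class \<Gamma> y"
  then have "x \<in> eq_class \<Gamma> y" using self_in_eq_class[OF assms(1)] by simp
  then show "cl \<Gamma> {x} = cl \<Gamma> {y}" using in_eq_class_iff[OF assms(2)] by simp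
next
  assume "cl \<Gamma> {x} = cl \<Gamma> {y}"
  then show "eq_class \<Gamma> x = eq_class \<Gamma> y" using in_eq_class_iff assms by auto
qed

section \<open>The group of a graph\<close>

lemma presentation: "presentation (pverts \<Gamma>) (comm_relations \<Gamma>)"
  using arcs_verts by unfold_locales (auto simp: comm_relations_def)

sublocale P: presentation "pverts \<Gamma>" "comm_relations \<Gamma>"
  by (rule presentation)

abbreviation G :: "'a word set monoid" where "G \<equiv> pc_group \<Gamma>"
abbreviation gen :: "'a \<Rightarrow> 'a word set" where "gen \<equiv> pc_gen \<Gamma>"

lemma P_gen: "P.gen = gen"
  by (simp add: fun_eq_iff P.gen_def pc_gen_def)

sublocale G: group G
  using P.group_G by (simp add: pc_group_def)

lemma gen_closed [simp]: "x \<in> pverts \<Gamma> \<Longrightarrow> gen x \<in> carrier G"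
  using P.gen_closed by (simp add: P_gen pc_group_def)

lemma gens_closed: "Y \<subseteq> pverts \<Gamma> \<Longrightarrow> gen ` Y \<subseteq> carrier G"
  by auto

lemma carrier_generate: "carrier G = pc_sub \<Gamma> (pverts \<Gamma>)"
  using P.carrier_generate by (simp add: P_gen pc_group_def pc_sub_def)

lemma gen_commute:
  assumes "comm x y" "x \<in> pverts \<Gamma>" "y \<in> pverts \<Gamma>"
  shows "gen x \<otimes>\<^bsub>G\<^esub> gen y = gen y \<otimes>\<^bsub>G\<^esub> gen x"
proof (cases "x = y")
  case False
  then have "(x, y) \<in> parcs \<Gamma>" using assms(1) by (simp add: comm_def)
  then have "([(x, True), (y, True)], [(y, True), (x, True)]) \<in> comm_relations \<Gamma>"
    by (auto simp: comm_relations_def)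
  then have "([] @ [(x, True), (y, True)] @ [], [] @ [(y, True), (x, True)] @ [])
      \<in> pres_rel (pverts \<Gamma>) (comm_relations \<Gamma>)"
    by (intro pres_rel.relator) auto
  then show ?thesis
    using assms unfolding P_gen[symmetric] pc_group_def
    by (simp add: P.gen_def P.mult_G P.cls_eq_iff)
qed simp

text \<open>The defining relations are commutations along arcs, so von Dyck's theorem asks only that
  images of adjacent vertices commute.\<close>

lemma hom_extension:
  assumes "group H" "f \<in> pverts \<Gamma> \<rightarrow> carrier H"
    and comm: "\<And>x y. (x, y) \<in> parcs \<Gamma> \<Longrightarrow> f x \<otimes>\<^bsub>H\<^esub> f y = f y \<otimes>\<^bsub>H\<^esub> f x"
  obtains F where "F \<in> hom G H" "F \<in> extensional (carrier G)"
    "\<And>x. x \<in> pverts \<Gamma> \<Longrightarrow> F (gen x) = f x"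
proof -
  interpret H: group H by fact
  have rel: "\<forall>(u, v)\<in>comm_relations \<Gamma>. P.word_eval H f u = P.word_eval H f v"
  proof safe
    fix u v assume "(u, v) \<in> comm_relations \<Gamma>"
    then obtain x y where xy: "(x, y) \<in> parcs \<Gamma>" "u = [(x, True), (y, True)]"
        "v = [(y, True), (x, True)]"
      by (auto simp: comm_relations_def)
    have "f x \<in> carrier H" "f y \<in> carrier H"
      using arcs_verts[OF xy(1)] assms(2) by auto
    then show "P.word_eval H f u = P.word_eval H f v"
      using xy comm[OF xy(1)] by simp
  qed
  show thesis
  proof (rule that)
    show "P.lift H f \<in> hom G H"
      using P.lift_hom[OF assms(1,2) rel] by (simp add: pc_group_def)
    show "P.lift H f \<in> extensional (carrier G)"
      by (simp add: P.lift_def pc_group_def)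
    show "P.lift H f (gen x) = f x" if "x \<in> pverts \<Gamma>" for x
      using P.lift_gen[OF assms(1,2) rel that] by (simp add: P_gen)
  qed
qed

lemma hom_eqI:
  assumes "group H" "f \<in> hom G H" "g \<in> hom G H"
    and "\<And>x. x \<in> pverts \<Gamma> \<Longrightarrow> f (gen x) = g (gen x)"
    and "a \<in> carrier G"
  shows "f a = g a"
proof (rule hom_eq_on_generate[OF G.group_axioms assms(1-3)])
  show "gen ` pverts \<Gamma> \<subseteq> carrier G" by auto
  show "f s = g s" if "s \<in> gen ` pverts \<Gamma>" for s using that assms(4) by auto
  show "a \<in> generate G (gen ` pverts \<Gamma>)"
    using assms(5) carrier_generate by (simp add: pc_sub_def)
qed

lemma pc_sub_commute:
  assumes "Y \<subseteq> pverts \<Gamma>" "Z \<subseteq> pverts \<Gamma>" "\<And>y z. y \<in> Y \<Longrightarrow> z \<in> Z \<Longrightarrow> comm y z"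
    and "a \<in> pc_sub \<Gamma> Y" "b \<in> pc_sub \<Gamma> Z"
  shows "a \<otimes>\<^bsub>G\<^esub> b = b \<otimes>\<^bsub>G\<^esub> a"
  using assms(4,5) unfolding pc_sub_def
proof (rule G.generate_commute[rotated 3])
  show "gen ` Y \<subseteq> carrier G" "gen ` Z \<subseteq> carrier G"
    using assms(1,2) by auto
  show "s \<otimes>\<^bsub>G\<^esub> t = t \<otimes>\<^bsub>G\<^esub> s" if st: "s \<in> gen ` Y" "t \<in> gen ` Z" for s t
  proof -
    from st obtain y z where "y \<in> Y" "z \<in> Z" "s = gen y" "t = gen z" by blast
    then show ?thesis using assms(1,2) gen_commute[OF assms(3), of y z] by auto
  qed
qed

lemma pc_sub_subgroup: "Y \<subseteq> pverts \<Gamma> \<Longrightarrow> subgroup (pc_sub \<Gamma> Y) G"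
  unfolding pc_sub_def by (intro G.generate_is_subgroup) auto

lemma pc_sub_carrier: "Y \<subseteq> pverts \<Gamma> \<Longrightarrow> pc_sub \<Gamma> Y \<subseteq> carrier G"
  by (rule subgroup.subset[OF pc_sub_subgroup])

lemma pc_sub_gen: "y \<in> Y \<Longrightarrow> gen y \<in> pc_sub \<Gamma> Y"
  unfolding pc_sub_def by (intro generate.incl) auto

lemma pc_sub_mono: "Y \<subseteq> Z \<Longrightarrow> pc_sub \<Gamma> Y \<subseteq> pc_sub \<Gamma> Z"
  unfolding pc_sub_def by (intro G.mono_generate) auto

lemma hom_pc_sub_subset:
  assumes "F \<in> hom G G" "Y \<subseteq> pverts \<Gamma>" "subgroup K G" "\<And>y. y \<in> Y \<Longrightarrow> F (gen y) \<in> K"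
  shows "F ` pc_sub \<Gamma> Y \<subseteq> K"
proof -
  interpret F: group_hom G G F
    using assms(1) by (simp add: group_hom_def group_hom_axioms_def G.group_axioms)
  have "F ` pc_sub \<Gamma> Y = generate G (F ` gen ` Y)"
    unfolding pc_sub_def using gens_closed[OF assms(2)] by (rule F.generate_img[symmetric])
  also have "\<dots> \<subseteq> K"
    using assms(3,4) by (intro G.generate_subgroup_incl) auto
  finally show ?thesis .
qed

section \<open>Exponents of group elements\<close>

definition expo :: "'a \<Rightarrow> 'a word set \<Rightarrow> int" where
  "expo z = (SOME h. h \<in> hom G integer_group \<and>
     (\<forall>x\<in>pverts \<Gamma>. h (gen x) = (if x = z then 1 else 0)))"

text \<open>The assignment sending z to 1 and every other vertex to 0 extends because the integers
  are abelian; the choice operator in \<open>expo\<close> therefore has a witness.\<close>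

lemma expo_hom: "expo z \<in> hom G integer_group"
  and expo_gen: "x \<in> pverts \<Gamma> \<Longrightarrow> expo z (gen x) = (if x = z then 1 else 0)"
proof -
  have "\<exists>h. h \<in> hom G integer_group \<and> (\<forall>x\<in>pverts \<Gamma>. h (gen x) = (if x = z then 1 else 0))"
    by (rule hom_extension[OF group_integer_group, of "\<lambda>x. if x = z then 1 else 0"]) auto
  then have "expo z \<in> hom G integer_group \<and>
      (\<forall>x\<in>pverts \<Gamma>. expo z (gen x) = (if x = z then 1 else 0))"
    unfolding expo_def by (rule someI_ex)
  then show "expo z \<in> hom G integer_group"
    and "x \<in> pverts \<Gamma> \<Longrightarrow> expo z (gen x) = (if x = z then 1 else 0)" by auto
qed

lemma expo_group_hom: "group_hom G integer_group (expo z)"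
  using expo_hom by (simp add: group_hom_def group_hom_axioms_def G.group_axioms)

lemma expo_mult: "g \<in> carrier G \<Longrightarrow> h \<in> carrier G \<Longrightarrow> expo z (g \<otimes>\<^bsub>G\<^esub> h) = expo z g + expo z h"
  using group_hom.hom_mult[OF expo_group_hom] by simp

lemma expo_one: "expo z \<one>\<^bsub>G\<^esub> = 0"
  using group_hom.hom_one[OF expo_group_hom] by simp

lemma expo_inv: "g \<in> carrier G \<Longrightarrow> expo z (inv\<^bsub>G\<^esub> g) = - expo z g"
  using group_hom.hom_inv[OF expo_group_hom] by simp

lemma expo_outside:
  assumes "Y \<subseteq> pverts \<Gamma>" "g \<in> pc_sub \<Gamma> Y" "z \<notin> Y"
  shows "expo z g = 0"
proof -
  have "g \<in> generate G (gen ` Y)" using assms(2) by (simp add: pc_sub_def)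
  then show ?thesis
  proof (induction rule: generate.induct)
    case one
    then show ?case by (rule expo_one)
  next
    case (incl h)
    then show ?case using assms expo_gen by auto
  next
    case (inv h)
    then show ?case using assms expo_gen expo_inv by auto
  next
    case (eng g h)
    then show ?case using assms(1) G.generate_in_carrier[OF gens_closed[OF assms(1)]] by (simp add: expo_mult)
  qed
qed

text \<open>Both sides are homomorphisms to the integers in \<open>g\<close> and agree on
  generators. This identity becomes the matrix product when the exponents are arranged in
  rows.\<close>

lemma expo_hom_comp:
  assumes "F \<in> hom G G" "g \<in> carrier G"
  shows "expo z (F g) = (\<Sum>x\<in>pverts \<Gamma>. expo x g * expo z (F (gen x)))"
proof (rule hom_eqI[OF group_integer_group _ _ _ assms(2)])
  interpret F: group_hom G G F
    using assms(1) by (simp add: group_hom_def group_hom_axioms_def G.group_axioms)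
  show "(\<lambda>g. expo z (F g)) \<in> hom G integer_group"
    by (intro homI) (auto simp: expo_mult)
  show "(\<lambda>g. \<Sum>x\<in>pverts \<Gamma>. expo x g * expo z (F (gen x))) \<in> hom G integer_group"
    by (intro homI) (auto simp: expo_mult sum.distrib algebra_simps)
  show "expo z (F (gen y)) = (\<Sum>x\<in>pverts \<Gamma>. expo x (gen y) * expo z (F (gen x)))"
    if "y \<in> pverts \<Gamma>" for y
    using that finite_verts by (simp add: expo_gen if_distrib[of "\<lambda>c. c * _"] sum.delta cong: if_cong)
qed

end

section \<open>Coordinates on subgroups generated by cliques\<close>

locale ordered_pc_graph = pc_graph \<Gamma> for \<Gamma> :: "'a pair_pre_digraph" +
  fixes xs :: "'a list"
  assumes set_xs: "set xs = pverts \<Gamma>" and distinct_xs: "distinct xs"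
begin

lemma length_xs: "length xs = card (pverts \<Gamma>)"
  using distinct_card[OF distinct_xs] set_xs by simp

lemma nth_verts [simp]: "i < length xs \<Longrightarrow> xs ! i \<in> pverts \<Gamma>"
  unfolding set_xs[symmetric] by (rule nth_mem)

lemma verts_nth: "x \<in> pverts \<Gamma> \<Longrightarrow> \<exists>i<length xs. xs ! i = x"
  unfolding set_xs[symmetric] in_set_conv_nth .

lemma sum_verts: "(\<Sum>x\<in>pverts \<Gamma>. f x) = (\<Sum>i<length xs. f (xs ! i))"
  using sum.distinct_set_conv_list[OF distinct_xs, of f] set_xs
  by (simp add: sum_list_sum_nth atLeast0LessThan)

lemma gen_power_prod_eq:
  "gen_power_prod \<Gamma> xs a = G.pow_prod (\<lambda>j. gen (xs ! j)) [0..<length xs] a"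
  by (simp add: gen_power_prod_def G.pow_prod_def)

lemma gen_power_prod_closed: "gen_power_prod \<Gamma> xs a \<in> carrier G"
  unfolding gen_power_prod_eq by (rule G.pow_prod_closed) simp

lemma expo_gen_power_prod:
  assumes "i < length xs"
  shows "expo (xs ! i) (gen_power_prod \<Gamma> xs a) = a i"
proof -
  have "expo (xs ! i) (gen_power_prod \<Gamma> xs a)
      = (\<Sum>j\<leftarrow>[0..<length xs]. a j * expo (xs ! i) (gen (xs ! j)))"
    unfolding gen_power_prod_eq by (rule hom_pow_prod_int[OF G.group_axioms expo_hom]) simp
  also have "\<dots> = (\<Sum>j<length xs. if j = i then a j else 0)"
    unfolding sum_list_distinct_conv_sum_set[OF distinct_upt] set_upt atLeast0LessThan
    using assms distinct_xs by (intro sum.cong) (auto simp: expo_gen nth_eq_iff_index_eq)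
  also have "\<dots> = a i" using assms by simp
  finally show ?thesis .
qed

lemma gen_power_prod_in_sub:
  assumes "Y \<subseteq> pverts \<Gamma>" "\<And>j. j < length xs \<Longrightarrow> xs ! j \<notin> Y \<Longrightarrow> a j = 0"
  shows "gen_power_prod \<Gamma> xs a \<in> pc_sub \<Gamma> Y"
proof -
  let ?J = "{j. j < length xs \<and> xs ! j \<in> Y}"
  have "gen_power_prod \<Gamma> xs a \<in> generate G ((\<lambda>j. gen (xs ! j)) ` ?J)"
    unfolding gen_power_prod_eq using assms by (intro G.pow_prod_in_generate) auto
  moreover have "(\<lambda>j. gen (xs ! j)) ` ?J \<subseteq> gen ` Y" by auto
  ultimately show ?thesis
    unfolding pc_sub_def using G.mono_generate by blast
qed

text \<open>On a clique the product of powers is additive in the exponents (\<open>add\<close>), so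
  the formula passes from generators to products and inverses. Together with
  \<open>expo_gen_power_prod\<close> this says that G(Y) is free abelian with basis Y.\<close>

lemma clique_element:
  assumes "Y \<subseteq> pverts \<Gamma>" "\<And>y z. y \<in> Y \<Longrightarrow> z \<in> Y \<Longrightarrow> comm y z" "g \<in> pc_sub \<Gamma> Y"
  shows "g = gen_power_prod \<Gamma> xs (\<lambda>j. expo (xs ! j) g)"
proof -
  let ?J = "{j. j < length xs \<and> xs ! j \<in> Y}"
  have add: "gen_power_prod \<Gamma> xs (\<lambda>j. a j + b j) = gen_power_prod \<Gamma> xs a \<otimes>\<^bsub>G\<^esub> gen_power_prod \<Gamma> xs b"
    if "\<And>j. j < length xs \<Longrightarrow> xs ! j \<notin> Y \<Longrightarrow> a j = 0"
      "\<And>j. j < length xs \<Longrightarrow> xs ! j \<notin> Y \<Longrightarrow> b j = 0" for a b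
    unfolding gen_power_prod_eq
  proof (rule G.pow_prod_add)
    show "gen (xs ! i) \<otimes>\<^bsub>G\<^esub> gen (xs ! j) = gen (xs ! j) \<otimes>\<^bsub>G\<^esub> gen (xs ! i)"
      if "i \<in> ?J" "j \<in> ?J" for i j
      using that assms(2) by (intro gen_commute) auto
  qed (use that in auto)
  have zero: "gen_power_prod \<Gamma> xs (\<lambda>j. 0) = \<one>\<^bsub>G\<^esub>"
    unfolding gen_power_prod_eq by (rule G.pow_prod_zero) simp
  have single: "gen (xs ! i) = gen_power_prod \<Gamma> xs (\<lambda>j. expo (xs ! j) (gen (xs ! i)))"
    if "i < length xs" for i
  proof -
    have "gen_power_prod \<Gamma> xs (\<lambda>j. expo (xs ! j) (gen (xs ! i)))
        = gen_power_prod \<Gamma> xs (\<lambda>j. if j = i then 1 else 0)"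
      unfolding gen_power_prod_def
      by (rule foldr_cong) (use that distinct_xs in \<open>auto simp: expo_gen nth_eq_iff_index_eq\<close>)
    also have "\<dots> = gen (xs ! i)"
      unfolding gen_power_prod_eq using that by (intro G.pow_prod_single) auto
    finally show ?thesis ..
  qed
  have single': "gen y = gen_power_prod \<Gamma> xs (\<lambda>j. expo (xs ! j) (gen y))" if "y \<in> Y" for y
    using single verts_nth that assms(1) by blast
  have gY: "gen y \<in> carrier G" if "y \<in> Y" for y
    using that assms(1) by auto
  have out: "expo (xs ! j) h = 0" if "h \<in> generate G (gen ` Y)" "xs ! j \<notin> Y" for h j
    using expo_outside[OF assms(1) _ that(2)] that(1) by (simp add: pc_sub_def)
  have "g \<in> generate G (gen ` Y)" using assms(3) by (simp add: pc_sub_def)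
  then show ?thesis
  proof (induction rule: generate.induct)
    case one
    then show ?case by (simp add: expo_one zero)
  next
    case (incl h)
    then obtain y where "y \<in> Y" "h = gen y" by auto
    then show ?case by (simp only: single'[symmetric])
  next
    case (inv h)
    then obtain y where y: "y \<in> Y" "h = gen y" by auto
    have h: "h \<in> carrier G" using y gY by simp
    let ?p = "gen_power_prod \<Gamma> xs (\<lambda>j. expo (xs ! j) (inv\<^bsub>G\<^esub> h))"
    have hs: "h \<in> generate G (gen ` Y)" using inv by (rule generate.incl)
    \<comment> \<open>The candidate \<open>?p\<close> is recognised as a left inverse of
      \<open>h\<close>: by additivity the exponents of \<open>?p\<close> and \<open>h\<close>
      cancel.\<close>
    have "?p \<otimes>\<^bsub>G\<^esub> h = ?p \<otimes>\<^bsub>G\<^esub> gen_power_prod \<Gamma> xs (\<lambda>j. expo (xs ! j) h)"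
      unfolding y(2) by (simp only: single'[OF y(1), symmetric])
    also have "\<dots> = gen_power_prod \<Gamma> xs (\<lambda>j. expo (xs ! j) (inv\<^bsub>G\<^esub> h) + expo (xs ! j) h)"
      using out[OF hs] h by (intro add[symmetric]) (auto simp: expo_inv)
    also have "\<dots> = \<one>\<^bsub>G\<^esub>" using h by (simp add: expo_inv zero)
    finally have "inv\<^bsub>G\<^esub> h = ?p"
      using h gen_power_prod_closed by (intro G.inv_equality)
    then show ?case .
  next
    case (eng g h)
    have "g \<in> carrier G" "h \<in> carrier G"
      using eng G.generate_in_carrier[OF gens_closed[OF assms(1)]] by auto
    moreover have "gen_power_prod \<Gamma> xs (\<lambda>j. expo (xs ! j) g + expo (xs ! j) h) = g \<otimes>\<^bsub>G\<^esub> h"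
      using add[of "\<lambda>j. expo (xs ! j) g" "\<lambda>j. expo (xs ! j) h"] out eng(1,2)
      by (simp add: eng(3,4)[symmetric])
    ultimately show ?case by (simp add: expo_mult)
  qed
qed

lemma clique_element_eqI:
  assumes "Y \<subseteq> pverts \<Gamma>" "\<And>y z. y \<in> Y \<Longrightarrow> z \<in> Y \<Longrightarrow> comm y z"
    and "g \<in> pc_sub \<Gamma> Y" "h \<in> pc_sub \<Gamma> Y" "\<And>z. z \<in> Y \<Longrightarrow> expo z g = expo z h"
  shows "g = h"
proof -
  have expo: "expo z g = expo z h" for z
    using assms(3-5) expo_outside[OF assms(1)] by (cases "z \<in> Y") auto
  have "g = gen_power_prod \<Gamma> xs (\<lambda>j. expo (xs ! j) g)"
    using assms(1-3) by (rule clique_element)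
  also have "\<dots> = gen_power_prod \<Gamma> xs (\<lambda>j. expo (xs ! j) h)"
    by (simp only: expo)
  also have "\<dots> = h"
    using assms(1,2,4) by (rule clique_element[symmetric])
  finally show ?thesis .
qed

end

section \<open>Automorphisms stabilising the closed sets\<close>

context group
begin

lemma auto_iff:
  "\<phi> \<in> auto G \<longleftrightarrow>
    \<phi> \<in> hom G G \<and> \<phi> \<in> extensional (carrier G) \<and> bij_betw \<phi> (carrier G) (carrier G)"
  by (auto simp: auto_def Bij_def)

lemma carrier_right_Aut [simp]: "carrier (right_Aut G) = auto G"
  by (simp add: right_Aut_def AutoGroup_def)

lemma one_right_Aut: "\<one>\<^bsub>right_Aut G\<^esub> = (\<lambda>x\<in>carrier G. x)"
  by (simp add: right_Aut_def AutoGroup_def BijGroup_def)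

lemma mult_right_Aut:
  assumes "\<phi> \<in> auto G" "\<psi> \<in> auto G"
  shows "\<phi> \<otimes>\<^bsub>right_Aut G\<^esub> \<psi> = compose (carrier G) \<psi> \<phi>"
  using assms by (simp add: right_Aut_def AutoGroup_def BijGroup_def auto_def)

text \<open>This is the opposite of \<open>AutoGroup\<close>, so its left inverses are right
  inverses there.\<close>

lemma group_right_Aut: "group (right_Aut G)"
proof -
  interpret A: group "AutoGroup G" by (rule AutoGroup)
  have simps: "carrier (right_Aut G) = carrier (AutoGroup G)" "\<one>\<^bsub>right_Aut G\<^esub> = \<one>\<^bsub>AutoGroup G\<^esub>"
    "\<And>x y. x \<otimes>\<^bsub>right_Aut G\<^esub> y = y \<otimes>\<^bsub>AutoGroup G\<^esub> x"
    by (simp_all add: right_Aut_def)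
  show ?thesis
  proof (rule groupI)
    show "\<exists>y\<in>carrier (right_Aut G). y \<otimes>\<^bsub>right_Aut G\<^esub> x = \<one>\<^bsub>right_Aut G\<^esub>"
      if "x \<in> carrier (right_Aut G)" for x
      using that A.inv_closed[of x] A.r_inv[of x] unfolding simps by blast
  qed (unfold simps, simp_all add: A.m_assoc)
qed

end

section \<open>Recognising elements of St(L) on generators\<close>

context pc_graph
begin

sublocale RA: group "right_Aut G"
  by (rule G.group_right_Aut)

lemma auto_eqI:
  assumes "\<phi> \<in> auto G" "\<psi> \<in> auto G"
    and "\<And>x. x \<in> pverts \<Gamma> \<Longrightarrow> \<phi> (gen x) = \<psi> (gen x)"
  shows "\<phi> = \<psi>"
proof (rule extensionalityI)
  show "\<phi> \<in> extensional (carrier G)" "\<psi> \<in> extensional (carrier G)"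
    using assms(1,2) by (simp_all add: G.auto_iff)
  show "\<phi> a = \<psi> a" if "a \<in> carrier G" for a
  proof (rule hom_eqI[where f = \<phi> and g = \<psi>, OF G.group_axioms])
    show "\<phi> \<in> hom G G" "\<psi> \<in> hom G G" using assms(1,2) by (simp_all add: G.auto_iff)
  qed (use assms(3) that in auto)
qed

lemma St_L_auto: "\<phi> \<in> St_L \<Gamma> \<Longrightarrow> \<phi> \<in> auto G"
  by (simp add: St_L_def)

lemma St_L_gen:
  assumes "\<phi> \<in> St_L \<Gamma>" "x \<in> pverts \<Gamma>"
  shows "\<phi> (gen x) \<in> pc_sub \<Gamma> (cl \<Gamma> {x})"
proof -
  have "\<phi> ` pc_sub \<Gamma> (cl \<Gamma> {x}) = pc_sub \<Gamma> (cl \<Gamma> {x})"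
    using assms cl_closed[of "{x}"] by (simp add: St_L_def)
  then show ?thesis
    using pc_sub_gen[OF self_in_cl[OF assms(2)]] by blast
qed

text \<open>For an arc (x, y) the images lie in the subgroups of cl(x) and cl(y), which commute
  elementwise by \<open>cl_comm\<close>.\<close>

lemma cl_hom_extension:
  assumes "\<And>x. x \<in> pverts \<Gamma> \<Longrightarrow> f x \<in> pc_sub \<Gamma> (cl \<Gamma> {x})"
  shows "\<exists>F. F \<in> hom G G \<and> F \<in> extensional (carrier G) \<and> (\<forall>x\<in>pverts \<Gamma>. F (gen x) = f x)"
proof (rule hom_extension[OF G.group_axioms, of f])
  show "f \<in> pverts \<Gamma> \<rightarrow> carrier G"
  proof
    fix x assume "x \<in> pverts \<Gamma>"
    then have "f x \<in> pc_sub \<Gamma> (cl \<Gamma> {x})" by (rule assms)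
    then show "f x \<in> carrier G" by (rule subsetD[OF pc_sub_carrier[OF cl_subset]])
  qed
  show "f x \<otimes>\<^bsub>G\<^esub> f y = f y \<otimes>\<^bsub>G\<^esub> f x" if xy: "(x, y) \<in> parcs \<Gamma>" for x y
  proof (rule pc_sub_commute[OF cl_subset cl_subset])
    have V: "x \<in> pverts \<Gamma>" "y \<in> pverts \<Gamma>" using arcs_verts[OF xy] by simp_all
    show "f x \<in> pc_sub \<Gamma> (cl \<Gamma> {x})" using V(1) by (rule assms)
    show "f y \<in> pc_sub \<Gamma> (cl \<Gamma> {y})" using V(2) by (rule assms)
    show "comm u v" if "u \<in> cl \<Gamma> {x}" "v \<in> cl \<Gamma> {y}" for u v
      by (rule cl_comm[OF _ V that]) (simp add: comm_def xy)
  qed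
next
  fix F assume "F \<in> hom G G" "F \<in> extensional (carrier G)"
    "\<And>x. x \<in> pverts \<Gamma> \<Longrightarrow> F (gen x) = f x"
  then show ?thesis by blast
qed

lemma comp_id_on_carrier:
  assumes "F \<in> hom G G" "F' \<in> hom G G" "\<And>x. x \<in> pverts \<Gamma> \<Longrightarrow> F' (F (gen x)) = gen x"
    and "a \<in> carrier G"
  shows "F' (F a) = a"
proof -
  have "(F' \<circ> F) a = id a"
  proof (rule hom_eqI[where f = "F' \<circ> F" and g = id, OF G.group_axioms])
    show "F' \<circ> F \<in> hom G G" using assms(1,2) by (rule Group.hom_compose)
    show "id \<in> hom G G" by (simp add: hom_def)
  qed (use assms(3,4) in auto)
  then show ?thesis by simp
qed

lemma autoI:
  assumes "F \<in> hom G G" "F \<in> extensional (carrier G)" "F' \<in> hom G G"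
    and "\<And>x. x \<in> pverts \<Gamma> \<Longrightarrow> F' (F (gen x)) = gen x"
    and "\<And>x. x \<in> pverts \<Gamma> \<Longrightarrow> F (F' (gen x)) = gen x"
  shows "F \<in> auto G"
proof -
  have cl: "F a \<in> carrier G" "F' a \<in> carrier G" if "a \<in> carrier G" for a
    using assms(1,3) that by (auto simp: hom_def)
  have "bij_betw F (carrier G) (carrier G)"
    using cl comp_id_on_carrier[OF assms(1,3,4)] comp_id_on_carrier[OF assms(3,1,5)]
    by (intro bij_betw_byWitness[where f' = F']) auto
  then show ?thesis using assms(1,2) by (simp add: G.auto_iff)
qed

text \<open>A closed set contains the closure of each of its vertices, so both \<open>F\<close> and
  \<open>F'\<close> map each G(Y) into itself; as \<open>F'\<close> inverts \<open>F\<close>, the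
  inclusion for \<open>F'\<close> turns the one for \<open>F\<close> into an equality.\<close>

lemma St_LI:
  assumes "F \<in> hom G G" "F \<in> extensional (carrier G)" "F' \<in> hom G G"
    and "\<And>x. x \<in> pverts \<Gamma> \<Longrightarrow> F (gen x) \<in> pc_sub \<Gamma> (cl \<Gamma> {x})"
    and "\<And>x. x \<in> pverts \<Gamma> \<Longrightarrow> F' (gen x) \<in> pc_sub \<Gamma> (cl \<Gamma> {x})"
    and "\<And>x. x \<in> pverts \<Gamma> \<Longrightarrow> F' (F (gen x)) = gen x"
    and "\<And>x. x \<in> pverts \<Gamma> \<Longrightarrow> F (F' (gen x)) = gen x"
  shows "F \<in> St_L \<Gamma>"
proof -
  have pres: "E ` pc_sub \<Gamma> Y \<subseteq> pc_sub \<Gamma> Y"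
    if Y: "Y \<in> closed_sets \<Gamma>" and E: "E \<in> hom G G"
      "\<And>x. x \<in> pverts \<Gamma> \<Longrightarrow> E (gen x) \<in> pc_sub \<Gamma> (cl \<Gamma> {x})" for E Y
  proof (rule hom_pc_sub_subset[OF E(1)])
    show sub: "Y \<subseteq> pverts \<Gamma>" using Y by (rule closed_subset)
    show "subgroup (pc_sub \<Gamma> Y) G" using sub by (rule pc_sub_subgroup)
    show "E (gen y) \<in> pc_sub \<Gamma> Y" if y: "y \<in> Y" for y
      using E(2)[of y] pc_sub_mono[OF cl_subset_closed[OF Y y]] sub y by blast
  qed
  have "F ` pc_sub \<Gamma> Y = pc_sub \<Gamma> Y" if Y: "Y \<in> closed_sets \<Gamma>" for Y
  proof
    show "F ` pc_sub \<Gamma> Y \<subseteq> pc_sub \<Gamma> Y" by (rule pres[OF Y assms(1,4)])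
    have sub: "pc_sub \<Gamma> Y \<subseteq> carrier G"
      by (rule pc_sub_carrier[OF closed_subset[OF Y]])
    have "F' ` pc_sub \<Gamma> Y \<subseteq> pc_sub \<Gamma> Y" by (rule pres[OF Y assms(3,5)])
    then have "F ` F' ` pc_sub \<Gamma> Y \<subseteq> F ` pc_sub \<Gamma> Y" by (rule image_mono)
    moreover have "F ` F' ` pc_sub \<Gamma> Y = pc_sub \<Gamma> Y"
      using comp_id_on_carrier[OF assms(3,1,7)] sub by (simp add: image_image subset_iff)
    ultimately show "pc_sub \<Gamma> Y \<subseteq> F ` pc_sub \<Gamma> Y" by simp
  qed
  moreover have "F \<in> auto G" by (rule autoI[OF assms(1-3,6,7)])
  ultimately show ?thesis by (simp add: St_L_def)
qed

lemma subgroup_St_L: "subgroup (St_L \<Gamma>) (right_Aut G)"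
proof (rule RA.subgroupI)
  show "St_L \<Gamma> \<subseteq> carrier (right_Aut G)" using St_L_auto by auto
  have "(\<lambda>x\<in>carrier G. x) \<in> St_L \<Gamma>"
  proof -
    have "(\<lambda>x\<in>carrier G. x) ` pc_sub \<Gamma> Y = pc_sub \<Gamma> Y" if Y: "Y \<in> closed_sets \<Gamma>" for Y
    proof -
      have "(\<lambda>x\<in>carrier G. x) ` pc_sub \<Gamma> Y = (\<lambda>x. x) ` pc_sub \<Gamma> Y"
        using pc_sub_carrier[OF closed_subset[OF Y]] by (intro image_cong) auto
      then show ?thesis by simp
    qed
    then show ?thesis using G.id_in_auto by (simp add: St_L_def)
  qed
  then show "St_L \<Gamma> \<noteq> {}" by blast
next
  fix \<phi> assume \<phi>: "\<phi> \<in> St_L \<Gamma>"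
  let ?\<psi> = "inv\<^bsub>right_Aut G\<^esub> \<phi>"
  have a: "\<phi> \<in> carrier (right_Aut G)" using \<phi> by (simp add: St_L_def)
  then have \<psi>: "?\<psi> \<in> auto G" using RA.inv_closed[OF a] by simp
  have comp: "compose (carrier G) ?\<psi> \<phi> = (\<lambda>x\<in>carrier G. x)"
    using RA.r_inv[OF a] a \<psi> by (simp add: G.mult_right_Aut G.one_right_Aut)
  have id: "?\<psi> (\<phi> a) = a" if "a \<in> carrier G" for a
    using fun_cong[OF comp, of a] that by (simp add: compose_def)
  have "?\<psi> ` pc_sub \<Gamma> Y = pc_sub \<Gamma> Y" if Y: "Y \<in> closed_sets \<Gamma>" for Y
  proof -
    have sub: "pc_sub \<Gamma> Y \<subseteq> carrier G"
      by (rule pc_sub_carrier[OF closed_subset[OF Y]])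
    \<comment> \<open>Invariance under \<phi> is used backwards, so that the inverse cancels against
      \<phi>.\<close>
    have "?\<psi> ` pc_sub \<Gamma> Y = ?\<psi> ` \<phi> ` pc_sub \<Gamma> Y"
      using \<phi> Y by (simp add: St_L_def)
    also have "\<dots> = pc_sub \<Gamma> Y"
      using id sub by (simp add: image_image subset_iff)
    finally show ?thesis .
  qed
  then show "?\<psi> \<in> St_L \<Gamma>" using \<psi> by (simp add: St_L_def)
next
  fix \<phi> \<psi> assume st: "\<phi> \<in> St_L \<Gamma>" "\<psi> \<in> St_L \<Gamma>"
  then have a: "\<phi> \<in> auto G" "\<psi> \<in> auto G" by (simp_all add: St_L_def)
  have "(\<phi> \<otimes>\<^bsub>right_Aut G\<^esub> \<psi>) ` pc_sub \<Gamma> Y = pc_sub \<Gamma> Y" if Y: "Y \<in> closed_sets \<Gamma>" for Y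
  proof -
    have sub: "pc_sub \<Gamma> Y \<subseteq> carrier G"
      by (rule pc_sub_carrier[OF closed_subset[OF Y]])
    have "(\<phi> \<otimes>\<^bsub>right_Aut G\<^esub> \<psi>) ` pc_sub \<Gamma> Y = \<psi> ` \<phi> ` pc_sub \<Gamma> Y"
      unfolding G.mult_right_Aut[OF a] image_image using sub by (intro image_cong) (auto simp: compose_def)
    then show ?thesis using st Y by (simp add: St_L_def)
  qed
  moreover have "\<phi> \<otimes>\<^bsub>right_Aut G\<^esub> \<psi> \<in> auto G"
    using RA.m_closed[of \<phi> \<psi>] a by simp
  ultimately show "\<phi> \<otimes>\<^bsub>right_Aut G\<^esub> \<psi> \<in> St_L \<Gamma>"
    by (simp add: St_L_def)
qed

section \<open>Sign changes and transvections\<close>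

lemma hom_inv_apply: "F \<in> hom G G \<Longrightarrow> a \<in> carrier G \<Longrightarrow> F (inv\<^bsub>G\<^esub> a) = inv\<^bsub>G\<^esub> F a"
  using group_hom.hom_inv[of G G F a] by (simp add: group_hom_def group_hom_axioms_def G.group_axioms)

lemma hom_mult_apply:
  "F \<in> hom G G \<Longrightarrow> a \<in> carrier G \<Longrightarrow> b \<in> carrier G \<Longrightarrow> F (a \<otimes>\<^bsub>G\<^esub> b) = F a \<otimes>\<^bsub>G\<^esub> F b"
  by (simp add: hom_def)

text \<open>Inverting a generator twice restores it, so such an automorphism is an involution and
  serves as its own inverse in \<open>St_LI\<close>.\<close>

lemma J_subset: "J_set \<Gamma> \<subseteq> St_L \<Gamma>"
proof
  fix \<phi> assume "\<phi> \<in> J_set \<Gamma>"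
  then have hom: "\<phi> \<in> hom G G" and ext: "\<phi> \<in> extensional (carrier G)"
    and J: "\<And>x. x \<in> pverts \<Gamma> \<Longrightarrow> \<phi> (gen x) = gen x \<or> \<phi> (gen x) = inv\<^bsub>G\<^esub> gen x"
    by (auto simp: J_set_def G.auto_iff)
  have sub: "\<phi> (gen x) \<in> pc_sub \<Gamma> (cl \<Gamma> {x})" if x: "x \<in> pverts \<Gamma>" for x
  proof -
    have "gen x \<in> pc_sub \<Gamma> (cl \<Gamma> {x})" by (intro pc_sub_gen self_in_cl x)
    then show ?thesis
      using J[OF x] subgroup.m_inv_closed[OF pc_sub_subgroup[OF cl_subset]] by auto
  qed
  have invol: "\<phi> (\<phi> (gen x)) = gen x" if x: "x \<in> pverts \<Gamma>" for x
    using J[OF x] x hom_inv_apply[OF hom] by auto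
  show "\<phi> \<in> St_L \<Gamma>" by (rule St_LI[OF hom ext hom sub sub invol invol])
qed

lemma tr_exists:
  assumes "x \<in> pverts \<Gamma>" "y \<in> pverts \<Gamma>" "x \<noteq> y" "cl \<Gamma> {y} \<subseteq> cl \<Gamma> {x}"
  shows "\<exists>\<phi>\<in>St_L \<Gamma>. \<phi> (gen x) = gen x \<otimes>\<^bsub>G\<^esub> gen y \<and>
    (\<forall>z\<in>pverts \<Gamma> - {x}. \<phi> (gen z) = gen z)"
proof -
  have y_cl: "y \<in> cl \<Gamma> {x}" using assms in_cl_iff by simp
  note cl_sub = pc_sub_subgroup[OF cl_subset]
  have gens: "gen z \<in> pc_sub \<Gamma> (cl \<Gamma> {z})" if "z \<in> pverts \<Gamma>" for z
    by (intro pc_sub_gen self_in_cl that)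
  have xy: "gen x \<in> pc_sub \<Gamma> (cl \<Gamma> {x})" "gen y \<in> pc_sub \<Gamma> (cl \<Gamma> {x})"
    using gens[OF assms(1)] pc_sub_gen[OF y_cl] by auto
  define f where "f = (\<lambda>z. if z = x then gen x \<otimes>\<^bsub>G\<^esub> gen y else gen z)"
  define f' where "f' = (\<lambda>z. if z = x then gen x \<otimes>\<^bsub>G\<^esub> inv\<^bsub>G\<^esub> gen y else gen z)"
  have f: "f z \<in> pc_sub \<Gamma> (cl \<Gamma> {z})" "f' z \<in> pc_sub \<Gamma> (cl \<Gamma> {z})" if "z \<in> pverts \<Gamma>" for z
    using gens[OF that] subgroup.m_closed[OF cl_sub xy]
      subgroup.m_closed[OF cl_sub xy(1) subgroup.m_inv_closed[OF cl_sub xy(2)]]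
    by (simp_all add: f_def f'_def)
  obtain F where F: "F \<in> hom G G" "F \<in> extensional (carrier G)"
      "\<And>z. z \<in> pverts \<Gamma> \<Longrightarrow> F (gen z) = f z"
    using cl_hom_extension[of f, OF f(1)] by blast
  obtain F' where F': "F' \<in> hom G G" "\<And>z. z \<in> pverts \<Gamma> \<Longrightarrow> F' (gen z) = f' z"
    using cl_hom_extension[of f', OF f(2)] by blast
  have "F \<in> St_L \<Gamma>"
  proof (rule St_LI[OF F(1,2) F'(1)])
    fix z assume z: "z \<in> pverts \<Gamma>"
    show "F (gen z) \<in> pc_sub \<Gamma> (cl \<Gamma> {z})" "F' (gen z) \<in> pc_sub \<Gamma> (cl \<Gamma> {z})"
      using f[OF z] by (simp_all add: F(3)[OF z] F'(2)[OF z])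
    have gz: "gen z \<in> carrier G" "gen x \<in> carrier G" "gen y \<in> carrier G"
      using assms z by simp_all
    have y: "f y = gen y" "f' y = gen y" using assms(3) by (simp_all add: f_def f'_def)
    show "F' (F (gen z)) = gen z"
      using gz assms(1,2) z y
      by (simp add: F(3) F'(2) f_def f'_def hom_mult_apply[OF F'(1)] G.m_assoc)
    show "F (F' (gen z)) = gen z"
      using gz assms(1,2) z y
      by (simp add: F(3) F'(2) f_def f'_def hom_mult_apply[OF F(1)]
          hom_inv_apply[OF F(1)] G.m_assoc)
  qed
  moreover have "F (gen x) = gen x \<otimes>\<^bsub>G\<^esub> gen y" using F(3)[OF assms(1)] by (simp add: f_def)
  moreover have "\<forall>z\<in>pverts \<Gamma> - {x}. F (gen z) = gen z" using F(3) by (simp add: f_def)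
  ultimately show ?thesis by blast
qed

text \<open>An automorphism is determined by its values on generators, so the definite description
  \<open>tr\<close> denotes the map just constructed.\<close>

lemma tr_props:
  assumes "x \<in> pverts \<Gamma>" "y \<in> pverts \<Gamma>" "x \<noteq> y" "cl \<Gamma> {y} \<subseteq> cl \<Gamma> {x}"
  shows "tr \<Gamma> x y \<in> St_L \<Gamma>" "tr \<Gamma> x y (gen x) = gen x \<otimes>\<^bsub>G\<^esub> gen y"
    "\<And>z. z \<in> pverts \<Gamma> - {x} \<Longrightarrow> tr \<Gamma> x y (gen z) = gen z"
proof -
  obtain \<phi> where \<phi>: "\<phi> \<in> St_L \<Gamma>" "\<phi> (gen x) = gen x \<otimes>\<^bsub>G\<^esub> gen y"
    "\<And>z. z \<in> pverts \<Gamma> - {x} \<Longrightarrow> \<phi> (gen z) = gen z"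
    using tr_exists[OF assms] by blast
  have "tr \<Gamma> x y = \<phi>"
    unfolding tr_def
  proof (rule the_equality)
    show "\<phi> \<in> auto G \<and> \<phi> (gen x) = gen x \<otimes>\<^bsub>G\<^esub> gen y \<and> (\<forall>z\<in>pverts \<Gamma> - {x}. \<phi> (gen z) = gen z)"
      using \<phi> St_L_auto by blast
    fix \<psi>
    assume \<psi>: "\<psi> \<in> auto G \<and> \<psi> (gen x) = gen x \<otimes>\<^bsub>G\<^esub> gen y \<and> (\<forall>z\<in>pverts \<Gamma> - {x}. \<psi> (gen z) = gen z)"
    show "\<psi> = \<phi>"
    proof (rule auto_eqI)
      show "\<psi> \<in> auto G" using \<psi> by simp
      show "\<phi> \<in> auto G" using \<phi>(1) by (rule St_L_auto)
      show "\<psi> (gen z) = \<phi> (gen z)" if "z \<in> pverts \<Gamma>" for z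
        using \<psi> \<phi>(2,3) that by (cases "z = x") auto
    qed
  qed
  then show "tr \<Gamma> x y \<in> St_L \<Gamma>" "tr \<Gamma> x y (gen x) = gen x \<otimes>\<^bsub>G\<^esub> gen y"
    "\<And>z. z \<in> pverts \<Gamma> - {x} \<Longrightarrow> tr \<Gamma> x y (gen z) = gen z"
    using \<phi> by auto
qed

lemma Tr_perp_subset: "Tr_perp \<Gamma> \<subseteq> St_L \<Gamma>"
  using tr_props(1) by (auto simp: Tr_perp_def)

text \<open>Membership of y in the double complement of x says that every vertex of the complement
  of x is within distance 1 of y, which yields the condition on complements in
  \<open>Tr_perp\<close>.\<close>

lemma tr_in_Tr_perp:
  assumes "x \<in> pverts \<Gamma>" "y \<in> pverts \<Gamma>" "less_L \<Gamma> y x"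
  shows "tr \<Gamma> x y \<in> Tr_perp \<Gamma>"
proof -
  have sub: "cl \<Gamma> {y} \<subset> cl \<Gamma> {x}" using assms(3) by (simp add: less_L_def)
  then have "y \<in> cl \<Gamma> {x}" using assms in_cl_iff by auto
  then have "orth \<Gamma> {x} \<subseteq> orth \<Gamma> {y}"
    using comm_sym by (auto simp: cl_def in_orth_iff)
  moreover have "x \<noteq> y" using sub by auto
  ultimately show ?thesis using assms sub unfolding Tr_perp_def by blast
qed

section \<open>Automorphisms of the subgroup of one class\<close>

abbreviation class_group :: "'a \<Rightarrow> 'a word set monoid" where
  "class_group x \<equiv> G\<lparr>carrier := pc_sub \<Gamma> (eq_class \<Gamma> x)\<rparr>"

lemma class_subgroup: "subgroup (pc_sub \<Gamma> (eq_class \<Gamma> x)) G"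
  by (rule pc_sub_subgroup[OF eq_class_subset])

lemma group_class_group: "group (class_group x)"
  by (rule G.subgroup_imp_group[OF class_subgroup])

text \<open>A class lies in the closure of each of its members, so the images prescribed by
  \<open>\<theta>\<close> are admissible for \<open>cl_hom_extension\<close>. The last clause is the
  form in which \<open>St_LI\<close> consumes the result.\<close>

lemma class_hom_extension:
  assumes "x \<in> pverts \<Gamma>" "\<theta> \<in> hom (class_group x) (class_group x)"
  shows "\<exists>F. F \<in> hom G G \<and> F \<in> extensional (carrier G) \<and>
    (\<forall>g\<in>pc_sub \<Gamma> (eq_class \<Gamma> x). F g = \<theta> g) \<and>
    (\<forall>z\<in>pverts \<Gamma> - eq_class \<Gamma> x. F (gen z) = gen z) \<and>
    (\<forall>z\<in>pverts \<Gamma>. F (gen z) \<in> pc_sub \<Gamma> (cl \<Gamma> {z}))"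
proof -
  let ?K = "pc_sub \<Gamma> (eq_class \<Gamma> x)"
  define f where "f = (\<lambda>z. if z \<in> eq_class \<Gamma> x then \<theta> (gen z) else gen z)"
  have f: "f z \<in> pc_sub \<Gamma> (cl \<Gamma> {z})" if z: "z \<in> pverts \<Gamma>" for z
  proof (cases "z \<in> eq_class \<Gamma> x")
    case True
    have "\<theta> (gen z) \<in> ?K"
      using assms(2) pc_sub_gen[OF True] by (auto simp: hom_def)
    moreover have "eq_class \<Gamma> x \<subseteq> cl \<Gamma> {z}"
      using eq_class_subset_cl[OF z] eq_class_cong[OF True] by simp
    ultimately show ?thesis
      using True pc_sub_mono by (auto simp: f_def)
  next
    case False
    then show ?thesis using pc_sub_gen[OF self_in_cl[OF z]] by (simp add: f_def)
  qed
  obtain F where F: "F \<in> hom G G" "F \<in> extensional (carrier G)"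
      "\<And>z. z \<in> pverts \<Gamma> \<Longrightarrow> F (gen z) = f z"
    using cl_hom_extension[of f, OF f] by blast
  have K: "?K \<subseteq> carrier G" by (rule subgroup.subset[OF class_subgroup])
  have agree: "F g = \<theta> g" if "g \<in> ?K" for g
  proof (rule hom_eq_on_generate[where f = F and g = \<theta>, OF group_class_group[of x] G.group_axioms])
    show "F \<in> hom (class_group x) G" using F(1) K by (simp add: hom_def Pi_iff subset_iff)
    show "\<theta> \<in> hom (class_group x) G" using assms(2) K by (simp add: hom_def Pi_iff subset_iff)
    show "gen ` eq_class \<Gamma> x \<subseteq> carrier (class_group x)" using pc_sub_gen by auto
    show "F s = \<theta> s" if "s \<in> gen ` eq_class \<Gamma> x" for s
    proof -
      obtain z where "z \<in> eq_class \<Gamma> x" "s = gen z" using \<open>s \<in> gen ` eq_class \<Gamma> x\<close> by blast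
      then show ?thesis using F(3)[of z] subsetD[OF eq_class_subset, of z x] by (simp add: f_def)
    qed
    \<comment> \<open>\<open>\<theta>\<close> is a homomorphism only on the class group, so
      generation has to be read there before the two maps can be compared.\<close>
    have "generate (class_group x) (gen ` eq_class \<Gamma> x) = generate G (gen ` eq_class \<Gamma> x)"
      using pc_sub_gen by (intro G.generate_consistent class_subgroup) auto
    then show "g \<in> generate (class_group x) (gen ` eq_class \<Gamma> x)"
      using that by (simp add: pc_sub_def)
  qed
  have "\<forall>z\<in>pverts \<Gamma> - eq_class \<Gamma> x. F (gen z) = gen z"
    using F(3) by (simp add: f_def)
  moreover have "\<forall>z\<in>pverts \<Gamma>. F (gen z) \<in> pc_sub \<Gamma> (cl \<Gamma> {z})"
    using F(3) f by simp
  ultimately show ?thesis using F(1,2) agree by blast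
qed

lemma ext_aut_eqI:
  assumes "x \<in> pverts \<Gamma>" "\<phi> \<in> auto G"
    and "\<And>g. g \<in> pc_sub \<Gamma> (eq_class \<Gamma> x) \<Longrightarrow> \<phi> g = \<theta> g"
    and "\<And>z. z \<in> pverts \<Gamma> - eq_class \<Gamma> x \<Longrightarrow> \<phi> (gen z) = gen z"
  shows "ext_aut \<Gamma> x \<theta> = \<phi>"
  unfolding ext_aut_def
proof (rule the_equality)
  show "\<phi> \<in> auto G \<and> (\<forall>g\<in>pc_sub \<Gamma> (eq_class \<Gamma> x). \<phi> g = \<theta> g) \<and>
      (\<forall>z\<in>pverts \<Gamma> - eq_class \<Gamma> x. \<phi> (gen z) = gen z)"
    using assms by blast
  fix \<psi>
  assume \<psi>: "\<psi> \<in> auto G \<and> (\<forall>g\<in>pc_sub \<Gamma> (eq_class \<Gamma> x). \<psi> g = \<theta> g) \<and>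
      (\<forall>z\<in>pverts \<Gamma> - eq_class \<Gamma> x. \<psi> (gen z) = gen z)"
  show "\<psi> = \<phi>"
  proof (rule auto_eqI[OF _ assms(2)])
    show "\<psi> \<in> auto G" using \<psi> by simp
    show "\<psi> (gen z) = \<phi> (gen z)" if "z \<in> pverts \<Gamma>" for z
      using \<psi> assms(3,4) that pc_sub_gen by (cases "z \<in> eq_class \<Gamma> x") auto
  qed
qed

text \<open>The extensions of \<open>\<theta>\<close> and of its inverse undo each other on every
  generator, inside the class by the choice of \<open>\<theta>'\<close> and outside because both fix
  it.\<close>

lemma ext_aut_in_St_L:
  assumes x: "x \<in> pverts \<Gamma>" and \<theta>: "\<theta> \<in> auto (class_group x)"
  shows "ext_aut \<Gamma> x \<theta> \<in> St_L \<Gamma>"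
proof -
  let ?K = "pc_sub \<Gamma> (eq_class \<Gamma> x)"
  interpret K: group "class_group x" by (rule group_class_group)
  define \<theta>' where "\<theta>' = restrict (inv_into ?K \<theta>) ?K"
  have hom: "\<theta> \<in> hom (class_group x) (class_group x)" and bij: "bij_betw \<theta> ?K ?K"
    using \<theta> by (simp_all add: K.auto_iff)
  have hom': "\<theta>' \<in> hom (class_group x) (class_group x)"
    using K.restrict_inv_into_hom[of \<theta>] \<theta> unfolding \<theta>'_def auto_def by simp
  have mem: "\<theta> g \<in> ?K" "\<theta>' g \<in> ?K" if "g \<in> ?K" for g
    using hom hom' that by (auto simp: hom_def)
  have inv: "\<theta>' (\<theta> g) = g" "\<theta> (\<theta>' g) = g" if "g \<in> ?K" for g
    using that bij mem(1)[OF that] by (simp_all add: \<theta>'_def bij_betw_def inv_into_f_f f_inv_into_f)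
  obtain F where F: "F \<in> hom G G" "F \<in> extensional (carrier G)"
    "\<And>g. g \<in> ?K \<Longrightarrow> F g = \<theta> g" "\<And>z. z \<in> pverts \<Gamma> - eq_class \<Gamma> x \<Longrightarrow> F (gen z) = gen z"
    "\<And>z. z \<in> pverts \<Gamma> \<Longrightarrow> F (gen z) \<in> pc_sub \<Gamma> (cl \<Gamma> {z})"
    using class_hom_extension[OF x hom] by blast
  obtain F' where F': "F' \<in> hom G G"
    "\<And>g. g \<in> ?K \<Longrightarrow> F' g = \<theta>' g" "\<And>z. z \<in> pverts \<Gamma> - eq_class \<Gamma> x \<Longrightarrow> F' (gen z) = gen z"
    "\<And>z. z \<in> pverts \<Gamma> \<Longrightarrow> F' (gen z) \<in> pc_sub \<Gamma> (cl \<Gamma> {z})"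
    using class_hom_extension[OF x hom'] by blast
  have comp: "F' (F (gen z)) = gen z \<and> F (F' (gen z)) = gen z" if z: "z \<in> pverts \<Gamma>" for z
  proof (cases "z \<in> eq_class \<Gamma> x")
    case True
    then have K: "gen z \<in> ?K" by (rule pc_sub_gen)
    then show ?thesis by (simp only: F(3) F'(2) mem inv simp_thms)
  next
    case False
    then show ?thesis using z by (simp add: F(4) F'(3))
  qed
  have St: "F \<in> St_L \<Gamma>"
    by (rule St_LI[OF F(1,2) F'(1) F(5) F'(4)]) (simp_all only: comp simp_thms)
  have "ext_aut \<Gamma> x \<theta> = F"
    by (rule ext_aut_eqI[OF x St_L_auto[OF St] F(3,4)])
  with St show ?thesis by simp
qed

lemma V_perp_subset: "V_perp \<Gamma> \<subseteq> St_L \<Gamma>"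
  unfolding V_perp_def
  by (rule RA.generate_subgroup_incl[OF _ subgroup_St_L]) (use ext_aut_in_St_L in blast)

lemma generate_subset_St_L:
  "generate (right_Aut G) (J_set \<Gamma> \<union> V_perp \<Gamma> \<union> Tr_perp \<Gamma>) \<subseteq> St_L \<Gamma>"
  by (rule RA.generate_subgroup_incl[OF _ subgroup_St_L])
    (use J_subset V_perp_subset Tr_perp_subset in blast)

text \<open>Such a map is the extension of its own restriction to the class group, by the uniqueness
  in \<open>ext_aut_eqI\<close>.\<close>

lemma in_V_perp:
  assumes x: "x \<in> pverts \<Gamma>" "card (eq_class \<Gamma> x) \<ge> 2" and \<phi>: "\<phi> \<in> auto G"
    and img: "\<phi> ` pc_sub \<Gamma> (eq_class \<Gamma> x) = pc_sub \<Gamma> (eq_class \<Gamma> x)"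
    and fixes_rest: "\<And>z. z \<in> pverts \<Gamma> - eq_class \<Gamma> x \<Longrightarrow> \<phi> (gen z) = gen z"
  shows "\<phi> \<in> V_perp \<Gamma>"
proof -
  let ?K = "pc_sub \<Gamma> (eq_class \<Gamma> x)"
  interpret K: group "class_group x" by (rule group_class_group)
  have sub: "?K \<subseteq> carrier G" by (rule subgroup.subset[OF class_subgroup])
  have hom: "\<phi> \<in> hom G G" and inj: "inj_on \<phi> (carrier G)"
    using \<phi> by (auto simp: G.auto_iff bij_betw_def)
  have mult: "a \<otimes>\<^bsub>G\<^esub> b \<in> ?K" if "a \<in> ?K" "b \<in> ?K" for a b
    using subgroup.m_closed[OF class_subgroup that] .
  have "restrict \<phi> ?K \<in> hom (class_group x) (class_group x)"
  proof (rule homI)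
    fix a b assume "a \<in> carrier (class_group x)" "b \<in> carrier (class_group x)"
    then have ab: "a \<in> ?K" "b \<in> ?K" by simp_all
    then show "restrict \<phi> ?K a \<in> carrier (class_group x)" using img by auto
    show "restrict \<phi> ?K (a \<otimes>\<^bsub>class_group x\<^esub> b) =
        restrict \<phi> ?K a \<otimes>\<^bsub>class_group x\<^esub> restrict \<phi> ?K b"
      using ab sub mult[OF ab] hom_mult_apply[OF hom, of a b] by (simp add: subset_iff)
  qed
  moreover have "bij_betw (restrict \<phi> ?K) ?K ?K"
    using img inj_on_subset[OF inj sub] by (simp add: bij_betw_def inj_on_restrict_eq)
  ultimately have "restrict \<phi> ?K \<in> auto (class_group x)"
    by (simp add: K.auto_iff)
  moreover have "ext_aut \<Gamma> x (restrict \<phi> ?K) = \<phi>"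
    by (rule ext_aut_eqI[OF x(1) \<phi> _ fixes_rest]) simp_all
  ultimately have "\<phi> \<in> ext_aut \<Gamma> x ` auto (class_group x)"
    by (metis image_eqI)
  then show ?thesis
    unfolding V_perp_def using x by (intro generate.incl) blast
qed

end

section \<open>Matrices of automorphisms\<close>

lemma carrier_GL: "carrier (GL n) = {A \<in> carrier_mat n n. \<exists>B\<in>carrier_mat n n. A * B = 1\<^sub>m n \<and> B * A = 1\<^sub>m n}"
  by (auto simp: GL_def units_of_def Units_def ring_mat_simps)

lemma mult_GL [simp]: "A \<otimes>\<^bsub>GL n\<^esub> B = A * B"
  by (simp add: GL_def units_of_def ring_mat_simps)

lemma one_GL [simp]: "\<one>\<^bsub>GL n\<^esub> = 1\<^sub>m n"
  by (simp add: GL_def units_of_def ring_mat_simps)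

lemma group_GL: "group (GL n :: 'r :: comm_ring_1 mat monoid)"
proof -
  interpret ring "ring_mat TYPE('r) n ()" by (rule ring_mat)
  show ?thesis unfolding GL_def by (rule units_group)
qed

lemma mult_mat_index:
  assumes "A \<in> carrier_mat n n" "B \<in> carrier_mat n n" "i < n" "j < n"
  shows "(A * B) $$ (i, j) = (\<Sum>l<n. A $$ (i, l) * B $$ (l, j))"
  using assms by (simp add: scalar_prod_def atLeast0LessThan)

lemma eq_one_matI:
  assumes "A \<in> carrier_mat n n" "\<And>i j. i < n \<Longrightarrow> j < n \<Longrightarrow> A $$ (i, j) = (if i = j then 1 else 0)"
  shows "A = 1\<^sub>m n"
  using assms by (intro eq_matI) auto

text \<open>\<open>d\<close> is a two-sided inverse of the block of \<open>A\<close> on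
  \<open>I\<close>, with rows and columns named by the elements of \<open>I\<close> themselves. Sums
  over \<open>I\<close> are easier to split off from sums over all indices than products of a
  renumbered \<open>submatrix\<close>.\<close>

definition block_unit :: "'r :: comm_ring_1 mat \<Rightarrow> nat set \<Rightarrow> (nat \<Rightarrow> nat \<Rightarrow> 'r) \<Rightarrow> bool" where
  "block_unit A I d \<longleftrightarrow> (\<forall>i\<in>I. \<forall>j\<in>I.
     (\<Sum>l\<in>I. A $$ (i, l) * d l j) = (if i = j then 1 else 0) \<and>
     (\<Sum>l\<in>I. d i l * A $$ (l, j)) = (if i = j then 1 else 0))"

lemma submatrix_GL_iff:
  assumes A: "A \<in> carrier_mat n n" and I: "I \<subseteq> {..<n}"
  shows "submatrix A I I \<in> carrier (GL (card I)) \<longleftrightarrow> (\<exists>d. block_unit A I d)"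
proof -
  let ?m = "card I"
  \<comment> \<open>The rank of an element in \<open>I\<close>, inverse to the increasing
    enumeration \<open>pick I\<close>; the two translate between block positions and original
    indices.\<close>
  let ?r = "\<lambda>i. card {a \<in> I. a < i}"
  have fin: "finite I" using I finite_subset by blast
  have card_eq: "{i. i < n \<and> i \<in> I} = I" using I by auto
  have sub: "submatrix A I I = mat ?m ?m (\<lambda>(i, j). A $$ (pick I i, pick I j))"
    using A by (simp add: submatrix_def card_eq)
  have pick_in: "pick I i \<in> I" if "i < ?m" for i using pick_in_set_le[OF that] .
  have r_pick: "?r (pick I i) = i" if "i < ?m" for i using card_pick_le[OF that] .
  have pick_r: "pick I (?r i) = i" if "i \<in> I" for i using pick_card_in_set[OF that] .
  have r_less: "?r i < ?m" if "i \<in> I" for i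
    using that fin by (intro psubset_card_mono) auto
  have bij: "bij_betw (pick I) {..<?m} I"
    using pick_in r_pick pick_r r_less by (intro bij_betw_byWitness[where f' = ?r]) auto
  have sum_I: "(\<Sum>l\<in>I. f l) = (\<Sum>l<?m. f (pick I l))" for f :: "nat \<Rightarrow> 'a"
    using sum.reindex_bij_betw[OF bij, of f] by simp
  have pick_eq: "pick I i = pick I j \<longleftrightarrow> i = j" if "i < ?m" "j < ?m" for i j
    using r_pick[OF that(1)] r_pick[OF that(2)] by metis
  show ?thesis
  proof
    assume "submatrix A I I \<in> carrier (GL ?m)"
    then obtain B where B: "B \<in> carrier_mat ?m ?m" "submatrix A I I * B = 1\<^sub>m ?m"
        "B * submatrix A I I = 1\<^sub>m ?m"
      by (auto simp: carrier_GL)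
    have S: "submatrix A I I \<in> carrier_mat ?m ?m" by (simp add: sub)
    define d where "d = (\<lambda>i j. B $$ (?r i, ?r j))"
    have "(\<Sum>l\<in>I. A $$ (i, l) * d l j) = (if i = j then 1 else 0) \<and>
        (\<Sum>l\<in>I. d i l * A $$ (l, j)) = (if i = j then 1 else 0)" if ij: "i \<in> I" "j \<in> I" for i j
    proof -
      have r: "?r i = ?r j \<longleftrightarrow> i = j" using pick_r[OF ij(1)] pick_r[OF ij(2)] by metis
      have "(\<Sum>l\<in>I. A $$ (i, l) * d l j) = (submatrix A I I * B) $$ (?r i, ?r j)"
        using ij r_less pick_r r_pick B(1) S
        by (subst mult_mat_index[OF S B(1)]) (auto simp: sum_I d_def sub intro!: sum.cong)
      moreover have "(\<Sum>l\<in>I. d i l * A $$ (l, j)) = (B * submatrix A I I) $$ (?r i, ?r j)"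
        using ij r_less pick_r r_pick B(1) S
        by (subst mult_mat_index[OF B(1) S]) (auto simp: sum_I d_def sub intro!: sum.cong)
      ultimately show ?thesis using B(2,3) ij r_less r by simp
    qed
    then have "block_unit A I d" unfolding block_unit_def by blast
    then show "\<exists>d. block_unit A I d" by blast
  next
    assume "\<exists>d. block_unit A I d"
    then obtain d where d: "block_unit A I d" by blast
    define B where "B = mat ?m ?m (\<lambda>(i, j). d (pick I i) (pick I j))"
    have S: "submatrix A I I \<in> carrier_mat ?m ?m" by (simp add: sub)
    have B: "B \<in> carrier_mat ?m ?m" by (simp add: B_def)
    have "submatrix A I I * B = 1\<^sub>m ?m"
    proof (rule eq_one_matI)
      show "(submatrix A I I * B) $$ (i, j) = (if i = j then 1 else 0)" if "i < ?m" "j < ?m" for i j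
      proof -
        have "(submatrix A I I * B) $$ (i, j) = (\<Sum>l\<in>I. A $$ (pick I i, l) * d l (pick I j))"
          using that by (subst mult_mat_index[OF S B]) (simp_all add: sum_I sub B_def)
        then show ?thesis using d pick_in that pick_eq by (simp add: block_unit_def)
      qed
    qed (use S B in simp)
    moreover have "B * submatrix A I I = 1\<^sub>m ?m"
    proof (rule eq_one_matI)
      show "(B * submatrix A I I) $$ (i, j) = (if i = j then 1 else 0)" if "i < ?m" "j < ?m" for i j
      proof -
        have "(B * submatrix A I I) $$ (i, j) = (\<Sum>l\<in>I. d (pick I i) l * A $$ (l, pick I j))"
          using that by (subst mult_mat_index[OF B S]) (simp_all add: sum_I sub B_def)
        then show ?thesis using d pick_in that pick_eq by (simp add: block_unit_def)
      qed
    qed (use S B in simp)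
    ultimately show "submatrix A I I \<in> carrier (GL ?m)"
      using S B by (auto simp: carrier_GL)
  qed
qed

section \<open>The incidence algebra and the matrix map\<close>

context ordered_pc_graph
begin

abbreviation k :: nat where "k \<equiv> length xs"

text \<open>Polymorphic in the entries: the integral instance describes S_X, the complex one the
  algebraic group.\<close>

definition cl_mats :: "'r :: comm_ring_1 mat set" where
  "cl_mats = {A \<in> carrier_mat k k. \<forall>i<k. \<forall>j<k. xs ! j \<notin> cl \<Gamma> {xs ! i} \<longrightarrow> A $$ (i, j) = 0}"

lemma cl_mats_carrier: "A \<in> cl_mats \<Longrightarrow> A \<in> carrier_mat k k"
  by (simp add: cl_mats_def)

lemma cl_mats_zero: "A \<in> cl_mats \<Longrightarrow> i < k \<Longrightarrow> j < k \<Longrightarrow> xs ! j \<notin> cl \<Gamma> {xs ! i} \<Longrightarrow> A $$ (i, j) = 0"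
  by (simp add: cl_mats_def)

lemma cl_matsI:
  assumes "A \<in> carrier_mat k k"
    and "\<And>i j. i < k \<Longrightarrow> j < k \<Longrightarrow> xs ! j \<notin> cl \<Gamma> {xs ! i} \<Longrightarrow> A $$ (i, j) = 0"
  shows "A \<in> cl_mats"
  using assms by (simp add: cl_mats_def)

text \<open>Transitivity: a nonzero term through \<open>l\<close> would put \<open>xs ! l\<close> in
  the closure of \<open>xs ! i\<close> and \<open>xs ! j\<close> in that of
  \<open>xs ! l\<close>.\<close>

lemma cl_mats_mult:
  assumes "A \<in> cl_mats" "B \<in> cl_mats"
  shows "A * B \<in> cl_mats"
proof (rule cl_matsI)
  note AB = cl_mats_carrier[OF assms(1)] cl_mats_carrier[OF assms(2)]
  show "A * B \<in> carrier_mat k k" using AB by simp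
  fix i j assume ij: "i < k" "j < k" "xs ! j \<notin> cl \<Gamma> {xs ! i}"
  have "A $$ (i, l) * B $$ (l, j) = 0" if "l < k" for l
  proof (cases "xs ! l \<in> cl \<Gamma> {xs ! i}")
    case True
    then have "xs ! j \<notin> cl \<Gamma> {xs ! l}" using in_cl_trans ij nth_verts by blast
    then show ?thesis using cl_mats_zero[OF assms(2)] that ij by simp
  next
    case False
    then show ?thesis using cl_mats_zero[OF assms(1)] that ij by simp
  qed
  then show "(A * B) $$ (i, j) = 0"
    by (simp add: mult_mat_index[OF AB ij(1,2)])
qed

lemma one_cl_mats: "1\<^sub>m k \<in> cl_mats"
proof (rule cl_matsI)
  fix i j assume "i < k" "j < k" "xs ! j \<notin> cl \<Gamma> {xs ! i}"
  then have "i \<noteq> j" using self_in_cl[OF nth_verts] by auto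
  then show "1\<^sub>m k $$ (i, j) = 0" using \<open>i < k\<close> \<open>j < k\<close> by simp
qed simp

lemma St_L_element:
  assumes "\<phi> \<in> St_L \<Gamma>" "x \<in> pverts \<Gamma>"
  shows "\<phi> (gen x) = gen_power_prod \<Gamma> xs (\<lambda>j. expo (xs ! j) (\<phi> (gen x)))"
  by (rule clique_element[OF cl_subset cl_clique[OF assms(2)] St_L_gen[OF assms]])

lemma St_L_gen_eqI:
  assumes "\<phi> \<in> St_L \<Gamma>" "x \<in> pverts \<Gamma>" "g \<in> pc_sub \<Gamma> (cl \<Gamma> {x})"
    and "\<And>z. z \<in> pverts \<Gamma> \<Longrightarrow> expo z (\<phi> (gen x)) = expo z g"
  shows "\<phi> (gen x) = g"
proof (rule clique_element_eqI[OF cl_subset cl_clique[OF assms(2)] St_L_gen[OF assms(1,2)] assms(3)])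
  fix z assume "z \<in> cl \<Gamma> {x}"
  then have "z \<in> pverts \<Gamma>" by (rule subsetD[OF cl_subset])
  then show "expo z (\<phi> (gen x)) = expo z g" by (rule assms(4))
qed

text \<open>Resolves the definite description: applying the exponent homomorphisms to the required
  product reads off the entries of any candidate matrix.\<close>

lemma aut_matrix_eq:
  assumes "\<phi> \<in> St_L \<Gamma>"
  shows "aut_matrix \<Gamma> xs \<phi> = mat k k (\<lambda>(i, j). expo (xs ! j) (\<phi> (gen (xs ! i))))"
    (is "_ = ?M")
  unfolding aut_matrix_def
proof (rule the_equality)
  have "gen_power_prod \<Gamma> xs (\<lambda>j. ?M $$ (i, j))
      = gen_power_prod \<Gamma> xs (\<lambda>j. expo (xs ! j) (\<phi> (gen (xs ! i))))" if "i < k" for i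
    unfolding gen_power_prod_def using that by (intro foldr_cong) auto
  moreover have "?M $$ (i, j) = 0" if "i < k" "j < k" "xs ! j \<notin> cl \<Gamma> {xs ! i}" for i j
    using that expo_outside[OF cl_subset St_L_gen[OF assms nth_verts]] by simp
  ultimately show "?M \<in> carrier_mat k k \<and>
      (\<forall>i<k. \<phi> (gen (xs ! i)) = gen_power_prod \<Gamma> xs (\<lambda>j. ?M $$ (i, j))) \<and>
      (\<forall>i<k. \<forall>j<k. xs ! j \<notin> cl \<Gamma> {xs ! i} \<longrightarrow> ?M $$ (i, j) = 0)"
    by (simp only: mat_carrier St_L_element[OF assms nth_verts, symmetric]) simp
next
  fix A :: "int mat"
  assume A: "A \<in> carrier_mat k k \<and>
      (\<forall>i<k. \<phi> (gen (xs ! i)) = gen_power_prod \<Gamma> xs (\<lambda>j. A $$ (i, j))) \<and>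
      (\<forall>i<k. \<forall>j<k. xs ! j \<notin> cl \<Gamma> {xs ! i} \<longrightarrow> A $$ (i, j) = 0)"
  then have "expo (xs ! j) (\<phi> (gen (xs ! i))) = A $$ (i, j)" if "i < k" "j < k" for i j
    using expo_gen_power_prod[OF that(2), of "\<lambda>j. A $$ (i, j)"] that(1) by metis
  then show "A = ?M" using A by (intro eq_matI) auto
qed

lemma aut_matrix_index:
  "\<phi> \<in> St_L \<Gamma> \<Longrightarrow> i < k \<Longrightarrow> j < k \<Longrightarrow> aut_matrix \<Gamma> xs \<phi> $$ (i, j) = expo (xs ! j) (\<phi> (gen (xs ! i)))"
  by (simp add: aut_matrix_eq)

lemma aut_matrix_cl_mats: "\<phi> \<in> St_L \<Gamma> \<Longrightarrow> aut_matrix \<Gamma> xs \<phi> \<in> cl_mats"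
  using expo_outside[OF cl_subset St_L_gen[OF _ nth_verts]]
  by (intro cl_matsI) (simp_all add: aut_matrix_eq)

text \<open>Row i holds the exponents of the image of the i-th vertex and automorphisms act on the
  right, so composition becomes the matrix product in the same order, by
  \<open>expo_hom_comp\<close>.\<close>

lemma aut_matrix_mult:
  assumes "\<phi> \<in> St_L \<Gamma>" "\<psi> \<in> St_L \<Gamma>"
  shows "aut_matrix \<Gamma> xs (\<phi> \<otimes>\<^bsub>right_Aut G\<^esub> \<psi>) = aut_matrix \<Gamma> xs \<phi> * aut_matrix \<Gamma> xs \<psi>"
proof -
  have prod: "\<phi> \<otimes>\<^bsub>right_Aut G\<^esub> \<psi> \<in> St_L \<Gamma>"
    using subgroup.m_closed[OF subgroup_St_L assms] .
  note C = cl_mats_carrier[OF aut_matrix_cl_mats]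
  have hom: "\<phi> \<in> hom G G" "\<psi> \<in> hom G G" using assms St_L_auto by (simp_all add: G.auto_iff)
  show ?thesis
  proof (rule eq_matI)
    fix i j assume "i < dim_row (aut_matrix \<Gamma> xs \<phi> * aut_matrix \<Gamma> xs \<psi>)"
      "j < dim_col (aut_matrix \<Gamma> xs \<phi> * aut_matrix \<Gamma> xs \<psi>)"
    then have ij: "i < k" "j < k" using C[OF assms(1)] C[OF assms(2)] by auto
    have "\<phi> (gen (xs ! i)) \<in> carrier G" using hom(1) ij by (auto simp: hom_def)
    then have "expo (xs ! j) (\<psi> (\<phi> (gen (xs ! i)))) =
        (\<Sum>l<k. expo (xs ! l) (\<phi> (gen (xs ! i))) * expo (xs ! j) (\<psi> (gen (xs ! l))))"
      by (simp add: expo_hom_comp[OF hom(2)] sum_verts)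
    moreover have "(\<phi> \<otimes>\<^bsub>right_Aut G\<^esub> \<psi>) (gen (xs ! i)) = \<psi> (\<phi> (gen (xs ! i)))"
      using assms St_L_auto ij by (simp add: G.mult_right_Aut compose_def)
    ultimately show "aut_matrix \<Gamma> xs (\<phi> \<otimes>\<^bsub>right_Aut G\<^esub> \<psi>) $$ (i, j) =
        (aut_matrix \<Gamma> xs \<phi> * aut_matrix \<Gamma> xs \<psi>) $$ (i, j)"
      using ij by (simp add: mult_mat_index[OF C[OF assms(1)] C[OF assms(2)]] aut_matrix_index assms prod)
  qed (use C[OF prod] C[OF assms(1)] C[OF assms(2)] in auto)
qed

lemma one_St_L: "\<one>\<^bsub>right_Aut G\<^esub> \<in> St_L \<Gamma>"
  by (rule subgroup.one_closed[OF subgroup_St_L])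

lemma aut_matrix_one: "aut_matrix \<Gamma> xs \<one>\<^bsub>right_Aut G\<^esub> = 1\<^sub>m k"
proof (rule eq_one_matI)
  show "aut_matrix \<Gamma> xs \<one>\<^bsub>right_Aut G\<^esub> \<in> carrier_mat k k"
    by (rule cl_mats_carrier[OF aut_matrix_cl_mats[OF one_St_L]])
  fix i j assume ij: "i < k" "j < k"
  show "aut_matrix \<Gamma> xs \<one>\<^bsub>right_Aut G\<^esub> $$ (i, j) = (if i = j then 1 else 0)"
    using ij distinct_xs
    by (subst aut_matrix_index[OF one_St_L ij])
      (simp add: G.one_right_Aut expo_gen nth_eq_iff_index_eq)
qed

lemma inv_St_L: "\<phi> \<in> St_L \<Gamma> \<Longrightarrow> inv\<^bsub>right_Aut G\<^esub> \<phi> \<in> St_L \<Gamma>"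
  by (rule subgroup.m_inv_closed[OF subgroup_St_L])

lemma aut_matrix_inv:
  assumes "\<phi> \<in> St_L \<Gamma>"
  shows "aut_matrix \<Gamma> xs \<phi> * aut_matrix \<Gamma> xs (inv\<^bsub>right_Aut G\<^esub> \<phi>) = 1\<^sub>m k"
    "aut_matrix \<Gamma> xs (inv\<^bsub>right_Aut G\<^esub> \<phi>) * aut_matrix \<Gamma> xs \<phi> = 1\<^sub>m k"
  using assms St_L_auto
  by (simp_all add: aut_matrix_mult[symmetric] inv_St_L aut_matrix_one)

lemma aut_matrix_GL: "\<phi> \<in> St_L \<Gamma> \<Longrightarrow> aut_matrix \<Gamma> xs \<phi> \<in> carrier (GL k)"
  using aut_matrix_inv cl_mats_carrier[OF aut_matrix_cl_mats] inv_St_L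
  unfolding carrier_GL by blast

lemma aut_matrix_inj: "inj_on (aut_matrix \<Gamma> xs) (St_L \<Gamma>)"
proof (rule inj_onI)
  fix \<phi> \<psi> assume st: "\<phi> \<in> St_L \<Gamma>" "\<psi> \<in> St_L \<Gamma>" and eq: "aut_matrix \<Gamma> xs \<phi> = aut_matrix \<Gamma> xs \<psi>"
  show "\<phi> = \<psi>"
  proof (rule auto_eqI[OF St_L_auto[OF st(1)] St_L_auto[OF st(2)]])
    fix x assume x: "x \<in> pverts \<Gamma>"
    then obtain i where i: "i < k" "xs ! i = x" using verts_nth by blast
    show "\<phi> (gen x) = \<psi> (gen x)"
    proof (rule St_L_gen_eqI[OF st(1) x St_L_gen[OF st(2) x]])
      fix z assume "z \<in> pverts \<Gamma>"
      then obtain j where j: "j < k" "xs ! j = z" using verts_nth by blast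
      show "expo z (\<phi> (gen x)) = expo z (\<psi> (gen x))"
        using aut_matrix_index[OF st(1) i(1) j(1)] aut_matrix_index[OF st(2) i(1) j(1)] eq i j by simp
    qed
  qed
qed

text \<open>\<open>A\<close> and \<open>B\<close> are realised separately by endomorphisms. The two
  matrix identities make these inverse to each other on generators, since an element of G(cl(x)) is
  determined by its exponents.\<close>

lemma aut_matrix_surj:
  assumes A: "A \<in> cl_mats" and B: "B \<in> cl_mats" and AB: "A * B = 1\<^sub>m k" "B * A = 1\<^sub>m k"
  shows "\<exists>\<phi>\<in>St_L \<Gamma>. aut_matrix \<Gamma> xs \<phi> = A"
proof -
  \<comment> \<open>The extension lemma takes a function on vertices, so the row number of a vertex
    has to be recovered.\<close>
  define idx where "idx = the_inv_into {..<k} (\<lambda>i. xs ! i)"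
  have inj: "inj_on (\<lambda>i. xs ! i) {..<k}"
    using distinct_xs by (auto simp: inj_on_def nth_eq_iff_index_eq)
  have idx: "idx (xs ! i) = i" if "i < k" for i
    unfolding idx_def using that by (intro the_inv_into_f_f[OF inj]) simp
  have realise: "\<exists>F. F \<in> hom G G \<and> F \<in> extensional (carrier G) \<and>
      (\<forall>x\<in>pverts \<Gamma>. F (gen x) \<in> pc_sub \<Gamma> (cl \<Gamma> {x})) \<and>
      (\<forall>i<k. \<forall>j<k. expo (xs ! j) (F (gen (xs ! i))) = C $$ (i, j))" if C: "C \<in> cl_mats" for C
  proof -
    let ?f = "\<lambda>x. gen_power_prod \<Gamma> xs (\<lambda>j. C $$ (idx x, j))"
    have f: "?f x \<in> pc_sub \<Gamma> (cl \<Gamma> {x})" if "x \<in> pverts \<Gamma>" for x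
    proof -
      obtain i where i: "i < k" "xs ! i = x" using verts_nth[OF \<open>x \<in> pverts \<Gamma>\<close>] by blast
      show ?thesis
      proof (rule gen_power_prod_in_sub[OF cl_subset])
        fix j assume "j < k" "xs ! j \<notin> cl \<Gamma> {x}"
        then show "C $$ (idx x, j) = 0"
          using cl_mats_zero[OF C i(1), of j] idx[OF i(1)] i(2) by simp
      qed
    qed
    obtain F where F: "F \<in> hom G G" "F \<in> extensional (carrier G)"
        "\<And>x. x \<in> pverts \<Gamma> \<Longrightarrow> F (gen x) = ?f x"
      using cl_hom_extension[of ?f, OF f] by blast
    have "expo (xs ! j) (F (gen (xs ! i))) = C $$ (i, j)" if "i < k" "j < k" for i j
      using that F(3)[OF nth_verts[OF that(1)]] by (simp add: expo_gen_power_prod idx)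
    then show ?thesis using F f by (intro exI[of _ F]) simp
  qed
  obtain F where F: "F \<in> hom G G" "F \<in> extensional (carrier G)"
      "\<And>x. x \<in> pverts \<Gamma> \<Longrightarrow> F (gen x) \<in> pc_sub \<Gamma> (cl \<Gamma> {x})"
      "\<And>i j. i < k \<Longrightarrow> j < k \<Longrightarrow> expo (xs ! j) (F (gen (xs ! i))) = A $$ (i, j)"
    using realise[OF A] by blast
  obtain F' where F': "F' \<in> hom G G"
      "\<And>x. x \<in> pverts \<Gamma> \<Longrightarrow> F' (gen x) \<in> pc_sub \<Gamma> (cl \<Gamma> {x})"
      "\<And>i j. i < k \<Longrightarrow> j < k \<Longrightarrow> expo (xs ! j) (F' (gen (xs ! i))) = B $$ (i, j)"
    using realise[OF B] by blast
  have comp: "E' (E (gen x)) = gen x"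
    if x: "x \<in> pverts \<Gamma>" and E: "E \<in> hom G G" "E' \<in> hom G G"
      and E_cl: "\<And>x. x \<in> pverts \<Gamma> \<Longrightarrow> E (gen x) \<in> pc_sub \<Gamma> (cl \<Gamma> {x})"
        "\<And>x. x \<in> pverts \<Gamma> \<Longrightarrow> E' (gen x) \<in> pc_sub \<Gamma> (cl \<Gamma> {x})"
      and E_mat: "\<And>i j. i < k \<Longrightarrow> j < k \<Longrightarrow> expo (xs ! j) (E (gen (xs ! i))) = C $$ (i, j)"
        "\<And>i j. i < k \<Longrightarrow> j < k \<Longrightarrow> expo (xs ! j) (E' (gen (xs ! i))) = D $$ (i, j)"
      and CD: "C \<in> carrier_mat k k" "D \<in> carrier_mat k k" "C * D = 1\<^sub>m k" for x E E' C D
  proof (rule clique_element_eqI[OF cl_subset cl_clique[OF x]])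
    obtain i where i: "i < k" "xs ! i = x" using verts_nth[OF x] by blast
    have "E' ` pc_sub \<Gamma> (cl \<Gamma> {x}) \<subseteq> pc_sub \<Gamma> (cl \<Gamma> {x})"
    proof (rule hom_pc_sub_subset[OF E(2) cl_subset pc_sub_subgroup[OF cl_subset]])
      fix y assume y: "y \<in> cl \<Gamma> {x}"
      then have "y \<in> pverts \<Gamma>" using cl_subset by blast
      then show "E' (gen y) \<in> pc_sub \<Gamma> (cl \<Gamma> {x})"
        using E_cl(2) pc_sub_mono[of "cl \<Gamma> {y}" "cl \<Gamma> {x}"] y x in_cl_iff by blast
    qed
    then show "E' (E (gen x)) \<in> pc_sub \<Gamma> (cl \<Gamma> {x})" using E_cl(1)[OF x] by blast
    show "gen x \<in> pc_sub \<Gamma> (cl \<Gamma> {x})" by (rule pc_sub_gen[OF self_in_cl[OF x]])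
    have Ex: "E (gen x) \<in> carrier G" using E(1) x by (auto simp: hom_def)
    fix z assume "z \<in> cl \<Gamma> {x}"
    then have "z \<in> pverts \<Gamma>" using cl_subset by blast
    then obtain j where j: "j < k" "xs ! j = z" using verts_nth by blast
    have "expo z (E' (E (gen x))) = (\<Sum>l<k. C $$ (i, l) * D $$ (l, j))"
      using E_mat i j by (auto simp: expo_hom_comp[OF E(2) Ex] sum_verts)
    also have "\<dots> = (C * D) $$ (i, j)" by (rule mult_mat_index[OF CD(1,2) i(1) j(1), symmetric])
    also have "\<dots> = expo z (gen x)"
      using CD(3) i j x distinct_xs by (auto simp: expo_gen nth_eq_iff_index_eq)
    finally show "expo z (E' (E (gen x))) = expo z (gen x)" .
  qed
  note AC = cl_mats_carrier[OF A] and BC = cl_mats_carrier[OF B]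
  have St: "F \<in> St_L \<Gamma>"
    by (rule St_LI[OF F(1,2) F'(1) F(3) F'(2)])
      (simp_all only: comp[OF _ F(1) F'(1) F(3) F'(2) F(4) F'(3) AC BC AB(1)]
        comp[OF _ F'(1) F(1) F'(2) F(3) F'(3) F(4) BC AC AB(2)])
  moreover have "aut_matrix \<Gamma> xs F = A"
    using AC F(4) by (intro eq_matI) (auto simp: aut_matrix_eq[OF St])
  ultimately show ?thesis by blast
qed

end

section \<open>Generation by elementary automorphisms\<close>

text \<open>The assumption is what the order \<prec> contributes to the matrices: it makes them
  block upper triangular.\<close>

locale sorted_pc_graph = ordered_pc_graph +
  assumes less_L_index: "i < k \<Longrightarrow> j < k \<Longrightarrow> less_L \<Gamma> (xs ! j) (xs ! i) \<Longrightarrow> i < j"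
begin

section \<open>Diagonal blocks and membership in S_X\<close>

definition class_idx :: "'a \<Rightarrow> nat set" where
  "class_idx v = {i. i < k \<and> xs ! i \<in> eq_class \<Gamma> v}"

definition same_class :: "nat \<Rightarrow> nat \<Rightarrow> bool" where
  "same_class i j \<longleftrightarrow> eq_class \<Gamma> (xs ! i) = eq_class \<Gamma> (xs ! j)"

lemma class_idx_subset: "class_idx v \<subseteq> {..<k}"
  by (auto simp: class_idx_def)

lemma card_class_idx: "card (class_idx v) = card (eq_class \<Gamma> v)"
proof -
  have "bij_betw (\<lambda>i. xs ! i) (class_idx v) (eq_class \<Gamma> v)"
  proof (rule bij_betw_imageI)
    show "inj_on (\<lambda>i. xs ! i) (class_idx v)"
      using distinct_xs by (auto simp: inj_on_def class_idx_def nth_eq_iff_index_eq)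
    show "(\<lambda>i. xs ! i) ` class_idx v = eq_class \<Gamma> v"
    proof
      show "eq_class \<Gamma> v \<subseteq> (\<lambda>i. xs ! i) ` class_idx v"
      proof
        fix x assume x: "x \<in> eq_class \<Gamma> v"
        then obtain i where "i < k" "xs ! i = x" using verts_nth eq_class_subset by blast
        then show "x \<in> (\<lambda>i. xs ! i) ` class_idx v" using x by (auto simp: class_idx_def)
      qed
    qed (auto simp: class_idx_def)
  qed
  then show ?thesis by (rule bij_betw_same_card)
qed

lemma class_idx_eq: "i \<in> class_idx v \<Longrightarrow> j \<in> class_idx v \<longleftrightarrow> j < k \<and> same_class i j"
  using eq_class_cong self_in_eq_class[OF nth_verts]
  unfolding class_idx_def same_class_def by blast

lemma same_class_iff: "i < k \<Longrightarrow> j < k \<Longrightarrow> same_class i j \<longleftrightarrow> cl \<Gamma> {xs ! i} = cl \<Gamma> {xs ! j}"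
  unfolding same_class_def by (rule eq_class_eq_iff) simp_all

lemma cl_cases:
  assumes "i < k" "j < k" "xs ! j \<in> cl \<Gamma> {xs ! i}"
  shows "same_class i j \<or> less_L \<Gamma> (xs ! j) (xs ! i)"
  using assms in_cl_iff[of "xs ! i" "xs ! j"] by (auto simp: same_class_iff less_L_def)

lemma less_L_in_cl:
  assumes "i < k" "j < k" "less_L \<Gamma> (xs ! j) (xs ! i)"
  shows "xs ! j \<in> cl \<Gamma> {xs ! i}" "\<not> same_class i j"
  using assms in_cl_iff[of "xs ! i" "xs ! j"] by (auto simp: same_class_iff less_L_def)

lemma same_class_in_cl: "i < k \<Longrightarrow> j < k \<Longrightarrow> same_class i j \<Longrightarrow> xs ! j \<in> cl \<Gamma> {xs ! i}"
  using in_cl_iff[of "xs ! i" "xs ! j"] by (auto simp: same_class_iff)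

text \<open>A vertex of cl(x) is either equivalent to x or strictly below x, and in the latter case
  its index is larger. So the two vanishing conditions of \<open>S_X\<close>, below and above the
  diagonal, amount to membership in \<open>cl_mats\<close>.\<close>

lemma in_S_X_iff:
  "A \<in> S_X \<Gamma> xs \<longleftrightarrow> A \<in> cl_mats \<and> (\<forall>v\<in>pverts \<Gamma>. \<exists>d. block_unit A (class_idx v) d)"
proof -
  have blocks: "submatrix A (class_idx v) (class_idx v) \<in> carrier (GL (card (eq_class \<Gamma> v))) \<longleftrightarrow>
      (\<exists>d. block_unit A (class_idx v) d)" if "A \<in> carrier_mat k k" for v
    using submatrix_GL_iff[OF that class_idx_subset] by (simp add: card_class_idx)
  have entries: "(\<forall>i<k. \<forall>j<k. xs ! j \<notin> cl \<Gamma> {xs ! i} \<longrightarrow> A $$ (i, j) = 0) \<longleftrightarrow>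
      (\<forall>i<k. \<forall>j<k. i > j \<and> eq_class \<Gamma> (xs ! i) \<noteq> eq_class \<Gamma> (xs ! j) \<longrightarrow> A $$ (i, j) = 0) \<and>
      (\<forall>i<k. \<forall>j<k. i < j \<and> eq_class \<Gamma> (xs ! i) \<noteq> eq_class \<Gamma> (xs ! j) \<and>
        \<not> less_L \<Gamma> (xs ! j) (xs ! i) \<longrightarrow> A $$ (i, j) = 0)" (is "?L \<longleftrightarrow> ?R")
  proof -
    have lower: "xs ! j \<notin> cl \<Gamma> {xs ! i}" if "i < k" "j < k" "i > j" "\<not> same_class i j" for i j
      using that less_L_index[of i j] cl_cases[of i j] by auto
    have upper: "xs ! j \<notin> cl \<Gamma> {xs ! i}"
      if "i < k" "j < k" "\<not> same_class i j" "\<not> less_L \<Gamma> (xs ! j) (xs ! i)" for i j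
      using that cl_cases[of i j] by auto
    have outside: "\<not> same_class i j" "\<not> less_L \<Gamma> (xs ! j) (xs ! i)" "i \<noteq> j"
      if "i < k" "j < k" "xs ! j \<notin> cl \<Gamma> {xs ! i}" for i j
      using that same_class_in_cl[of i j] less_L_in_cl(1)[of i j] by (auto simp: same_class_def)
    show ?thesis
    proof
      assume ?L
      then show ?R using lower upper by (simp add: same_class_def)
    next
      assume R: ?R
      show ?L
      proof (intro allI impI)
        fix i j assume ij: "i < k" "j < k" "xs ! j \<notin> cl \<Gamma> {xs ! i}"
        show "A $$ (i, j) = 0"
          using R ij outside[OF ij] by (cases "i < j") (auto simp: same_class_def)
      qed
    qed
  qed
  have "A \<in> S_X \<Gamma> xs \<longleftrightarrow> A \<in> carrier_mat k k \<and>
      (\<forall>v\<in>pverts \<Gamma>. submatrix A (class_idx v) (class_idx v) \<in> carrier (GL (card (eq_class \<Gamma> v)))) \<and>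
      (\<forall>i<k. \<forall>j<k. i > j \<and> eq_class \<Gamma> (xs ! i) \<noteq> eq_class \<Gamma> (xs ! j) \<longrightarrow> A $$ (i, j) = 0) \<and>
      (\<forall>i<k. \<forall>j<k. i < j \<and> eq_class \<Gamma> (xs ! i) \<noteq> eq_class \<Gamma> (xs ! j) \<and>
        \<not> less_L \<Gamma> (xs ! j) (xs ! i) \<longrightarrow> A $$ (i, j) = 0)"
    unfolding S_X_def class_idx_def Let_def by (rule mem_Collect_eq)
  then show ?thesis
    unfolding cl_mats_def mem_Collect_eq entries
    by (cases "A \<in> carrier_mat k k") (simp_all only: blocks simp_thms conj_ac)
qed

text \<open>If a middle index \<open>l\<close> contributes to an entry of the product with
  \<open>i\<close> and \<open>j\<close> in one class, then cl(x_j) \<subseteq> cl(x_l) \<subseteq>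
  cl(x_i) with equal ends, so \<open>l\<close> is in the class as well. Hence the blocks of a
  product are the products of the blocks.\<close>

lemma block_unit_inverse:
  assumes "A \<in> cl_mats" "B \<in> cl_mats" "A * B = 1\<^sub>m k" "B * A = 1\<^sub>m k"
  shows "block_unit A (class_idx v) (\<lambda>i j. B $$ (i, j))"
proof -
  have block_sum: "(\<Sum>l\<in>class_idx v. C $$ (i, l) * D $$ (l, j)) = (if i = j then 1 else 0)"
    if C: "C \<in> cl_mats" and D: "D \<in> cl_mats" and CD: "C * D = 1\<^sub>m k"
      and ij: "i \<in> class_idx v" "j \<in> class_idx v" for C D :: "'b mat" and i j
  proof -
    have ijk: "i < k" "j < k" using ij by (auto simp: class_idx_def)
    have "C $$ (i, l) * D $$ (l, j) = 0" if l: "l \<in> {..<k} - class_idx v" for l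
    proof (rule ccontr)
      assume "C $$ (i, l) * D $$ (l, j) \<noteq> 0"
      then have "C $$ (i, l) \<noteq> 0" "D $$ (l, j) \<noteq> 0" by auto
      then have "xs ! l \<in> cl \<Gamma> {xs ! i}" "xs ! j \<in> cl \<Gamma> {xs ! l}"
        using cl_mats_zero[OF C ijk(1), of l] cl_mats_zero[OF D _ ijk(2), of l] l by auto
      moreover have "cl \<Gamma> {xs ! i} = cl \<Gamma> {xs ! j}"
        using ij class_idx_eq[OF ij(1)] same_class_iff[OF ijk] by simp
      ultimately have "cl \<Gamma> {xs ! l} = cl \<Gamma> {xs ! i}"
        using in_cl_iff[of "xs ! i" "xs ! l"] in_cl_iff[of "xs ! l" "xs ! j"] l ijk by auto
      then have "l \<in> class_idx v"
        using class_idx_eq[OF ij(1)] same_class_iff[of i l] ijk l by simp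
      then show False using l by simp
    qed
    then have "(\<Sum>l\<in>class_idx v. C $$ (i, l) * D $$ (l, j)) = (\<Sum>l<k. C $$ (i, l) * D $$ (l, j))"
      using class_idx_subset by (intro sum.mono_neutral_left) auto
    also have "\<dots> = (C * D) $$ (i, j)"
      by (rule mult_mat_index[OF cl_mats_carrier[OF C] cl_mats_carrier[OF D] ijk, symmetric])
    also have "\<dots> = (if i = j then 1 else 0)" using CD ijk by simp
    finally show ?thesis .
  qed
  show ?thesis
    unfolding block_unit_def using block_sum[OF assms(1-3)] block_sum[OF assms(2,1,4)] by blast
qed

lemma aut_matrix_in_S_X:
  assumes "\<phi> \<in> St_L \<Gamma>"
  shows "aut_matrix \<Gamma> xs \<phi> \<in> S_X \<Gamma> xs"
  unfolding in_S_X_iff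
proof (intro conjI ballI exI)
  show "aut_matrix \<Gamma> xs \<phi> \<in> cl_mats" using assms by (rule aut_matrix_cl_mats)
  then show "block_unit (aut_matrix \<Gamma> xs \<phi>) (class_idx v)
      (\<lambda>i j. aut_matrix \<Gamma> xs (inv\<^bsub>right_Aut G\<^esub> \<phi>) $$ (i, j))" for v
    by (rule block_unit_inverse[OF _ aut_matrix_cl_mats[OF inv_St_L[OF assms]] aut_matrix_inv[OF assms]])
qed

section \<open>Elementary row operations\<close>

definition elem_auts :: "('a word set \<Rightarrow> 'a word set) set" where
  "elem_auts = generate (right_Aut G) (J_set \<Gamma> \<union> V_perp \<Gamma> \<union> Tr_perp \<Gamma>)"

abbreviation elem_mats :: "int mat set" where
  "elem_mats \<equiv> aut_matrix \<Gamma> xs ` elem_auts"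

lemma elem_auts_subset: "elem_auts \<subseteq> St_L \<Gamma>"
  unfolding elem_auts_def by (rule generate_subset_St_L)

lemma elem_mats_mult:
  assumes "A \<in> elem_mats" "B \<in> elem_mats"
  shows "A * B \<in> elem_mats"
proof -
  from assms(1) obtain \<phi> where \<phi>: "A = aut_matrix \<Gamma> xs \<phi>" "\<phi> \<in> elem_auts" by (rule imageE)
  from assms(2) obtain \<psi> where \<psi>: "B = aut_matrix \<Gamma> xs \<psi>" "\<psi> \<in> elem_auts" by (rule imageE)
  have "\<phi> \<otimes>\<^bsub>right_Aut G\<^esub> \<psi> \<in> elem_auts"
    using \<phi>(2) \<psi>(2) unfolding elem_auts_def by (rule generate.eng)
  then have "aut_matrix \<Gamma> xs (\<phi> \<otimes>\<^bsub>right_Aut G\<^esub> \<psi>) \<in> elem_mats" by (rule imageI)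
  then show ?thesis
    using aut_matrix_mult[OF subsetD[OF elem_auts_subset \<phi>(2)] subsetD[OF elem_auts_subset \<psi>(2)]] \<phi> \<psi>
    by simp
qed

lemma one_elem_mats: "1\<^sub>m k \<in> elem_mats"
proof -
  have "\<one>\<^bsub>right_Aut G\<^esub> \<in> elem_auts" unfolding elem_auts_def by (rule generate.one)
  then have "aut_matrix \<Gamma> xs \<one>\<^bsub>right_Aut G\<^esub> \<in> elem_mats" by (rule imageI)
  then show ?thesis by (simp only: aut_matrix_one)
qed

text \<open>Sending x to x y adds a unit entry in row x and column y; the coefficient -1 comes from
  the inverse automorphism. Larger multiples are reached by repetition in
  \<open>unitriangular_elem_mats\<close>.\<close>

lemma addrow_mat_elem_mats:
  assumes "i < k" "j < k" "less_L \<Gamma> (xs ! j) (xs ! i)" "c = 1 \<or> c = - 1"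
  shows "addrow_mat k c i j \<in> elem_mats"
proof -
  let ?x = "xs ! i" and ?y = "xs ! j"
  let ?t = "tr \<Gamma> ?x ?y"
  have ij: "i \<noteq> j" using less_L_index[OF assms(1-3)] by simp
  have xy: "?x \<noteq> ?y" "cl \<Gamma> {?y} \<subseteq> cl \<Gamma> {?x}"
    using assms(3) by (auto simp: less_L_def)
  note tr = tr_props[OF nth_verts[OF assms(1)] nth_verts[OF assms(2)] xy]
  have t: "?t \<in> J_set \<Gamma> \<union> V_perp \<Gamma> \<union> Tr_perp \<Gamma>"
    using tr_in_Tr_perp assms by simp
  have mat: "aut_matrix \<Gamma> xs ?t = addrow_mat k 1 i j"
  proof (rule eq_matI)
    fix a b assume "a < dim_row (addrow_mat k (1::int) i j)" "b < dim_col (addrow_mat k (1::int) i j)"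
    then have ab: "a < k" "b < k" by simp_all
    have "?t (gen (xs ! a)) = (if a = i then gen ?x \<otimes>\<^bsub>G\<^esub> gen ?y else gen (xs ! a))"
      using tr(2) tr(3)[of "xs ! a"] ab assms(1) distinct_xs by (simp add: nth_eq_iff_index_eq)
    then show "aut_matrix \<Gamma> xs ?t $$ (a, b) = addrow_mat k 1 i j $$ (a, b)"
      using ab assms(1,2) ij distinct_xs
      by (simp add: aut_matrix_index[OF tr(1)] expo_mult expo_gen nth_eq_iff_index_eq)
  qed (use cl_mats_carrier[OF aut_matrix_cl_mats[OF tr(1)]] in auto)
  show ?thesis
    using assms(4)
  proof
    assume "c = 1"
    moreover have "?t \<in> elem_auts" unfolding elem_auts_def using t by (rule generate.incl)
    ultimately show ?thesis using mat[symmetric] by (simp only: imageI)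
  next
    assume c: "c = - 1"
    let ?T = "aut_matrix \<Gamma> xs (inv\<^bsub>right_Aut G\<^esub> ?t)"
    have T: "?T \<in> carrier_mat k k"
      by (rule cl_mats_carrier[OF aut_matrix_cl_mats[OF inv_St_L[OF tr(1)]]])
    \<comment> \<open>A left inverse of the matrix with coefficient 1 must equal its known inverse,
      the one with coefficient -1.\<close>
    have "?T = ?T * (addrow_mat k 1 i j * addrow_mat k c i j)"
      using T c by (simp add: addrow_mat_inv[OF assms(1,2) ij])
    also have "\<dots> = (?T * addrow_mat k 1 i j) * addrow_mat k c i j"
      using T by (intro assoc_mult_mat[symmetric, of _ k k _ k _ k]) auto
    also have "\<dots> = addrow_mat k c i j"
      using aut_matrix_inv(2)[OF tr(1)] by (simp add: mat)
    finally have "?T = addrow_mat k c i j" .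
    moreover have "inv\<^bsub>right_Aut G\<^esub> ?t \<in> elem_auts"
      unfolding elem_auts_def using t by (rule generate.inv)
    ultimately show ?thesis by (intro image_eqI[of _ _ "inv\<^bsub>right_Aut G\<^esub> ?t"]) simp_all
  qed
qed

text \<open>The sum of the absolute values of the entries decreases: in the last row
  \<open>i\<close> with a nonzero entry off the diagonal, at column \<open>j\<close>, one has i < j,
  so row \<open>j\<close> is already a unit vector. Subtracting or adding it then changes just the
  entry (i, j), bringing it one step closer to 0.\<close>

lemma unitriangular_elem_mats:
  assumes "A \<in> cl_mats" "\<And>i j. i < k \<Longrightarrow> j < k \<Longrightarrow> same_class i j \<Longrightarrow> A $$ (i, j) = (if i = j then 1 else 0)"
  shows "A \<in> elem_mats"
  using assms
proof (induction "\<Sum>p\<in>{..<k} \<times> {..<k}. nat \<bar>A $$ p\<bar>" arbitrary: A rule: less_induct)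
  case less
  note A = less.prems
  define N where "N = {i. i < k \<and> (\<exists>j<k. i \<noteq> j \<and> A $$ (i, j) \<noteq> 0)}"
  have diag: "A $$ (i, i) = 1" if "i < k" for i
    using A(2)[OF that that] by (simp add: same_class_def)
  show ?case
  proof (cases "N = {}")
    case True
    then have "A = 1\<^sub>m k"
      using diag by (intro eq_one_matI cl_mats_carrier A(1)) (auto simp: N_def)
    then show ?thesis using one_elem_mats by simp
  next
    case False
    have fin: "finite N" by (simp add: N_def)
    define i where "i = Max N"
    have "i \<in> N" unfolding i_def using fin False by (rule Max_in)
    then obtain j where ij: "i < k" "j < k" "i \<noteq> j" "A $$ (i, j) \<noteq> 0" by (auto simp: N_def)
    have "xs ! j \<in> cl \<Gamma> {xs ! i}" using cl_mats_zero[OF A(1) ij(1,2)] ij(4) by blast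
    then have less: "less_L \<Gamma> (xs ! j) (xs ! i)"
      using cl_cases[OF ij(1,2)] A(2)[OF ij(1,2)] ij(3,4) by auto
    have "i < j" using less_L_index[OF ij(1,2) less] .
    \<comment> \<open>\<open>j\<close> exceeds the maximum of \<open>N\<close>, so its row has no
      nonzero entry off the diagonal.\<close>
    then have "j \<notin> N" using Max_ge[OF fin, of j] by (auto simp: i_def)
    then have row_j: "A $$ (j, m) = (if m = j then 1 else 0)" if "m < k" for m
      using that ij(2) diag by (auto simp: N_def)
    \<comment> \<open>Only steps of size 1 are available as elementary matrices, so the entry is
      reduced by its sign and not cleared at once.\<close>
    define s where "s = sgn (A $$ (i, j))"
    have s: "s = 1 \<or> s = - 1" using ij(4) by (auto simp: s_def sgn_if)
    define B where "B = addrow (- s) i j A"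
    have dims: "dim_row A = k" "dim_col A = k" using cl_mats_carrier[OF A(1)] by auto
    have B: "B \<in> carrier_mat k k" using cl_mats_carrier[OF A(1)] by (simp add: B_def)
    have B_ind: "B $$ (a, b) = (if a = i \<and> b = j then A $$ (i, j) - s else A $$ (a, b))"
      if "a < k" "b < k" for a b
      using that ij dims row_j by (auto simp: B_def)
    have A_eq: "addrow_mat k s i j * B = A"
    proof -
      have "addrow_mat k s i j * B = addrow_mat k s i j * (addrow_mat k (- s) i j * A)"
        unfolding B_def using ij cl_mats_carrier[OF A(1)] by (simp add: addrow_mat)
      also have "\<dots> = (addrow_mat k s i j * addrow_mat k (- s) i j) * A"
        using cl_mats_carrier[OF A(1)] by (intro assoc_mult_mat[symmetric, of _ k k _ k _ k]) auto
      also have "\<dots> = A"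
        using cl_mats_carrier[OF A(1)] by (simp add: addrow_mat_inv[OF ij(1-3)])
      finally show ?thesis .
    qed
    have E: "addrow_mat k s i j \<in> elem_mats"
      by (rule addrow_mat_elem_mats[OF ij(1,2) less s])
    have "B \<in> elem_mats"
    proof (rule less.hyps)
      have "(\<Sum>p\<in>{..<k} \<times> {..<k}. nat \<bar>B $$ p\<bar>) < (\<Sum>p\<in>{..<k} \<times> {..<k}. nat \<bar>A $$ p\<bar>)"
      proof (rule sum_strict_mono_ex1)
        have dec: "nat \<bar>A $$ (i, j) - s\<bar> < nat \<bar>A $$ (i, j)\<bar>"
          using ij(4) by (auto simp: s_def sgn_if)
        show "\<forall>p\<in>{..<k} \<times> {..<k}. nat \<bar>B $$ p\<bar> \<le> nat \<bar>A $$ p\<bar>"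
          using dec by (auto simp: B_ind)
        show "\<exists>p\<in>{..<k} \<times> {..<k}. nat \<bar>B $$ p\<bar> < nat \<bar>A $$ p\<bar>"
          using dec ij by (intro bexI[of _ "(i, j)"]) (auto simp: B_ind)
      qed simp
      then show "(\<Sum>p\<in>{..<k} \<times> {..<k}. nat \<bar>B $$ p\<bar>) < (\<Sum>p\<in>{..<k} \<times> {..<k}. nat \<bar>A $$ p\<bar>)" .
      show "B \<in> cl_mats"
        using cl_mats_zero[OF A(1)] less_L_in_cl(1)[OF ij(1,2) less]
        by (intro cl_matsI B) (auto simp: B_ind)
      show "B $$ (a, b) = (if a = b then 1 else 0)" if "a < k" "b < k" "same_class a b" for a b
        using A(2)[OF that] that less_L_in_cl(2)[OF ij(1,2) less] by (auto simp: B_ind)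
    qed
    with E have "addrow_mat k s i j * B \<in> elem_mats" by (rule elem_mats_mult)
    then show ?thesis by (simp only: A_eq)
  qed
qed

section \<open>Matrices supported on one diagonal block\<close>

definition block_mat :: "'a \<Rightarrow> (nat \<Rightarrow> nat \<Rightarrow> 'r) \<Rightarrow> 'r :: comm_ring_1 mat" where
  "block_mat v d = mat k k (\<lambda>(i, j). if i \<in> class_idx v \<and> j \<in> class_idx v then d i j
     else if i = j then 1 else 0)"

lemma block_mat_carrier [simp]: "block_mat v d \<in> carrier_mat k k"
  by (simp add: block_mat_def)

lemma block_mat_index:
  "i < k \<Longrightarrow> j < k \<Longrightarrow> block_mat v d $$ (i, j) =
    (if i \<in> class_idx v \<and> j \<in> class_idx v then d i j else if i = j then 1 else 0)"
  by (simp add: block_mat_def)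

lemma block_mat_cl_mats: "block_mat v d \<in> cl_mats"
proof (rule cl_matsI)
  fix i j assume ij: "i < k" "j < k" "xs ! j \<notin> cl \<Gamma> {xs ! i}"
  then have "\<not> same_class i j" using same_class_in_cl by blast
  then have "i \<noteq> j" "\<not> (i \<in> class_idx v \<and> j \<in> class_idx v)"
    using class_idx_eq by (auto simp: same_class_def)
  then show "block_mat v d $$ (i, j) = 0" using ij by (auto simp: block_mat_index)
qed simp

text \<open>Left multiplication by a block matrix recombines the rows of one class among themselves
  and leaves all other rows alone.\<close>

lemma block_mat_mult_index:
  assumes "A \<in> carrier_mat k k" "i < k" "j < k"
  shows "(block_mat v d * A) $$ (i, j) =
    (if i \<in> class_idx v then (\<Sum>l\<in>class_idx v. d i l * A $$ (l, j)) else A $$ (i, j))"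
proof -
  have "(block_mat v d * A) $$ (i, j) = (\<Sum>l<k. block_mat v d $$ (i, l) * A $$ (l, j))"
    by (rule mult_mat_index[OF block_mat_carrier assms])
  also have "\<dots> = (if i \<in> class_idx v then (\<Sum>l\<in>class_idx v. d i l * A $$ (l, j)) else A $$ (i, j))"
  proof (cases "i \<in> class_idx v")
    case True
    have "(\<Sum>l<k. block_mat v d $$ (i, l) * A $$ (l, j)) =
        (\<Sum>l\<in>class_idx v. block_mat v d $$ (i, l) * A $$ (l, j))"
      using class_idx_subset[of v] assms True
      by (intro sum.mono_neutral_right) (auto simp: block_mat_index)
    also have "\<dots> = (\<Sum>l\<in>class_idx v. d i l * A $$ (l, j))"
      using class_idx_subset[of v] assms True by (intro sum.cong) (auto simp: block_mat_index subset_iff)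
    finally show ?thesis using True by simp
  next
    case False
    have "(\<Sum>l<k. block_mat v d $$ (i, l) * A $$ (l, j)) = (\<Sum>l<k. if l = i then A $$ (l, j) else 0)"
      using assms False by (intro sum.cong) (auto simp: block_mat_index)
    also have "\<dots> = A $$ (i, j)" using assms by simp
    finally show ?thesis using False by simp
  qed
  finally show ?thesis .
qed

lemma block_mat_inverse:
  assumes "block_unit A (class_idx v) d"
  shows "block_mat v (\<lambda>i j. A $$ (i, j)) * block_mat v d = 1\<^sub>m k"
    "block_mat v d * block_mat v (\<lambda>i j. A $$ (i, j)) = 1\<^sub>m k"
proof -
  have "block_mat v e * block_mat v e' = 1\<^sub>m k"
    if "\<And>i j. i \<in> class_idx v \<Longrightarrow> j \<in> class_idx v \<Longrightarrow>
      (\<Sum>l\<in>class_idx v. e i l * e' l j) = (if i = j then 1 else 0)" for e e' :: "nat \<Rightarrow> nat \<Rightarrow> 'b"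
  proof (rule eq_one_matI)
    fix i j assume ij: "i < k" "j < k"
    have "(\<Sum>l\<in>class_idx v. e i l * block_mat v e' $$ (l, j)) = (if i = j then 1 else 0)"
      if i: "i \<in> class_idx v"
    proof (cases "j \<in> class_idx v")
      case True
      then have "(\<Sum>l\<in>class_idx v. e i l * block_mat v e' $$ (l, j)) = (\<Sum>l\<in>class_idx v. e i l * e' l j)"
        using class_idx_subset[of v] by (intro sum.cong) (auto simp: block_mat_index subset_iff)
      then show ?thesis using \<open>\<And>i j. i \<in> class_idx v \<Longrightarrow> j \<in> class_idx v \<Longrightarrow>
        (\<Sum>l\<in>class_idx v. e i l * e' l j) = (if i = j then 1 else 0)\<close>[OF i True] by simp
    next
      case False
      then have "e i l * block_mat v e' $$ (l, j) = 0" if "l \<in> class_idx v" for l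
        using that class_idx_subset[of v] ij by (auto simp: block_mat_index subset_iff)
      then show ?thesis using False i by (auto intro: sum.neutral)
    qed
    then show "(block_mat v e * block_mat v e') $$ (i, j) = (if i = j then 1 else 0)"
      using ij by (auto simp: block_mat_mult_index[OF block_mat_carrier] block_mat_index)
  qed (rule mult_carrier_mat[OF block_mat_carrier block_mat_carrier])
  note * = this
  show "block_mat v (\<lambda>i j. A $$ (i, j)) * block_mat v d = 1\<^sub>m k"
    "block_mat v d * block_mat v (\<lambda>i j. A $$ (i, j)) = 1\<^sub>m k"
    using assms unfolding block_unit_def by (simp_all add: *)
qed

lemma St_L_gen_block:
  assumes "\<phi> \<in> St_L \<Gamma>" "aut_matrix \<Gamma> xs \<phi> = block_mat v d"
  shows "x \<in> pverts \<Gamma> - eq_class \<Gamma> v \<Longrightarrow> \<phi> (gen x) = gen x"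
    and "x \<in> eq_class \<Gamma> v \<Longrightarrow> \<phi> (gen x) \<in> pc_sub \<Gamma> (eq_class \<Gamma> v)"
proof -
  have expo: "expo (xs ! j) (\<phi> (gen (xs ! i))) = block_mat v d $$ (i, j)" if "i < k" "j < k" for i j
    using aut_matrix_index[OF assms(1) that] assms(2) by simp
  show "\<phi> (gen x) = gen x" if x: "x \<in> pverts \<Gamma> - eq_class \<Gamma> v"
  proof (rule St_L_gen_eqI[OF assms(1)])
    obtain i where i: "i < k" "xs ! i = x" using verts_nth x by blast
    show xV: "x \<in> pverts \<Gamma>" using x by simp
    then show "gen x \<in> pc_sub \<Gamma> (cl \<Gamma> {x})" by (intro pc_sub_gen self_in_cl)
    fix z assume "z \<in> pverts \<Gamma>"
    then obtain j where j: "j < k" "xs ! j = z" using verts_nth by blast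
    have "i \<notin> class_idx v" using x i by (simp add: class_idx_def)
    then have "expo z (\<phi> (gen x)) = (if i = j then 1 else 0)"
      using expo[OF i(1) j(1)] i j by (simp add: block_mat_index)
    also have "\<dots> = expo z (gen x)"
      using i j xV distinct_xs by (auto simp: expo_gen nth_eq_iff_index_eq)
    finally show "expo z (\<phi> (gen x)) = expo z (gen x)" .
  qed
  show "\<phi> (gen x) \<in> pc_sub \<Gamma> (eq_class \<Gamma> v)" if x: "x \<in> eq_class \<Gamma> v"
  proof -
    have xV: "x \<in> pverts \<Gamma>" using x eq_class_subset by blast
    then obtain i where i: "i < k" "xs ! i = x" using verts_nth by blast
    have "gen_power_prod \<Gamma> xs (\<lambda>j. expo (xs ! j) (\<phi> (gen x))) \<in> pc_sub \<Gamma> (eq_class \<Gamma> v)"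
    proof (rule gen_power_prod_in_sub[OF eq_class_subset])
      fix j assume j: "j < k" "xs ! j \<notin> eq_class \<Gamma> v"
      then have "j \<notin> class_idx v" "i \<noteq> j" using x i by (auto simp: class_idx_def)
      then show "expo (xs ! j) (\<phi> (gen x)) = 0"
        using expo[OF i(1) j(1)] i j by (simp add: block_mat_index)
    qed
    then show ?thesis by (simp only: St_L_element[OF assms(1) xV, symmetric])
  qed
qed

text \<open>An automorphism with such a matrix fixes the generators outside the class and preserves
  the subgroup of the class. With two or more vertices this places it in \<open>V_perp\<close>; a
  class of one vertex has a unit of the integers as its block, hence a sign change in
  \<open>J_set\<close>.\<close>

lemma block_elem_mats:
  assumes v: "v \<in> pverts \<Gamma>" and A: "block_unit A (class_idx v) d"
  shows "block_mat v (\<lambda>i j. A $$ (i, j)) \<in> elem_mats"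
proof -
  let ?D = "block_mat v (\<lambda>i j. A $$ (i, j)) :: int mat" and ?D' = "block_mat v d"
  obtain \<phi> where \<phi>: "\<phi> \<in> St_L \<Gamma>" "aut_matrix \<Gamma> xs \<phi> = ?D"
    using aut_matrix_surj[OF block_mat_cl_mats block_mat_cl_mats block_mat_inverse[OF A]] by (rule bexE)
  obtain \<psi> where \<psi>: "\<psi> \<in> St_L \<Gamma>" "aut_matrix \<Gamma> xs \<psi> = ?D'"
    using aut_matrix_surj[OF block_mat_cl_mats block_mat_cl_mats block_mat_inverse(2,1)[OF A]] by (rule bexE)
  have "\<phi> \<in> J_set \<Gamma> \<union> V_perp \<Gamma> \<union> Tr_perp \<Gamma>"
  proof (cases "card (eq_class \<Gamma> v) \<ge> 2")
    case True
    let ?K = "pc_sub \<Gamma> (eq_class \<Gamma> v)"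
    have img: "E ` ?K \<subseteq> ?K" if "E \<in> St_L \<Gamma>" "aut_matrix \<Gamma> xs E = block_mat v e" for E e
    proof (rule hom_pc_sub_subset[OF _ eq_class_subset class_subgroup])
      show "E \<in> hom G G" using St_L_auto[OF that(1)] by (simp add: G.auto_iff)
    qed (rule St_L_gen_block(2)[OF that])
    \<comment> \<open>\<psi> realises the inverse block. Injectivity of the matrix map shows that
      first \<psi> and then \<phi> is the identity, so \<phi> maps the subgroup of the class onto
      itself and not merely into it.\<close>
    have "aut_matrix \<Gamma> xs (\<psi> \<otimes>\<^bsub>right_Aut G\<^esub> \<phi>) = aut_matrix \<Gamma> xs \<one>\<^bsub>right_Aut G\<^esub>"
      by (simp only: aut_matrix_mult[OF \<psi>(1) \<phi>(1)] aut_matrix_one \<phi>(2) \<psi>(2) block_mat_inverse(2)[OF A])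
    then have "\<psi> \<otimes>\<^bsub>right_Aut G\<^esub> \<phi> = \<one>\<^bsub>right_Aut G\<^esub>"
      by (rule inj_onD[OF aut_matrix_inj _ subgroup.m_closed[OF subgroup_St_L \<psi>(1) \<phi>(1)] one_St_L])
    then have comp: "compose (carrier G) \<phi> \<psi> = (\<lambda>a\<in>carrier G. a)"
      unfolding G.mult_right_Aut[OF St_L_auto[OF \<psi>(1)] St_L_auto[OF \<phi>(1)]] G.one_right_Aut .
    have K: "?K \<subseteq> carrier G" by (rule subgroup.subset[OF class_subgroup])
    have "\<phi> (\<psi> a) = a" if "a \<in> ?K" for a
      using fun_cong[OF comp, of a] subsetD[OF K that] that by (simp add: compose_def)
    then have "\<phi> ` \<psi> ` ?K = ?K" unfolding image_image by simp
    then have "?K = \<phi> ` \<psi> ` ?K" by (rule HOL.sym)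
    also have "\<dots> \<subseteq> \<phi> ` ?K" using img[OF \<psi>] by (rule image_mono)
    finally have "\<phi> ` ?K = ?K" by (rule equalityI[OF img[OF \<phi>]])
    then have "\<phi> \<in> V_perp \<Gamma>"
      by (rule in_V_perp[OF v True St_L_auto[OF \<phi>(1)] _ St_L_gen_block(1)[OF \<phi>]])
    then show ?thesis by simp
  next
    case False
    have "card (class_idx v) = 1"
    proof -
      have "finite (eq_class \<Gamma> v)" using eq_class_subset finite_verts by (rule finite_subset)
      then have "card (eq_class \<Gamma> v) \<noteq> 0" using self_in_eq_class[OF v] by auto
      then show ?thesis using False by (simp add: card_class_idx)
    qed
    then obtain i where I: "class_idx v = {i}" by (rule card_1_singletonE)
    have i: "i < k" "xs ! i \<in> eq_class \<Gamma> v" using I by (auto simp: class_idx_def)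
    have "A $$ (i, i) * d i i = 1" using A unfolding block_unit_def I by simp
    then have unit: "A $$ (i, i) = 1 \<or> A $$ (i, i) = - 1"
      by (auto simp: zmult_eq_1_iff)
    have "\<phi> (gen x) = gen x \<or> \<phi> (gen x) = inv\<^bsub>G\<^esub> gen x" if x: "x \<in> pverts \<Gamma>" for x
    proof (cases "x \<in> eq_class \<Gamma> v")
      case False
      then show ?thesis using St_L_gen_block(1)[OF \<phi>] x by simp
    next
      case True
      obtain i' where i': "i' < k" "xs ! i' = x" using verts_nth[OF x] by blast
      then have "i' \<in> class_idx v" using True by (simp add: class_idx_def)
      then have xi: "xs ! i = x" using I i' by simp
      have gx: "gen x \<in> pc_sub \<Gamma> (cl \<Gamma> {x})" by (rule pc_sub_gen[OF self_in_cl[OF x]])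
      have expo: "expo z (\<phi> (gen x)) = A $$ (i, i) * expo z (gen x)" if z: "z \<in> pverts \<Gamma>" for z
      proof -
        obtain j where j: "j < k" "xs ! j = z" using verts_nth[OF z] by blast
        have "expo z (\<phi> (gen x)) = ?D $$ (i, j)"
          using aut_matrix_index[OF \<phi>(1) i(1) j(1)] \<phi>(2) xi j(2) by simp
        also have "\<dots> = (if i = j then A $$ (i, i) else 0)"
          by (simp add: block_mat_index[OF i(1) j(1)] I)
        also have "\<dots> = A $$ (i, i) * expo z (gen x)"
          using nth_eq_iff_index_eq[OF distinct_xs i(1) j(1)] xi j(2) by (simp add: expo_gen[OF x])
        finally show ?thesis .
      qed
      from unit show ?thesis
      proof
        assume "A $$ (i, i) = 1"
        then have "\<phi> (gen x) = gen x"
          by (intro St_L_gen_eqI[OF \<phi>(1) x gx]) (simp add: expo)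
        then show ?thesis by simp
      next
        assume "A $$ (i, i) = - 1"
        then have "\<phi> (gen x) = inv\<^bsub>G\<^esub> gen x"
          by (intro St_L_gen_eqI[OF \<phi>(1) x subgroup.m_inv_closed[OF pc_sub_subgroup[OF cl_subset] gx]])
            (simp add: expo expo_inv x)
        then show ?thesis by simp
      qed
    qed
    then have "\<phi> \<in> J_set \<Gamma>" using St_L_auto[OF \<phi>(1)] unfolding J_set_def by simp
    then show ?thesis by simp
  qed
  then have "\<phi> \<in> elem_auts" unfolding elem_auts_def by (rule generate.incl)
  then have "aut_matrix \<Gamma> xs \<phi> \<in> elem_mats" by (rule imageI)
  then show ?thesis unfolding \<phi>(2) .
qed

section \<open>Factorisation of the matrices in S_X\<close>

definition nontrivial_classes :: "int mat \<Rightarrow> 'a set set" where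
  "nontrivial_classes A = {C \<in> eq_class \<Gamma> ` pverts \<Gamma>. \<exists>i<k. \<exists>j<k. xs ! i \<in> C \<and> xs ! j \<in> C \<and>
    A $$ (i, j) \<noteq> (if i = j then 1 else 0)}"

text \<open>Induction on the number of classes whose block is not the identity. Multiplying on the
  left by the inverse of one block turns it into the identity; the blocks of the other classes lie
  in other rows and are unchanged. With every block trivial, \<open>unitriangular_elem_mats\<close>
  applies.\<close>

lemma S_X_elem_mats:
  assumes "A \<in> S_X \<Gamma> xs"
  shows "A \<in> elem_mats"
  using assms
proof (induction "card (nontrivial_classes A)" arbitrary: A rule: less_induct)
  case less
  have A: "A \<in> cl_mats" and blocks: "\<And>v. v \<in> pverts \<Gamma> \<Longrightarrow> \<exists>d. block_unit A (class_idx v) d"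
    using less.prems in_S_X_iff by auto
  note AC = cl_mats_carrier[OF A]
  show ?case
  proof (cases "nontrivial_classes A = {}")
    case True
    show ?thesis
    proof (rule unitriangular_elem_mats[OF A])
      fix i j assume ij: "i < k" "j < k" "same_class i j"
      then have "xs ! i \<in> eq_class \<Gamma> (xs ! i)" "xs ! j \<in> eq_class \<Gamma> (xs ! i)"
        using self_in_eq_class[OF nth_verts] by (auto simp: same_class_def)
      then show "A $$ (i, j) = (if i = j then 1 else 0)"
        using True ij nth_verts[OF ij(1)] unfolding nontrivial_classes_def by blast
    qed
  next
    case False
    then obtain v where v: "v \<in> pverts \<Gamma>" "eq_class \<Gamma> v \<in> nontrivial_classes A" by (auto simp: nontrivial_classes_def)
    obtain d where d: "block_unit A (class_idx v) d" using blocks[OF v(1)] by blast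
    let ?D = "block_mat v (\<lambda>i j. A $$ (i, j)) :: int mat"
    define B where "B = block_mat v d * A"
    have B_ind: "B $$ (i, j) = (if i \<in> class_idx v then (\<Sum>l\<in>class_idx v. d i l * A $$ (l, j)) else A $$ (i, j))"
      if "i < k" "j < k" for i j
      unfolding B_def by (rule block_mat_mult_index[OF AC that])
    have B_block: "B $$ (i, j) = (if i = j then 1 else 0)" if "i \<in> class_idx v" "j \<in> class_idx v" for i j
    proof -
      have "i < k" "j < k" using that by (simp_all add: class_idx_def)
      then show ?thesis using B_ind[of i j] that d unfolding block_unit_def by simp
    qed
    have A_eq: "?D * B = A"
    proof -
      have "?D * B = (?D * block_mat v d) * A"
        unfolding B_def using AC by (intro assoc_mult_mat[symmetric, of _ k k _ k _ k]) simp_all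
      then show ?thesis using AC by (simp add: block_mat_inverse[OF d])
    qed
    have D: "?D \<in> elem_mats" by (rule block_elem_mats[OF v(1) d])
    have "B \<in> elem_mats"
    proof (rule less.hyps)
      have other: "B $$ (i, j) = A $$ (i, j)"
        if "i < k" "j < k" "xs ! i \<notin> eq_class \<Gamma> v" for i j
        using B_ind[of i j] that by (simp add: class_idx_def)
      have "nontrivial_classes B \<subseteq> nontrivial_classes A - {eq_class \<Gamma> v}"
      proof
        fix C assume "C \<in> nontrivial_classes B"
        then obtain w i j where C: "w \<in> pverts \<Gamma>" "C = eq_class \<Gamma> w" "i < k" "j < k" "xs ! i \<in> C"
            "xs ! j \<in> C" "B $$ (i, j) \<noteq> (if i = j then 1 else 0)"
          unfolding nontrivial_classes_def by blast
        \<comment> \<open>If C were the class of v, its block in \<open>B\<close> would be the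
          identity, contrary to the choice of \<open>i\<close> and \<open>j\<close>.\<close>
        have "xs ! i \<notin> eq_class \<Gamma> v \<and> C \<noteq> eq_class \<Gamma> v"
        proof (cases "C = eq_class \<Gamma> v")
          case True
          then show ?thesis using B_block C(3-7) by (simp add: class_idx_def)
        next
          case False
          then show ?thesis using C(2,5) eq_class_cong by blast
        qed
        moreover from this have "A $$ (i, j) \<noteq> (if i = j then 1 else 0)"
          using C(7) other[OF C(3,4)] by simp
        then have "C \<in> nontrivial_classes A"
          unfolding nontrivial_classes_def using C(1-6) by blast
        ultimately show "C \<in> nontrivial_classes A - {eq_class \<Gamma> v}" by simp
      qed
      then have "nontrivial_classes B \<subset> nontrivial_classes A" using v(2) by blast
      moreover have "finite (nontrivial_classes A)" using finite_verts by (simp add: nontrivial_classes_def)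
      ultimately show "card (nontrivial_classes B) < card (nontrivial_classes A)" by (intro psubset_card_mono)
      show "B \<in> S_X \<Gamma> xs"
        unfolding in_S_X_iff
      proof (intro conjI ballI)
        show "B \<in> cl_mats" unfolding B_def by (rule cl_mats_mult[OF block_mat_cl_mats A])
        fix w assume w: "w \<in> pverts \<Gamma>"
        show "\<exists>d. block_unit B (class_idx w) d"
        proof (cases "eq_class \<Gamma> w = eq_class \<Gamma> v")
          case True
          then have I: "class_idx w = class_idx v" by (simp add: class_idx_def)
          have fin: "finite (class_idx v)" using class_idx_subset by (rule finite_subset) simp
          have "block_unit B (class_idx w) (\<lambda>i j. if i = j then 1 else 0)"
            unfolding block_unit_def I
          proof (intro ballI conjI)
            fix i j assume ij: "i \<in> class_idx v" "j \<in> class_idx v"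
            have "(\<Sum>l\<in>class_idx v. B $$ (i, l) * (if l = j then 1 else 0)) =
                (\<Sum>l\<in>class_idx v. if l = j then (if i = j then 1 else 0) else 0)"
              using ij by (intro sum.cong) (auto simp: B_block)
            then show "(\<Sum>l\<in>class_idx v. B $$ (i, l) * (if l = j then 1 else 0)) = (if i = j then 1 else 0)"
              using fin ij by simp
            have "(\<Sum>l\<in>class_idx v. (if i = l then 1 else 0) * B $$ (l, j)) =
                (\<Sum>l\<in>class_idx v. if l = i then (if i = j then 1 else 0) else 0)"
              using ij by (intro sum.cong) (auto simp: B_block)
            then show "(\<Sum>l\<in>class_idx v. (if i = l then 1 else 0) * B $$ (l, j)) = (if i = j then 1 else 0)"
              using fin ij by simp
          qed
          then show ?thesis by blast
        next
          case False
          obtain e where e: "block_unit A (class_idx w) e" using blocks[OF w] by blast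
          have eq: "B $$ (i, j) = A $$ (i, j)" if "i \<in> class_idx w" "j \<in> class_idx w" for i j
          proof (rule other)
            show "i < k" "j < k" using that by (auto simp: class_idx_def)
            show "xs ! i \<notin> eq_class \<Gamma> v"
              using that(1) False eq_class_cong unfolding class_idx_def by blast
          qed
          have "block_unit B (class_idx w) e"
            using e unfolding block_unit_def by (simp add: eq)
          then show ?thesis by blast
        qed
      qed
    qed
    with D have "?D * B \<in> elem_mats" by (rule elem_mats_mult)
    then show ?thesis by (simp only: A_eq)
  qed
qed

text \<open>Surjectivity is a by-product of the factorisation: a product of elementary matrices is
  the matrix of a product of elementary automorphisms, which lies in St(L).\<close>

theorem image_aut_matrix: "aut_matrix \<Gamma> xs ` St_L \<Gamma> = S_X \<Gamma> xs"
proof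
  show "aut_matrix \<Gamma> xs ` St_L \<Gamma> \<subseteq> S_X \<Gamma> xs" using aut_matrix_in_S_X by (rule image_subsetI)
  have "S_X \<Gamma> xs \<subseteq> elem_mats" using S_X_elem_mats by (rule subsetI)
  also have "\<dots> \<subseteq> aut_matrix \<Gamma> xs ` St_L \<Gamma>" using elem_auts_subset by (rule image_mono)
  finally show "S_X \<Gamma> xs \<subseteq> aut_matrix \<Gamma> xs ` St_L \<Gamma>" .
qed

text \<open>An automorphism and the elementary product with the same matrix coincide by
  injectivity.\<close>

theorem generate_eq_St_L: "generate (right_Aut G) (J_set \<Gamma> \<union> V_perp \<Gamma> \<union> Tr_perp \<Gamma>) = St_L \<Gamma>"
proof -
  have "St_L \<Gamma> \<subseteq> elem_auts"
  proof
    fix \<phi> assume \<phi>: "\<phi> \<in> St_L \<Gamma>"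
    then have "aut_matrix \<Gamma> xs \<phi> \<in> elem_mats" by (intro S_X_elem_mats aut_matrix_in_S_X)
    then obtain \<psi> where \<psi>: "aut_matrix \<Gamma> xs \<phi> = aut_matrix \<Gamma> xs \<psi>" "\<psi> \<in> elem_auts" by (rule imageE)
    have "\<phi> = \<psi>"
      by (rule inj_onD[OF aut_matrix_inj \<psi>(1) \<phi> subsetD[OF elem_auts_subset \<psi>(2)]])
    with \<psi>(2) show "\<phi> \<in> elem_auts" by simp
  qed
  with elem_auts_subset have "elem_auts = St_L \<Gamma>" by (rule equalityI)
  then show ?thesis unfolding elem_auts_def .
qed

end

section \<open>Rational polynomial functions\<close>

definition monomial_eval :: "('v \<Rightarrow> complex) \<Rightarrow> ('v \<Rightarrow>\<^sub>0 nat) \<Rightarrow> complex" where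
  "monomial_eval f m = (\<Prod>v\<in>Poly_Mapping.keys m. f v ^ Poly_Mapping.lookup m v)"

lemma monomial_eval_superset:
  assumes "finite S" "Poly_Mapping.keys m \<subseteq> S"
  shows "monomial_eval f m = (\<Prod>v\<in>S. f v ^ Poly_Mapping.lookup m v)"
  unfolding monomial_eval_def using assms
  by (intro prod.mono_neutral_left) (auto simp: in_keys_iff)

lemma monomial_eval_add:
  "monomial_eval f (m + m') = monomial_eval f m * monomial_eval f m'"
proof -
  let ?S = "Poly_Mapping.keys m \<union> Poly_Mapping.keys m'"
  have "monomial_eval f (m + m') = (\<Prod>v\<in>?S. f v ^ Poly_Mapping.lookup (m + m') v)"
    by (intro monomial_eval_superset Poly_Mapping.keys_add) simp
  also have "\<dots> = (\<Prod>v\<in>?S. f v ^ Poly_Mapping.lookup m v) * (\<Prod>v\<in>?S. f v ^ Poly_Mapping.lookup m' v)"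
    by (simp add: lookup_add power_add prod.distrib)
  also have "\<dots> = monomial_eval f m * monomial_eval f m'"
    by (simp add: monomial_eval_superset[of ?S])
  finally show ?thesis .
qed

lemma mpoly_eval_superset:
  assumes "finite S" "Poly_Mapping.keys p \<subseteq> S"
  shows "mpoly_eval f p = (\<Sum>m\<in>S. of_rat (Poly_Mapping.lookup p m) * monomial_eval f m)"
  unfolding mpoly_eval_def monomial_eval_def using assms
  by (intro sum.mono_neutral_left) (auto simp: in_keys_iff)

lemma mpoly_eval_add: "mpoly_eval f (p + q) = mpoly_eval f p + mpoly_eval f q"
proof -
  let ?S = "Poly_Mapping.keys p \<union> Poly_Mapping.keys q"
  have "mpoly_eval f (p + q) = (\<Sum>m\<in>?S. of_rat (Poly_Mapping.lookup (p + q) m) * monomial_eval f m)"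
    by (intro mpoly_eval_superset Poly_Mapping.keys_add) simp
  also have "\<dots> = mpoly_eval f p + mpoly_eval f q"
    by (simp add: mpoly_eval_superset[of ?S] lookup_add of_rat_add algebra_simps sum.distrib)
  finally show ?thesis .
qed

lemma mpoly_eval_single:
  "mpoly_eval f (Poly_Mapping.single m c) = of_rat c * monomial_eval f m"
  by (simp add: mpoly_eval_superset[of "{m}"])

text \<open>Polynomials are handled through the functions they define. Sums of rational multiples of
  monomials cover both matrix products and cofactors, so products are formed for monomials
  only.\<close>

definition monomial_fun :: "'v set \<Rightarrow> (('v \<Rightarrow> complex) \<Rightarrow> complex) \<Rightarrow> bool" where
  "monomial_fun V F \<longleftrightarrow> (\<exists>m. Poly_Mapping.keys m \<subseteq> V \<and> (\<forall>f. F f = monomial_eval f m))"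

definition poly_fun :: "'v set \<Rightarrow> (('v \<Rightarrow> complex) \<Rightarrow> complex) \<Rightarrow> bool" where
  "poly_fun V F \<longleftrightarrow> (\<exists>q\<in>mpolys_in V. \<forall>f. F f = mpoly_eval f q)"

lemma monomial_fun_var: "v \<in> V \<Longrightarrow> monomial_fun V (\<lambda>f. f v)"
  unfolding monomial_fun_def
  by (intro exI[of _ "Poly_Mapping.single v 1"]) (simp add: monomial_eval_def)

lemma monomial_fun_one: "monomial_fun V (\<lambda>f. 1)"
  unfolding monomial_fun_def by (intro exI[of _ 0]) (simp add: monomial_eval_def)

lemma monomial_fun_mult:
  assumes "monomial_fun V F" "monomial_fun V F'"
  shows "monomial_fun V (\<lambda>f. F f * F' f)"
proof -
  obtain m m' where "Poly_Mapping.keys m \<subseteq> V" "Poly_Mapping.keys m' \<subseteq> V"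
      "\<And>f. F f = monomial_eval f m" "\<And>f. F' f = monomial_eval f m'"
    using assms unfolding monomial_fun_def by blast
  then show ?thesis
    unfolding monomial_fun_def using Poly_Mapping.keys_add[of m m']
    by (intro exI[of _ "m + m'"]) (auto simp: monomial_eval_add)
qed

lemma monomial_fun_prod:
  assumes "\<And>i. i \<in> I \<Longrightarrow> monomial_fun V (F i)"
  shows "monomial_fun V (\<lambda>f. \<Prod>i\<in>I. F i f)"
  using assms
proof (induction I rule: infinite_finite_induct)
  case (insert i I)
  then have "monomial_fun V (\<lambda>f. F i f * (\<Prod>i\<in>I. F i f))"
    by (intro monomial_fun_mult) auto
  then show ?case using insert by simp
qed (simp_all add: monomial_fun_one)

lemma poly_fun_monomial:
  assumes "monomial_fun V F"
  shows "poly_fun V (\<lambda>f. of_rat c * F f)"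
proof -
  obtain m where "Poly_Mapping.keys m \<subseteq> V" "\<And>f. F f = monomial_eval f m"
    using assms unfolding monomial_fun_def by blast
  then show ?thesis
    unfolding poly_fun_def
    by (intro bexI[of _ "Poly_Mapping.single m c"]) (simp_all add: mpoly_eval_single mpolys_in_def)
qed

lemma poly_fun_add:
  assumes "poly_fun V F" "poly_fun V F'"
  shows "poly_fun V (\<lambda>f. F f + F' f)"
proof -
  obtain p q where "p \<in> mpolys_in V" "q \<in> mpolys_in V"
      "\<And>f. F f = mpoly_eval f p" "\<And>f. F' f = mpoly_eval f q"
    using assms unfolding poly_fun_def by blast
  moreover from this have "p + q \<in> mpolys_in V"
    using Poly_Mapping.keys_add[of p q] unfolding mpolys_in_def by blast
  ultimately show ?thesis
    unfolding poly_fun_def by (intro bexI[of _ "p + q"]) (simp_all add: mpoly_eval_add)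
qed

lemma poly_fun_sum:
  assumes "\<And>i. i \<in> I \<Longrightarrow> poly_fun V (F i)"
  shows "poly_fun V (\<lambda>f. \<Sum>i\<in>I. F i f)"
  using assms
proof (induction I rule: infinite_finite_induct)
  case (insert i I)
  then have "poly_fun V (\<lambda>f. F i f + (\<Sum>i\<in>I. F i f))"
    by (intro poly_fun_add) auto
  then show ?case using insert by simp
\<comment> \<open>An empty or infinite sum is the zero function, written as 0 times the monomial
  1.\<close>
qed (use poly_fun_monomial[OF monomial_fun_one, of V 0] in simp_all)

section \<open>Polynomial formulas for products and inverses\<close>

lemma inv_GL_eq:
  assumes "A \<in> carrier (GL n)" "B \<in> carrier_mat n n" "B * A = 1\<^sub>m n"
  shows "inv\<^bsub>GL n\<^esub> A = (B :: 'r :: comm_ring_1 mat)"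
proof -
  interpret GL: group "GL n :: 'r mat monoid" by (rule group_GL)
  obtain C where C: "C \<in> carrier_mat n n" "A * C = 1\<^sub>m n" "C * A = 1\<^sub>m n" and A: "A \<in> carrier_mat n n"
    using assms(1) unfolding carrier_GL by blast
  have "B * (A * C) = (B * A) * C"
    by (rule assoc_mult_mat[symmetric, OF assms(2) A C(1)])
  then have "B = C" using assms(2,3) C(1,2) by simp
  moreover have "C \<in> carrier (GL n)" unfolding carrier_GL using A C by blast
  ultimately show ?thesis using assms by (intro GL.inv_equality) simp_all
qed

lemma det_GL_nonzero:
  assumes "(A :: complex mat) \<in> carrier (GL n)"
  shows "det A \<noteq> 0"
proof -
  obtain B where B: "B \<in> carrier_mat n n" "A * B = 1\<^sub>m n" and A: "A \<in> carrier_mat n n"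
    using assms unfolding carrier_GL by blast
  have "det A * det B = 1" using det_mult[OF A B(1)] B(2) by simp
  then show ?thesis by auto
qed

text \<open>Cramer's rule; the indices of the cofactor are swapped because the adjugate is the
  transposed cofactor matrix.\<close>

lemma inv_GL_index:
  assumes A: "(A :: complex mat) \<in> carrier (GL n)" and ij: "i < n" "j < n"
  shows "(inv\<^bsub>GL n\<^esub> A) $$ (i, j) = 1 / det A * cofactor A j i"
proof -
  have AC: "A \<in> carrier_mat n n" using A unfolding carrier_GL by blast
  note adj = adj_mat[OF AC]
  have "((1 / det A) \<cdot>\<^sub>m adj_mat A) * A = (1 / det A) \<cdot>\<^sub>m (det A \<cdot>\<^sub>m 1\<^sub>m n)"
    using mult_smult_assoc_mat[OF adj(1) AC] adj(3) by simp
  also have "\<dots> = 1\<^sub>m n"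
    using det_GL_nonzero[OF A] by (intro eq_matI) auto
  finally have "inv\<^bsub>GL n\<^esub> A = (1 / det A) \<cdot>\<^sub>m adj_mat A"
    using adj(1) by (intro inv_GL_eq[OF A]) simp_all
  then show ?thesis using ij AC adj(1) by (simp add: adj_mat_def)
qed

lemma GL_mult_polynomial:
  assumes "i < n" "j < n"
  shows "\<exists>q\<in>mpolys_in (GL_vars n <+> GL_vars n). \<forall>A\<in>carrier_mat n n. \<forall>B\<in>carrier_mat n n.
    (A \<otimes>\<^bsub>GL n\<^esub> B) $$ (i, j) = mpoly_eval (case_sum (GL_coord A) (GL_coord B)) q"
proof -
  let ?V = "GL_vars n <+> GL_vars n"
  have "poly_fun ?V (\<lambda>f. \<Sum>l<n. of_rat 1 * (f (Inl (Some (i, l))) * f (Inr (Some (l, j)))))"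
    using assms
    by (intro poly_fun_sum poly_fun_monomial monomial_fun_mult monomial_fun_var) (auto simp: GL_vars_def)
  then obtain q where q: "q \<in> mpolys_in ?V"
      "\<And>f. (\<Sum>l<n. of_rat 1 * (f (Inl (Some (i, l))) * f (Inr (Some (l, j))))) = mpoly_eval f q"
    unfolding poly_fun_def by blast
  have "(A \<otimes>\<^bsub>GL n\<^esub> B) $$ (i, j) = mpoly_eval (case_sum (GL_coord A) (GL_coord B)) q"
    if "A \<in> carrier_mat n n" "B \<in> carrier_mat n n" for A B
    using that assms by (simp add: q(2)[symmetric] mult_mat_index[of _ n] del: index_mult_mat)
  then show ?thesis using q(1) by blast
qed

text \<open>In Cramer's rule the factor 1 / det is the coordinate \<open>None\<close>, and Leibniz'
  formula expands the cofactor as a sum of signed monomials in the entries.\<close>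

lemma GL_inv_polynomial:
  assumes "i < n" "j < n"
  shows "\<exists>q\<in>mpolys_in (GL_vars n). \<forall>A\<in>carrier (GL n).
    (inv\<^bsub>GL n\<^esub> A) $$ (i, j) = mpoly_eval (GL_coord A) q"
proof -
  let ?V = "GL_vars n"
  let ?P = "{p. p permutes {0..<n - 1}}"
  let ?c = "\<lambda>p. (- 1) ^ (j + i) * of_int (sign p) :: rat"
  \<comment> \<open>\<open>insert_index j\<close> renumbers the positions below n - 1 so as to skip
    row \<open>j\<close>, and \<open>insert_index i\<close> likewise skips column \<open>i\<close>:
    these are the entries of the minor behind the cofactor (j, i).\<close>
  let ?m = "\<lambda>p f. f None * (\<Prod>a = 0..<n - 1. f (Some (insert_index j a, insert_index i (p a))) :: complex)"
  have index: "insert_index l a < n" if "a < n - 1" for l a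
    using that by (auto simp: insert_index_def)
  have "poly_fun ?V (\<lambda>f. \<Sum>p\<in>?P. of_rat (?c p) * ?m p f)"
  proof (intro poly_fun_sum poly_fun_monomial monomial_fun_mult monomial_fun_prod monomial_fun_var)
    show "None \<in> ?V" by (simp add: GL_vars_def)
    fix p a assume "p \<in> ?P" "a \<in> {0..<n - 1}"
    then have "a < n - 1" "p a < n - 1" using permutes_in_image[of p "{0..<n - 1}" a] by auto
    then show "Some (insert_index j a, insert_index i (p a)) \<in> ?V"
      using index by (auto simp: GL_vars_def)
  qed
  then obtain q where q: "q \<in> mpolys_in ?V"
      "\<And>f. (\<Sum>p\<in>?P. of_rat (?c p) * ?m p f) = mpoly_eval f q"
    unfolding poly_fun_def by blast
  have "(inv\<^bsub>GL n\<^esub> A) $$ (i, j) = mpoly_eval (GL_coord A) q" if A: "A \<in> carrier (GL n)" for A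
  proof -
    have AC: "A \<in> carrier_mat n n" using A unfolding carrier_GL by blast
    have "cofactor A j i = (- 1) ^ (j + i) * (\<Sum>p\<in>?P. of_int (sign p) *
        (\<Prod>a = 0..<n - 1. mat_delete A j i $$ (a, p a)))"
      unfolding cofactor_def det_def'[OF mat_delete_carrier[OF AC]] ..
    also have "(\<Sum>p\<in>?P. of_int (sign p) * (\<Prod>a = 0..<n - 1. mat_delete A j i $$ (a, p a))) =
        (\<Sum>p\<in>?P. of_int (sign p) * (\<Prod>a = 0..<n - 1. A $$ (insert_index j a, insert_index i (p a))))"
    proof (rule sum.cong)
      fix p assume p: "p \<in> ?P"
      have "(\<Prod>a = 0..<n - 1. mat_delete A j i $$ (a, p a)) =
          (\<Prod>a = 0..<n - 1. A $$ (insert_index j a, insert_index i (p a)))"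
      proof (rule prod.cong)
        fix a assume "a \<in> {0..<n - 1}"
        then have "a < n - 1" "p a < n - 1"
          using p permutes_in_image[of p "{0..<n - 1}" a] by auto
        then show "mat_delete A j i $$ (a, p a) = A $$ (insert_index j a, insert_index i (p a))"
          using AC by (simp add: mat_delete_def insert_index_def)
      qed simp
      then show "of_int (sign p) * (\<Prod>a = 0..<n - 1. mat_delete A j i $$ (a, p a)) =
          of_int (sign p) * (\<Prod>a = 0..<n - 1. A $$ (insert_index j a, insert_index i (p a)))"
        by simp
    qed simp
    finally have "1 / det A * cofactor A j i = (\<Sum>p\<in>?P. 1 / det A * ((- 1) ^ (j + i) *
        (of_int (sign p) * (\<Prod>a = 0..<n - 1. A $$ (insert_index j a, insert_index i (p a))))))"
      by (simp only: sum_distrib_left)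
    also have "\<dots> = (\<Sum>p\<in>?P. of_rat (?c p) * ?m p (GL_coord A))"
      by (rule sum.cong) (simp_all add: of_rat_mult of_rat_power of_rat_minus)
    also have "\<dots> = mpoly_eval (GL_coord A) q" by (rule q(2))
    finally show ?thesis unfolding inv_GL_index[OF A assms] .
  qed
  then show ?thesis using q(1) by blast
qed

lemma mult_mat_vec_index:
  assumes "A \<in> carrier_mat n n" "v \<in> carrier_vec n" "i < n"
  shows "(A *\<^sub>v v) $ i = (\<Sum>l<n. A $$ (i, l) * v $ l)"
  using assms by (simp add: scalar_prod_def atLeast0LessThan)

text \<open>The criterion with column vectors, applied to the transpose.\<close>

lemma det_zero_left_kernel:
  assumes "(A :: 'f :: field mat) \<in> carrier_mat n n"
  shows "det A = 0 \<longleftrightarrow> (\<exists>v. v \<in> carrier_vec n \<and> v \<noteq> 0\<^sub>v n \<and> (\<forall>j<n. (\<Sum>l<n. v $ l * A $$ (l, j)) = 0))"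
proof -
  have T: "transpose_mat A \<in> carrier_mat n n" using assms by simp
  have "transpose_mat A *\<^sub>v v = 0\<^sub>v n \<longleftrightarrow> (\<forall>j<n. (\<Sum>l<n. v $ l * A $$ (l, j)) = 0)"
    if v: "v \<in> carrier_vec n" for v
  proof -
    have "(transpose_mat A *\<^sub>v v) $ j = (\<Sum>l<n. v $ l * A $$ (l, j))" if "j < n" for j
      unfolding mult_mat_vec_index[OF T v that] using assms that by (intro sum.cong) (auto simp: mult.commute)
    then show ?thesis using T by (auto simp: vec_eq_iff)
  qed
  then show ?thesis
    using det_0_iff_vec_prod_zero_field[OF T] det_transpose[OF assms] by auto
qed

section \<open>The algebraic group of invertible incidence matrices\<close>

context ordered_pc_graph
begin

text \<open>The rows of \<open>A\<close> indexed by \<open>I\<close>, the part of the list lying in a fixed closure, vanish off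
  \<open>I\<close>. Hence the block of \<open>A\<close> on \<open>I\<close> (completed to \<open>C\<close> by an identity block) is nonsingular, and
  it annihilates the part of each column outside \<open>I\<close> of \<open>A\<inverse>\<close> that is indexed by \<open>I\<close>.\<close>

lemma cl_mats_inverse:
  fixes A B :: "'f :: field mat"
  assumes A: "A \<in> cl_mats" and B: "B \<in> carrier_mat k k" and AB: "A * B = 1\<^sub>m k"
  shows "B \<in> cl_mats"
proof (rule cl_matsI[OF B])
  fix i0 j0 assume ij: "i0 < k" "j0 < k" "xs ! j0 \<notin> cl \<Gamma> {xs ! i0}"
  note AC = cl_mats_carrier[OF A]
  define I where "I = {i. i < k \<and> xs ! i \<in> cl \<Gamma> {xs ! i0}}"
  have I: "I \<subseteq> {..<k}" by (auto simp: I_def)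
  have zero: "A $$ (i, j) = 0" if "i \<in> I" "j < k" "j \<notin> I" for i j
  proof -
    have "xs ! j \<notin> cl \<Gamma> {xs ! i}"
      using that in_cl_trans[of "xs ! i" "xs ! i0" "xs ! j"] ij(1) by (auto simp: I_def)
    then show ?thesis using cl_mats_zero[OF A] that by (simp add: I_def)
  qed
  define C where "C = mat k k (\<lambda>(i, j). if i \<in> I \<and> j \<in> I then A $$ (i, j) else if i = j then 1 else 0)"
  have CC: "C \<in> carrier_mat k k" by (simp add: C_def)
  have C: "C $$ (i, j) = (if i \<in> I \<and> j \<in> I then A $$ (i, j) else if i = j then 1 else 0)"
    if "i < k" "j < k" for i j using that by (simp add: C_def)
  have "det A * det B = 1" using det_mult[OF AC B] AB by simp
  then have det_A: "det A \<noteq> 0" by auto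
  \<comment> \<open>A left kernel vector of \<open>C\<close> vanishes off \<open>I\<close>, where
    the columns of \<open>C\<close> are unit vectors. As the rows of \<open>A\<close> in
    \<open>I\<close> vanish off \<open>I\<close>, it is then a left kernel vector of
    \<open>A\<close>, which is nonsingular.\<close>
  have det_C: "det C \<noteq> 0"
  proof
    assume "det C = 0"
    then obtain v where v: "v \<in> carrier_vec k" "v \<noteq> 0\<^sub>v k"
        and vC: "\<And>j. j < k \<Longrightarrow> (\<Sum>l<k. v $ l * C $$ (l, j)) = 0"
      using det_zero_left_kernel[OF CC] by blast
    have v0: "v $ j = 0" if "j < k" "j \<notin> I" for j
    proof -
      have "(\<Sum>l<k. v $ l * C $$ (l, j)) = (\<Sum>l<k. if l = j then v $ l else 0)"
        using that by (intro sum.cong) (auto simp: C)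
      then show ?thesis using vC[OF that(1)] that(1) by simp
    qed
    have "(\<Sum>l<k. v $ l * A $$ (l, j)) = 0" if j: "j < k" for j
    proof (cases "j \<in> I")
      case True
      have "(\<Sum>l<k. v $ l * A $$ (l, j)) = (\<Sum>l<k. v $ l * C $$ (l, j))"
        using True j v0 by (intro sum.cong) (auto simp: C)
      then show ?thesis using vC[OF j] by simp
    next
      case False
      then show ?thesis using zero[OF _ j] v0 by (intro sum.neutral) (metis lessThan_iff mult_zero_left mult_zero_right)
    qed
    then have "det A = 0" using det_zero_left_kernel[OF AC] v by blast
    then show False using det_A by simp
  qed
  define w where "w = vec k (\<lambda>l. if l \<in> I then B $$ (l, j0) else 0)"
  have wC: "w \<in> carrier_vec k" by (simp add: w_def)
  have "C *\<^sub>v w = 0\<^sub>v k"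
  proof (rule eq_vecI)
    fix i assume "i < dim_vec (0\<^sub>v k :: 'f vec)"
    then have i: "i < k" by simp
    have j0: "j0 \<notin> I" using ij by (simp add: I_def)
    have "(\<Sum>l<k. C $$ (i, l) * w $ l) = 0"
    proof (cases "i \<in> I")
      case True
      have "(\<Sum>l<k. C $$ (i, l) * w $ l) = (\<Sum>l<k. A $$ (i, l) * B $$ (l, j0))"
        using True i zero[OF True] by (intro sum.cong) (auto simp: C w_def)
      also have "\<dots> = (A * B) $$ (i, j0)"
        by (rule mult_mat_index[OF AC B i ij(2), symmetric])
      also have "\<dots> = 0" using AB i ij(2) True j0 by auto
      finally show ?thesis .
    next
      case False
      then show ?thesis using i by (intro sum.neutral) (auto simp: C w_def)
    qed
    then show "(C *\<^sub>v w) $ i = 0\<^sub>v k $ i"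
      using mult_mat_vec_index[OF CC wC i] i by simp
  qed (use CC in simp)
  then have "w = 0\<^sub>v k"
    using det_0_iff_vec_prod_zero_field[OF CC] det_C wC by blast
  moreover have "i0 \<in> I" using ij self_in_cl[OF nth_verts[OF ij(1)]] by (simp add: I_def)
  moreover from this have "w $ i0 = B $$ (i0, j0)" using ij(1) by (simp add: w_def)
  ultimately show "B $$ (i0, j0) = 0" using ij(1) by simp
qed

definition cl_GL :: "complex mat set" where
  "cl_GL = cl_mats \<inter> carrier (GL k)"

lemma subgroup_cl_GL: "subgroup cl_GL (GL k)"
proof -
  interpret GL: group "GL k :: complex mat monoid" by (rule group_GL)
  show ?thesis
  proof (rule GL.subgroupI)
    show "cl_GL \<subseteq> carrier (GL k)" by (simp add: cl_GL_def)
    have "1\<^sub>m k \<in> cl_GL" using one_cl_mats GL.one_closed by (simp add: cl_GL_def)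
    then show "cl_GL \<noteq> {}" by blast
  next
    fix A assume A: "A \<in> cl_GL"
    then have G: "A \<in> carrier (GL k)" by (simp add: cl_GL_def)
    have inv: "inv\<^bsub>GL k\<^esub> A \<in> carrier (GL k)" by (rule GL.inv_closed[OF G])
    have "inv\<^bsub>GL k\<^esub> A \<in> cl_mats"
    proof (rule cl_mats_inverse)
      show "A \<in> cl_mats" using A by (simp add: cl_GL_def)
      show "inv\<^bsub>GL k\<^esub> A \<in> carrier_mat k k" using inv unfolding carrier_GL by blast
      show "A * inv\<^bsub>GL k\<^esub> A = 1\<^sub>m k" using GL.r_inv[OF G] by simp
    qed
    then show "inv\<^bsub>GL k\<^esub> A \<in> cl_GL" using inv by (simp add: cl_GL_def)
  next
    fix A B assume "A \<in> cl_GL" "B \<in> cl_GL"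
    then show "A \<otimes>\<^bsub>GL k\<^esub> B \<in> cl_GL"
      using cl_mats_mult[of A B] GL.m_closed[of A B] by (simp add: cl_GL_def)
  qed
qed

lemma Q_defined_cl_GL: "Q_defined_algebraic_group k cl_GL"
  unfolding Q_defined_algebraic_group_def
proof (intro conjI allI impI)
  show "subgroup cl_GL (GL k)" by (rule subgroup_cl_GL)
  let ?Z = "{(i, j). i < k \<and> j < k \<and> xs ! j \<notin> cl \<Gamma> {xs ! i}}"
  \<comment> \<open>The coordinate function of one entry: the variable \<open>ij\<close> to the
    power 1 with coefficient 1. The group is cut out by these at the forbidden positions.\<close>
  let ?p = "\<lambda>ij. Poly_Mapping.single (Poly_Mapping.single ij 1) 1 :: (nat \<times> nat) rat_mpoly"
  have eval: "mpoly_eval f (?p ij) = f ij" for f ij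
    by (simp add: mpoly_eval_single monomial_eval_def)
  have "?p ` ?Z \<subseteq> mpolys_in ({..<k} \<times> {..<k})"
    by (auto simp: mpolys_in_def)
  moreover have "cl_GL = {A \<in> carrier (GL k). \<forall>p\<in>?p ` ?Z. mpoly_eval (\<lambda>ij. A $$ ij) p = 0}"
    unfolding cl_GL_def cl_mats_def carrier_GL Ball_image_comp comp_def eval by auto
  ultimately show "\<exists>P\<subseteq>mpolys_in ({..<k} \<times> {..<k}).
      cl_GL = {A \<in> carrier (GL k). \<forall>p\<in>P. mpoly_eval (\<lambda>ij. A $$ ij) p = 0}"
    by blast
next
  fix i j assume ij: "i < k" "j < k"
  obtain q where q: "q \<in> mpolys_in (GL_vars k <+> GL_vars k)"
      "\<forall>A\<in>carrier_mat k k. \<forall>B\<in>carrier_mat k k.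
        (A \<otimes>\<^bsub>GL k\<^esub> B) $$ (i, j) = mpoly_eval (case_sum (GL_coord A) (GL_coord B)) q"
    using GL_mult_polynomial[OF ij] by (rule bexE)
  have "cl_GL \<subseteq> carrier_mat k k" by (auto simp: cl_GL_def carrier_GL)
  then show "\<exists>q\<in>mpolys_in (GL_vars k <+> GL_vars k). \<forall>A\<in>cl_GL. \<forall>B\<in>cl_GL.
      (A \<otimes>\<^bsub>GL k\<^esub> B) $$ (i, j) = mpoly_eval (case_sum (GL_coord A) (GL_coord B)) q"
    using q by blast
  obtain q where q: "q \<in> mpolys_in (GL_vars k)"
      "\<forall>A\<in>carrier (GL k). (inv\<^bsub>GL k\<^esub> A) $$ (i, j) = mpoly_eval (GL_coord A) q"
    using GL_inv_polynomial[OF ij] by (rule bexE)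
  have "cl_GL \<subseteq> carrier (GL k)" by (simp add: cl_GL_def)
  then show "\<exists>q\<in>mpolys_in (GL_vars k). \<forall>A\<in>cl_GL.
      (inv\<^bsub>GL k\<^esub> A) $$ (i, j) = mpoly_eval (GL_coord A) q"
    using q by blast
qed

end

section \<open>Arithmeticity\<close>

text \<open>Commensurability will be applied to two equal subgroups, where there is just one
  coset.\<close>

lemma finite_index_self:
  assumes "group G" "subgroup H G"
  shows "finite_index_in G H H"
proof -
  let ?K = "G\<lparr>carrier := H\<rparr>"
  interpret K: group ?K by (rule group.subgroup_imp_group[OF assms])
  have H: "subgroup H ?K" using K.subgroup_self by simp
  have "H #>\<^bsub>?K\<^esub> a = H" if "a \<in> H" for a
    using K.coset_join2[OF _ H that] that by simp
  then have "rcosets\<^bsub>?K\<^esub> H \<subseteq> {H}" by (auto simp: RCOSETS_def)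
  then show ?thesis unfolding finite_index_in_def by (rule finite_subset) simp
qed

lemma map_mat_of_int_GL:
  assumes "A \<in> carrier (GL n)"
  shows "map_mat of_int A \<in> carrier (GL n :: 'r :: comm_ring_1 mat monoid)"
proof -
  obtain B where B: "B \<in> carrier_mat n n" "A * B = 1\<^sub>m n" "B * A = 1\<^sub>m n" and A: "A \<in> carrier_mat n n"
    using assms unfolding carrier_GL by blast
  have "map_mat of_int A * map_mat of_int B = (1\<^sub>m n :: 'r mat)"
    "map_mat of_int B * map_mat of_int A = (1\<^sub>m n :: 'r mat)"
    using of_int_hom.mat_hom_mult[OF A B(1), where 'a = 'r]
      of_int_hom.mat_hom_mult[OF B(1) A, where 'a = 'r] B(2,3)
    by (simp_all add: of_int_hom.mat_hom_one)
  then show ?thesis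
    unfolding carrier_GL using A B(1) by (auto intro!: bexI[of _ "map_mat of_int B"])
qed

lemma map_mat_of_int_hom:
  "map_mat of_int \<in> hom (GL n) (GL n :: 'r :: comm_ring_1 mat monoid)"
proof (rule homI)
  fix A B :: "int mat" assume "A \<in> carrier (GL n)" "B \<in> carrier (GL n)"
  then have "A \<in> carrier_mat n n" "B \<in> carrier_mat n n" unfolding carrier_GL by auto
  then show "map_mat of_int (A \<otimes>\<^bsub>GL n\<^esub> B) =
      map_mat of_int A \<otimes>\<^bsub>GL n\<^esub> (map_mat of_int B :: 'r mat)"
    using of_int_hom.mat_hom_mult[of A n n B n] by simp
qed (rule map_mat_of_int_GL)

lemma map_mat_of_int_inj: "inj_on (map_mat (of_int :: int \<Rightarrow> complex)) S"
proof (rule inj_onI)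
  fix A B :: "int mat"
  assume eq: "map_mat (of_int :: int \<Rightarrow> complex) A = map_mat of_int B"
  show "A = B"
  proof (rule eq_matI)
    show dims: "dim_row A = dim_row B" "dim_col A = dim_col B"
      using arg_cong[OF eq, of dim_row] arg_cong[OF eq, of dim_col] by simp_all
    fix i j assume "i < dim_row B" "j < dim_col B"
    then show "A $$ (i, j) = B $$ (i, j)"
      using arg_cong[OF eq, of "\<lambda>M. M $$ (i, j)"] dims by simp
  qed
qed

section \<open>Integral points of the algebraic group\<close>

context sorted_pc_graph
begin

lemma map_mat_cl_mats:
  assumes "A \<in> carrier_mat k k"
  shows "map_mat (of_int :: int \<Rightarrow> complex) A \<in> cl_mats \<longleftrightarrow> A \<in> cl_mats"
  using assms by (simp add: cl_mats_def)

text \<open>An element of the integral general linear group has an integral inverse by definition.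
  That this inverse is again an incidence matrix comes from \<open>cl_mats_inverse\<close>, which
  works over a field, hence the passage to complex entries and back.\<close>

lemma S_X_eq: "S_X \<Gamma> xs = cl_mats \<inter> carrier (GL k)"
proof
  show "S_X \<Gamma> xs \<subseteq> cl_mats \<inter> carrier (GL k)"
  proof
    fix A assume "A \<in> S_X \<Gamma> xs"
    then obtain \<phi> where \<phi>: "A = aut_matrix \<Gamma> xs \<phi>" "\<phi> \<in> St_L \<Gamma>"
      unfolding image_aut_matrix[symmetric] by (rule imageE)
    show "A \<in> cl_mats \<inter> carrier (GL k)"
      using aut_matrix_cl_mats[OF \<phi>(2)] aut_matrix_GL[OF \<phi>(2)] \<phi>(1) by simp
  qed
  show "cl_mats \<inter> carrier (GL k) \<subseteq> S_X \<Gamma> xs"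
  proof
    fix A :: "int mat" assume A: "A \<in> cl_mats \<inter> carrier (GL k)"
    then obtain B where B: "B \<in> carrier_mat k k" "A * B = 1\<^sub>m k" "B * A = 1\<^sub>m k"
      unfolding carrier_GL by blast
    have AC: "A \<in> carrier_mat k k" using A cl_mats_carrier by blast
    let ?c = "map_mat (of_int :: int \<Rightarrow> complex)"
    have "?c B \<in> cl_mats"
    proof (rule cl_mats_inverse)
      show "?c A \<in> cl_mats" using A by (simp add: map_mat_cl_mats[OF AC])
      show "?c B \<in> carrier_mat k k" using B by simp
      show "?c A * ?c B = 1\<^sub>m k"
        using of_int_hom.mat_hom_mult[OF AC B(1), where 'a = complex] B(2)
        by (simp add: of_int_hom.mat_hom_one)
    qed
    then have "B \<in> cl_mats" by (simp add: map_mat_cl_mats[OF B(1)])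
    then show "A \<in> S_X \<Gamma> xs"
      using block_unit_inverse[of A B] A B unfolding in_S_X_iff by blast
  qed
qed

abbreviation St_L_group :: "('a word set \<Rightarrow> 'a word set) monoid" where
  "St_L_group \<equiv> (right_Aut G)\<lparr>carrier := St_L \<Gamma>\<rparr>"

lemma group_St_L: "group St_L_group"
  by (rule RA.subgroup_imp_group[OF subgroup_St_L])

lemma aut_matrix_hom: "aut_matrix \<Gamma> xs \<in> hom St_L_group (GL k)"
  using aut_matrix_GL aut_matrix_mult by (intro homI) simp_all

lemma subgroup_S_X: "subgroup (S_X \<Gamma> xs) (GL k)"
proof -
  interpret M: group_hom St_L_group "GL k" "aut_matrix \<Gamma> xs"
    using group_St_L group_GL aut_matrix_hom by (simp add: group_hom_def group_hom_axioms_def)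
  show ?thesis using M.img_is_subgroup by (simp add: image_aut_matrix)
qed

lemma arithmetic_St_L: "arithmetic_group St_L_group"
  unfolding arithmetic_group_def
proof (intro conjI exI)
  let ?c = "map_mat (of_int :: int \<Rightarrow> complex)"
  let ?A = "?c ` S_X \<Gamma> xs"
  show "group St_L_group" by (rule group_St_L)
  show "Q_defined_algebraic_group k cl_GL" by (rule Q_defined_cl_GL)
  \<comment> \<open>The image of S_X is the full group of integral points, so it is trivially
    commensurable with it.\<close>
  have H: "cl_GL \<inter> GL_int k = ?A"
  proof
    show "?A \<subseteq> cl_GL \<inter> GL_int k"
    proof
      fix M assume "M \<in> ?A"
      then obtain A where A: "M = ?c A" "A \<in> S_X \<Gamma> xs" by (rule imageE)
      then have "A \<in> cl_mats" "A \<in> carrier (GL k)" by (simp_all add: S_X_eq)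
      then show "M \<in> cl_GL \<inter> GL_int k"
        using A(1) map_mat_cl_mats[OF cl_mats_carrier] map_mat_of_int_GL
        by (simp add: cl_GL_def GL_int_def)
    qed
    show "cl_GL \<inter> GL_int k \<subseteq> ?A"
    proof
      fix M assume M: "M \<in> cl_GL \<inter> GL_int k"
      then obtain A where A: "M = ?c A" "A \<in> carrier (GL k)" by (auto simp: GL_int_def)
      have "A \<in> carrier_mat k k" using A(2) unfolding carrier_GL by blast
      then have "A \<in> cl_mats" using M A(1) map_mat_cl_mats by (simp add: cl_GL_def)
      then show "M \<in> ?A" using A by (simp add: S_X_eq)
    qed
  qed
  have group_GLc: "group (GL k :: complex mat monoid)" by (rule group_GL)
  have sub: "subgroup ?A (GL k)"
  proof -
    interpret M: group_hom "GL k" "GL k" ?c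
      using group_GL[where 'r = int] group_GLc map_mat_of_int_hom[where 'r = complex]
      by (simp add: group_hom_def group_hom_axioms_def)
    show ?thesis by (rule M.subgroup_img_is_subgroup[OF subgroup_S_X])
  qed
  have rat: "?A \<subseteq> GL_rat k"
  proof
    fix M assume "M \<in> ?A"
    then obtain A where A: "M = ?c A" "A \<in> S_X \<Gamma> xs" by (rule imageE)
    \<comment> \<open>The embedding of the integers in the complex numbers is factored through the
      rationals.\<close>
    have "M = map_mat of_rat (map_mat of_int A)" using A(1) by (intro eq_matI) simp_all
    moreover have "map_mat of_int A \<in> carrier (GL k :: rat mat monoid)"
      using A(2) by (intro map_mat_of_int_GL) (simp add: S_X_eq)
    ultimately show "M \<in> GL_rat k" unfolding GL_rat_def by (rule image_eqI)
  qed
  show "arithmetic_subgroup k cl_GL ?A"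
    unfolding arithmetic_subgroup_def commensurable_def H
    using sub rat H finite_index_self[OF group_GLc sub] by auto
  have "?c \<circ> aut_matrix \<Gamma> xs \<in> iso St_L_group ((GL k)\<lparr>carrier := ?A\<rparr>)"
  proof (rule isoI)
    show "?c \<circ> aut_matrix \<Gamma> xs \<in> hom St_L_group ((GL k)\<lparr>carrier := ?A\<rparr>)"
    proof (rule homI)
      fix \<phi> \<psi> assume "\<phi> \<in> carrier St_L_group" "\<psi> \<in> carrier St_L_group"
      then have st: "\<phi> \<in> St_L \<Gamma>" "\<psi> \<in> St_L \<Gamma>" by simp_all
      show "(?c \<circ> aut_matrix \<Gamma> xs) \<phi> \<in> carrier ((GL k)\<lparr>carrier := ?A\<rparr>)"
        using aut_matrix_in_S_X[OF st(1)] by simp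
      show "(?c \<circ> aut_matrix \<Gamma> xs) (\<phi> \<otimes>\<^bsub>St_L_group\<^esub> \<psi>) =
          (?c \<circ> aut_matrix \<Gamma> xs) \<phi> \<otimes>\<^bsub>(GL k)\<lparr>carrier := ?A\<rparr>\<^esub> (?c \<circ> aut_matrix \<Gamma> xs) \<psi>"
        using aut_matrix_mult[OF st]
          of_int_hom.mat_hom_mult[OF cl_mats_carrier[OF aut_matrix_cl_mats[OF st(1)]]
            cl_mats_carrier[OF aut_matrix_cl_mats[OF st(2)]], where 'a = complex]
        by simp
    qed
    have "bij_betw (aut_matrix \<Gamma> xs) (St_L \<Gamma>) (S_X \<Gamma> xs)"
      using aut_matrix_inj image_aut_matrix by (rule bij_betw_imageI)
    moreover have "bij_betw ?c (S_X \<Gamma> xs) ?A"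
      using map_mat_of_int_inj by (rule inj_on_imp_bij_betw)
    ultimately show "bij_betw (?c \<circ> aut_matrix \<Gamma> xs) (carrier St_L_group) (carrier ((GL k)\<lparr>carrier := ?A\<rparr>))"
      using bij_betw_trans by simp
  qed
  then show "St_L_group \<cong> (GL k)\<lparr>carrier := ?A\<rparr>" by (rule is_isoI)
qed

end

section \<open>Heights and the order on the vertices\<close>

lemma less_L_height:
  assumes "finite (pverts \<Gamma>)" "y \<in> pverts \<Gamma>" "less_L \<Gamma> y x"
  shows "height \<Gamma> y < height \<Gamma> x"
proof -
  have "height \<Gamma> y \<le> Max (height \<Gamma> ` {y \<in> pverts \<Gamma>. less_L \<Gamma> y x})"
    using assms by (intro Max_ge) auto
  moreover have "height \<Gamma> x = 1 + Max (height \<Gamma> ` {y \<in> pverts \<Gamma>. less_L \<Gamma> y x})"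
    using assms by (subst height.simps) auto
  ultimately show ?thesis by linarith
qed

text \<open>Irreflexivity of \<open>vertex_less\<close> makes the list distinct. If y <_L x then y
  has smaller height, which excludes the first two ways for y to precede x; the third would put both
  in one class, against the strict inclusion of closures.\<close>

lemma (in pc_graph) sorted_pc_graph:
  assumes "set xs = pverts \<Gamma>" "sorted_wrt (vertex_less \<Gamma> rB rC) xs"
  shows "sorted_pc_graph \<Gamma> xs"
proof -
  have irrefl: "\<not> vertex_less \<Gamma> rB rC x x" for x by (simp add: vertex_less_def)
  have less: "vertex_less \<Gamma> rB rC (xs ! i) (xs ! j)" if "i < j" "j < length xs" for i j
    using sorted_wrt_nth_less[OF assms(2) that] .
  have "distinct xs"
    unfolding distinct_conv_nth
  proof (intro allI impI)
    fix i j assume "i < length xs" "j < length xs" "i \<noteq> j"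
    then show "xs ! i \<noteq> xs ! j"
      using less[of i j] less[of j i] irrefl by (metis linorder_neqE_nat)
  qed
  moreover have "i < j" if ij: "i < length xs" "j < length xs" and L: "less_L \<Gamma> (xs ! j) (xs ! i)" for i j
  proof (rule ccontr)
    assume "\<not> i < j"
    have V: "xs ! i \<in> pverts \<Gamma>" "xs ! j \<in> pverts \<Gamma>" using ij assms(1) nth_mem by blast+
    have h: "height \<Gamma> (xs ! j) < height \<Gamma> (xs ! i)"
      by (rule less_L_height[OF finite_verts V(2) L])
    then have "j < i" using \<open>\<not> i < j\<close> by (cases "i = j") auto
    then have "vertex_less \<Gamma> rB rC (xs ! j) (xs ! i)" using less ij by simp
    then have "eq_class \<Gamma> (xs ! j) = eq_class \<Gamma> (xs ! i)"
      using h by (auto simp: vertex_less_def)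
    then show False using L V eq_class_eq_iff by (simp add: less_L_def)
  qed
  ultimately show ?thesis using assms(1) graph by unfold_locales auto
qed

theorem theorem2p12:
  fixes \<Gamma> :: "'a pair_pre_digraph"
    and rB :: "nat \<Rightarrow> 'a set rel"
    and rC :: "'a set \<Rightarrow> 'a rel"
    and xs :: "'a list"
  assumes "pair_graph \<Gamma>"
    and "\<And>i. linear_order_on (height_level \<Gamma> i) (rB i)"
    and "\<And>x. x \<in> pverts \<Gamma> \<Longrightarrow> linear_order_on (eq_class \<Gamma> x) (rC (eq_class \<Gamma> x))"
    and "set xs = pverts \<Gamma>"
    and "sorted_wrt (vertex_less \<Gamma> rB rC) xs"
  shows "aut_matrix \<Gamma> xs \<in>
           hom ((right_Aut (pc_group \<Gamma>))\<lparr>carrier := St_L \<Gamma>\<rparr>) (GL (card (pverts \<Gamma>)))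
   \<and> inj_on (aut_matrix \<Gamma> xs) (St_L \<Gamma>)
   \<and> aut_matrix \<Gamma> xs ` St_L \<Gamma> = S_X \<Gamma> xs
   \<and> subgroup (S_X \<Gamma> xs) (GL (card (pverts \<Gamma>)))
   \<and> generate (right_Aut (pc_group \<Gamma>)) (J_set \<Gamma> \<union> V_perp \<Gamma> \<union> Tr_perp \<Gamma>) = St_L \<Gamma>
   \<and> arithmetic_group ((right_Aut (pc_group \<Gamma>))\<lparr>carrier := St_L \<Gamma>\<rparr>)"
proof -
  interpret pc_graph \<Gamma> using assms(1) by (rule pc_graph.intro)
  interpret sorted_pc_graph \<Gamma> xs using assms(4,5) by (rule sorted_pc_graph)
  show ?thesis
    unfolding length_xs[symmetric]
    using aut_matrix_hom aut_matrix_inj image_aut_matrix subgroup_S_X generate_eq_St_L arithmetic_St_L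
    by (intro conjI)
qed

end
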